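(* Let $\Omega\subset\mathbb{R}^N$, $N\ge 2$, be a bounded smooth domain, let $H=H(x,u,v)$ be continuous with respect to $x\in\Omega$ and $C^2$ with respect to $(u,v)\in\mathbb{R}^2$, and let $(u,v)$ be a solution to $$-\Delta u=H_v(x,u,v),\quad -\Delta v=H_u(x,u,v)\ \text{ in }\Omega,\qquad u=v=0\ \text{ on }\partial\Omega,$$ such that the functions $H_{uu}(x,u(x),v(x))$, $H_{vv}(x,u(x),v(x))$, $H_{uv}(x,u(x),v(x))$ are bounded on $\Omega$. Set $$a(x)=-\tfrac12\big(H_{uu}(x,u(x),v(x))+H_{vv}(x,u(x),v(x))\big)-H_{uv}(x,u(x),v(x)),$$ $$b(x)=\tfrac12\big(H_{uu}(x,u(x),v(x))+H_{vv}(x,u(x),v(x))\big)-H_{uv}(x,u(x),v(x)).$$ Then the linearized Morse index of $(u,v)$ is the sum of the numbers (counting multiplicity) of negative eigenvalues of the two scalar problems $$\text{(P}_+)\quad -\Delta\phi+a\phi=\mu\phi\ \text{ in }\Omega,\quad \phi=0\ \text{ on }\partial\Omega,$$ $$\text{(P}_-)\quad -\Delta\psi+b\psi=\nu\psi\ \text{ in }\Omega,\quad \psi=0\ \text{ on }\partial\Omega.$$ Moreover the negative eigenspace $W^-$ is spanned by functions of type $(\phi,\phi)$, where $\phi$ solves (P$_+$) (for a negative eigenvalue $\mu$), and $(\psi,-\psi)$, where $\psi$ solves (P$_-$) (for a negative eigenvalue $\nu$). If in addition $H$ satisfies the convexity assumption $H_{uu}\ge 0$, $H_{vv}\ge 0$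 and $H_{uu}H_{vv}\ge (H_{uv})^2$ on $\Omega\times\mathbb{R}^2$, then the linearized Morse index of $(u,v)$ is equal to the number (counting multiplicity) of negative eigenvalues of (P$_+$), and the negative eigenspace $W^-$ is contained in $H^+=\{(\phi,\phi):\phi\in H^1_0(\Omega)\}$.
   Context: Solutions are weak solutions $u,v\in H^1_0(\Omega)$, and eigenvalue problems are understood in the weak sense in $H^1_0(\Omega)$. All second derivatives of $H$ below are evaluated at $(x,u(x),v(x))$, and $\Delta H:=H_{uu}+H_{vv}$. The linearized Morse index of $(u,v)$ is the maximal dimension of a subspace of $(H^1_0(\Omega))^2$ on which the quadratic form $$\mathcal{Q}_{\rm lin}(\phi,\psi)=\int_\Omega\big(|\nabla\phi|^2+|\nabla\psi|^2\big)dx-\int_\Omega\big((H_{uu}+H_{vv})\phi\psi+H_{uv}(\phi^2+\psi^2)\big)dx$$ is negative definite. A number $\Lambda$ is a symmetric eigenvalue, with eigenfunction $(\phi,\psi)\in (H_0^1(\Omega))^2\setminus\{(0,0)\}$, if $(\phi,\psi)$ solves weakly $$-\Delta\phi-H_{uv}\phi-\tfrac12\Delta H\,\psi=\Lambda\phi,\quad -\Delta\psi-\tfrac12\Delta H\,\phi-H_{uv}\psi=\Lambda\psi\ \text{ in }\Omega,\quad \phi=\psi=0\ \text{ on }\partial\Omega.$$ The negative eigenspace $W^-$ is the span of the eigenfunctions $(\phi,\psi)$ associated with negative symmetric eigenvalues. *)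

theory Defs
  imports "HOL-Analysis.Analysis" "HOL-Library.Extended_Nat"
begin

section \<open>Smooth functions and smooth domains\<close>

definition pdiff :: "'a::euclidean_space \<Rightarrow> ('a \<Rightarrow> real) \<Rightarrow> 'a \<Rightarrow> real" where
  "pdiff b f x = frechet_derivative f (at x) b"

text \<open>Intended for open \<open>S\<close>; total differentiability follows anyway from continuity of the partial
  derivatives, it is included so that \<^const>\<open>frechet_derivative\<close> is meaningful.\<close>

primrec Ck_on :: "nat \<Rightarrow> 'a::euclidean_space set \<Rightarrow> ('a \<Rightarrow> real) \<Rightarrow> bool" where
  "Ck_on 0 S f = continuous_on S f"
| "Ck_on (Suc k) S f = (continuous_on S f \<and> (\<forall>x\<in>S. f differentiable (at x)) \<and>
      (\<forall>b\<in>Basis. Ck_on k S (pdiff b f)))"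

definition smooth :: "('a::euclidean_space \<Rightarrow> real) \<Rightarrow> bool" where
  "smooth f \<longleftrightarrow> (\<forall>k. Ck_on k UNIV f)"

definition grad :: "('a::euclidean_space \<Rightarrow> real) \<Rightarrow> 'a \<Rightarrow> 'a" where
  "grad f x = (\<Sum>b\<in>Basis. pdiff b f x *\<^sub>R b)"

text \<open>The boundary is locally the graph, in the direction \<open>e\<close>, of a smooth function \<open>\<gamma>\<close> of the
  coordinates orthogonal to \<open>e\<close>, with \<open>\<Omega>\<close> on one side of it.\<close>

definition smooth_boundary :: "'a::euclidean_space set \<Rightarrow> bool" where
  "smooth_boundary \<Omega> \<longleftrightarrow> (\<forall>p\<in>frontier \<Omega>. \<exists>r>0. \<exists>e \<gamma>. norm e = 1 \<and> smooth \<gamma> \<and>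
     \<Omega> \<inter> ball p r = {x \<in> ball p r. x \<bullet> e > \<gamma> (x - (x \<bullet> e) *\<^sub>R e)})"

definition bounded_smooth_domain :: "'a::euclidean_space set \<Rightarrow> bool" where
  "bounded_smooth_domain \<Omega> \<longleftrightarrow>
     open \<Omega> \<and> connected \<Omega> \<and> \<Omega> \<noteq> {} \<and> bounded \<Omega> \<and> smooth_boundary \<Omega>"

definition test_functions :: "'a::euclidean_space set \<Rightarrow> ('a \<Rightarrow> real) set" where
  "test_functions \<Omega> = {\<eta>. smooth \<eta> \<and> (\<exists>K. compact K \<and> K \<subseteq> \<Omega> \<and> (\<forall>x. x \<notin> K \<longrightarrow> \<eta> x = 0))}"


section \<open>Functions modulo almost everywhere equality\<close>

text \<open>All functions on the whole space are admitted; measurability is imposed where it is needed.\<close>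

quotient_type (overloaded) 'a aefun = "'a::euclidean_space \<Rightarrow> real" /
  "\<lambda>f g. AE x in lebesgue. f x = g x"
proof (rule equivpI)
  show "reflp (\<lambda>f g :: 'a \<Rightarrow> real. AE x in lebesgue. f x = g x)"
    by (auto intro: reflpI)
  show "symp (\<lambda>f g :: 'a \<Rightarrow> real. AE x in lebesgue. f x = g x)"
    by (auto intro!: sympI elim: AE_mp)
  show "transp (\<lambda>f g :: 'a \<Rightarrow> real. AE x in lebesgue. f x = g x)"
  proof (rule transpI)
    fix f g h :: "'a \<Rightarrow> real"
    assume "AE x in lebesgue. f x = g x" "AE x in lebesgue. g x = h x"
    then show "AE x in lebesgue. f x = h x" by eventually_elim simp
  qed
qed

instantiation aefun :: (euclidean_space) real_vector
begin

lift_definition zero_aefun :: "'a aefun" is "\<lambda>_. 0" .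

lift_definition plus_aefun :: "'a aefun \<Rightarrow> 'a aefun \<Rightarrow> 'a aefun" is "\<lambda>f g x. f x + g x"
  by (erule (1) AE_mp [OF AE_conjI]) simp

lift_definition minus_aefun :: "'a aefun \<Rightarrow> 'a aefun \<Rightarrow> 'a aefun" is "\<lambda>f g x. f x - g x"
  by (erule (1) AE_mp [OF AE_conjI]) simp

lift_definition uminus_aefun :: "'a aefun \<Rightarrow> 'a aefun" is "\<lambda>f x. - f x"
  by simp

lift_definition scaleR_aefun :: "real \<Rightarrow> 'a aefun \<Rightarrow> 'a aefun" is "\<lambda>c f x. c * f x"
  by (erule AE_mp) simp

instance
  by standard (transfer; simp add: algebra_simps)+

end


section \<open>The Sobolev space \<open>H\<^sup>1\<^sub>0(\<Omega>)\<close> and weak solutions\<close>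

definition square_integrable :: "'a::euclidean_space set \<Rightarrow> ('a \<Rightarrow> 'b::euclidean_space) \<Rightarrow> bool" where
  "square_integrable \<Omega> f \<longleftrightarrow> f \<in> borel_measurable (lebesgue_on \<Omega>) \<and>
     integrable (lebesgue_on \<Omega>) (\<lambda>x. (norm (f x))\<^sup>2)"

text \<open>\<open>g\<close> is the weak gradient of \<open>f\<close> on \<open>\<Omega>\<close>, both being in \<open>L\<^sup>2(\<Omega>)\<close>; that is, \<open>f \<in> H\<^sup>1(\<Omega>)\<close>.\<close>

definition has_weak_grad :: "'a::euclidean_space set \<Rightarrow> ('a \<Rightarrow> real) \<Rightarrow> ('a \<Rightarrow> 'a) \<Rightarrow> bool" where
  "has_weak_grad \<Omega> f g \<longleftrightarrow> square_integrable \<Omega> f \<and> square_integrable \<Omega> g \<and>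
     (\<forall>\<eta>\<in>test_functions \<Omega>. \<forall>b\<in>Basis.
        (LINT x|lebesgue_on \<Omega>. f x * pdiff b \<eta> x) = - (LINT x|lebesgue_on \<Omega>. (g x \<bullet> b) * \<eta> x))"

text \<open>\<open>H\<^sup>1\<^sub>0(\<Omega>)\<close> is the closure of the test functions in \<open>H\<^sup>1(\<Omega>)\<close>. An element is represented by the class
  of its extension by zero to the whole space.\<close>

definition H10 :: "'a::euclidean_space set \<Rightarrow> 'a aefun set" where
  "H10 \<Omega> = {u. (AE x in lebesgue. x \<notin> \<Omega> \<longrightarrow> rep_aefun u x = 0) \<and>
     (\<exists>g. has_weak_grad \<Omega> (rep_aefun u) g \<and>
       (\<exists>\<eta>. (\<forall>k. \<eta> k \<in> test_functions \<Omega>) \<and>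
          (\<lambda>k::nat. (LINT x|lebesgue_on \<Omega>. (\<eta> k x - rep_aefun u x)\<^sup>2)
             + (LINT x|lebesgue_on \<Omega>. (norm (grad (\<eta> k) x - g x))\<^sup>2)) \<longlonglongrightarrow> 0))}"

definition wgrad :: "'a::euclidean_space set \<Rightarrow> 'a aefun \<Rightarrow> 'a \<Rightarrow> 'a" where
  "wgrad \<Omega> u = (SOME g. has_weak_grad \<Omega> (rep_aefun u) g)"

text \<open>\<open>weak_dirichlet \<Omega> u h f\<close>: \<open>u \<in> H\<^sup>1\<^sub>0(\<Omega>)\<close> is a weak solution of \<open>-\<Delta>u + h = f\<close> in \<open>\<Omega>\<close>, \<open>u = 0\<close> on the
  boundary. Integrability is required explicitly because the Bochner integral of a non-integrable
  function is \<open>0\<close>.\<close>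

definition weak_dirichlet ::
    "'a::euclidean_space set \<Rightarrow> 'a aefun \<Rightarrow> ('a \<Rightarrow> real) \<Rightarrow> ('a \<Rightarrow> real) \<Rightarrow> bool" where
  "weak_dirichlet \<Omega> u h f \<longleftrightarrow> u \<in> H10 \<Omega> \<and>
     (\<forall>\<eta>\<in>test_functions \<Omega>.
        integrable (lebesgue_on \<Omega>) (\<lambda>x. h x * \<eta> x) \<and>
        integrable (lebesgue_on \<Omega>) (\<lambda>x. f x * \<eta> x) \<and>
        (LINT x|lebesgue_on \<Omega>. wgrad \<Omega> u x \<bullet> grad \<eta> x) + (LINT x|lebesgue_on \<Omega>. h x * \<eta> x)
          = (LINT x|lebesgue_on \<Omega>. f x * \<eta> x))"


section \<open>Dimension and negative eigenvalues of scalar problems\<close>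

text \<open>The library's \<^const>\<open>dim\<close> is \<open>0\<close> on infinite-dimensional spaces.\<close>

definition edim :: "'b::real_vector set \<Rightarrow> enat" where
  "edim V = (if \<exists>B. finite B \<and> V \<subseteq> span B then enat (dim V) else \<infinity>)"

definition eigenspace :: "'a::euclidean_space set \<Rightarrow> ('a \<Rightarrow> real) \<Rightarrow> real \<Rightarrow> 'a aefun set" where
  "eigenspace \<Omega> c \<mu> =
     {\<phi>. weak_dirichlet \<Omega> \<phi> (\<lambda>x. c x * rep_aefun \<phi> x) (\<lambda>x. \<mu> * rep_aefun \<phi> x)}"

definition neg_eigenvalues :: "'a::euclidean_space set \<Rightarrow> ('a \<Rightarrow> real) \<Rightarrow> real set" where
  "neg_eigenvalues \<Omega> c = {\<mu>. \<mu> < 0 \<and> (\<exists>\<phi>\<in>eigenspace \<Omega> c \<mu>. \<phi> \<noteq> 0)}"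

text \<open>The sum of the multiplicities of all negative eigenvalues, as an extended natural number.\<close>

definition num_neg_eigenvalues :: "'a::euclidean_space set \<Rightarrow> ('a \<Rightarrow> real) \<Rightarrow> enat" where
  "num_neg_eigenvalues \<Omega> c =
     (SUP F\<in>{F. finite F \<and> F \<subseteq> neg_eigenvalues \<Omega> c}. \<Sum>\<mu>\<in>F. edim (eigenspace \<Omega> c \<mu>))"


section \<open>The Hamiltonian system and its linearization\<close>

text \<open>\<open>H x s t\<close> stands for \<open>H(x,u,v)\<close> at \<open>u = s\<close>, \<open>v = t\<close>.\<close>

definition Du :: "('a \<Rightarrow> real \<Rightarrow> real \<Rightarrow> real) \<Rightarrow> 'a \<Rightarrow> real \<Rightarrow> real \<Rightarrow> real" where
  "Du H x s t = deriv (\<lambda>s'. H x s' t) s"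

definition Dv :: "('a \<Rightarrow> real \<Rightarrow> real \<Rightarrow> real) \<Rightarrow> 'a \<Rightarrow> real \<Rightarrow> real \<Rightarrow> real" where
  "Dv H x s t = deriv (\<lambda>t'. H x s t') t"

abbreviation "Huu H \<equiv> Du (Du H)"
abbreviation "Hvv H \<equiv> Dv (Dv H)"
abbreviation "Huv H \<equiv> Dv (Du H)"

definition along :: "('a::euclidean_space \<Rightarrow> real \<Rightarrow> real \<Rightarrow> real) \<Rightarrow> 'a aefun \<Rightarrow> 'a aefun \<Rightarrow> 'a \<Rightarrow> real" where
  "along F u v x = F x (rep_aefun u x) (rep_aefun v x)"

definition ess_bounded_on :: "'a::euclidean_space set \<Rightarrow> ('a \<Rightarrow> real) \<Rightarrow> bool" where
  "ess_bounded_on \<Omega> f \<longleftrightarrow> (\<exists>C. AE x in lebesgue_on \<Omega>. \<bar>f x\<bar> \<le> C)"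

definition hamiltonian_solution ::
    "'a::euclidean_space set \<Rightarrow> ('a \<Rightarrow> real \<Rightarrow> real \<Rightarrow> real) \<Rightarrow> 'a aefun \<Rightarrow> 'a aefun \<Rightarrow> bool" where
  "hamiltonian_solution \<Omega> H u v \<longleftrightarrow>
     weak_dirichlet \<Omega> u (\<lambda>x. 0) (along (Dv H) u v) \<and>
     weak_dirichlet \<Omega> v (\<lambda>x. 0) (along (Du H) u v)"

definition Qlin ::
    "'a::euclidean_space set \<Rightarrow> ('a \<Rightarrow> real \<Rightarrow> real \<Rightarrow> real) \<Rightarrow> 'a aefun \<Rightarrow> 'a aefun \<Rightarrow>
     'a aefun \<times> 'a aefun \<Rightarrow> real" where
  "Qlin \<Omega> H u v = (\<lambda>(\<phi>, \<psi>).
     (LINT x|lebesgue_on \<Omega>. (norm (wgrad \<Omega> \<phi> x))\<^sup>2 + (norm (wgrad \<Omega> \<psi> x))\<^sup>2)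
     - (LINT x|lebesgue_on \<Omega>.
          (along (Huu H) u v x + along (Hvv H) u v x) * (rep_aefun \<phi> x * rep_aefun \<psi> x)
          + along (Huv H) u v x * ((rep_aefun \<phi> x)\<^sup>2 + (rep_aefun \<psi> x)\<^sup>2)))"

text \<open>The maximal dimension, taken in the extended natural numbers; a finite supremum is attained.\<close>

definition lin_morse_index ::
    "'a::euclidean_space set \<Rightarrow> ('a \<Rightarrow> real \<Rightarrow> real \<Rightarrow> real) \<Rightarrow> 'a aefun \<Rightarrow> 'a aefun \<Rightarrow> enat" where
  "lin_morse_index \<Omega> H u v =
     (SUP V\<in>{V. subspace V \<and> V \<subseteq> H10 \<Omega> \<times> H10 \<Omega> \<and> (\<forall>w\<in>V. w \<noteq> 0 \<longrightarrow> Qlin \<Omega> H u v w < 0)}. edim V)"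

definition sym_eigenfunction ::
    "'a::euclidean_space set \<Rightarrow> ('a \<Rightarrow> real \<Rightarrow> real \<Rightarrow> real) \<Rightarrow> 'a aefun \<Rightarrow> 'a aefun \<Rightarrow> real \<Rightarrow>
     'a aefun \<times> 'a aefun \<Rightarrow> bool" where
  "sym_eigenfunction \<Omega> H u v \<Lambda> = (\<lambda>(\<phi>, \<psi>). (\<phi>, \<psi>) \<noteq> 0 \<and>
     weak_dirichlet \<Omega> \<phi>
       (\<lambda>x. - along (Huv H) u v x * rep_aefun \<phi> x
            - 1/2 * (along (Huu H) u v x + along (Hvv H) u v x) * rep_aefun \<psi> x)
       (\<lambda>x. \<Lambda> * rep_aefun \<phi> x) \<and>
     weak_dirichlet \<Omega> \<psi>
       (\<lambda>x. - 1/2 * (along (Huu H) u v x + along (Hvv H) u v x) * rep_aefun \<phi> x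
            - along (Huv H) u v x * rep_aefun \<psi> x)
       (\<lambda>x. \<Lambda> * rep_aefun \<psi> x))"

definition neg_eigenspace ::
    "'a::euclidean_space set \<Rightarrow> ('a \<Rightarrow> real \<Rightarrow> real \<Rightarrow> real) \<Rightarrow> 'a aefun \<Rightarrow> 'a aefun \<Rightarrow>
     ('a aefun \<times> 'a aefun) set" where
  "neg_eigenspace \<Omega> H u v = span {w. \<exists>\<Lambda><0. sym_eigenfunction \<Omega> H u v \<Lambda> w}"

end

theory Submission
  imports Defs
begin

text \<open>
For a pair \<open>(\<phi>, \<psi>)\<close> put \<open>p = \<phi> + \<psi>\<close> and \<open>q = \<phi> - \<psi>\<close>. Then \<open>4 \<phi> \<psi> = p\<^sup>2 - q\<^sup>2\<close> and \<open>2 (\<phi>\<^sup>2 + \<psi>\<^sup>2) = p\<^sup>2 + q\<^sup>2\<close>, so that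
the coupled quadratic form is \<open>(Q\<^sub>a(p) + Q\<^sub>b(q)) / 2\<close> with the scalar forms
\<open>Q\<^sub>c(p) = \<integral> \<bar>\<nabla>p\<bar>\<^sup>2 + c p\<^sup>2\<close>. In the same way the sum and the difference of the two equations of the
symmetric eigenvalue problem are the scalar problems with potentials \<open>a\<close> and \<open>b\<close> and the same eigenvalue
(\<open>coupled_form_decouples\<close>, \<open>coupled_eigenfunction_iff\<close>). The description of the negative eigenspace follows
by linear algebra. If \<open>H\<close> is convex in \<open>(u, v)\<close>, then \<open>b \<ge> 0\<close> and the problem with potential \<open>b\<close> has no
negative eigenvalue.

For the Morse index it remains to see that the index of \<open>Q\<^sub>c\<close> on \<open>H\<^sup>1\<^sub>0(\<Omega>)\<close> is the dimension of the span \<open>E\<close> of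
the eigenfunctions with negative eigenvalue, in a form that applies to both problems at once. The form
is negative on \<open>E\<close>, because eigenfunctions for different eigenvalues are orthogonal. The main point is that
it is nonnegative on the orthogonal complement of \<open>E\<close> in \<open>L\<^sup>2\<close> (\<open>B_nonneg_orth_E\<close>): otherwise its negative
infimum over the unit sphere there would be attained, and attained at an eigenfunction that had to
lie both in \<open>E\<close> and in its complement. A negative subspace for the pair of forms of dimension larger than
\<open>dim E\<^sub>a + dim E\<^sub>b\<close> would contain a nonzero element whose sum and difference are orthogonal to the two
eigenspaces, and there the form is nonnegative (\<open>morse_index_decoupled\<close>).

The minimum is attained because \<open>H\<^sup>1\<^sub>0(\<Omega>)\<close> is complete (\<open>Riesz_Fischer_l2\<close>, \<open>H10_complete\<close>) and by a
quantitative version of Rellich's theorem (\<open>Rellich_inequality\<close>, \<open>H10_compact\<close>): for every \<open>\<epsilon> > 0\<close> there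
are finitely many bounded functionals with \<open>\<parallel>u\<parallel>\<^sup>2 \<le> \<epsilon> \<parallel>\<nabla>u\<parallel>\<^sup>2 + \<Sum>i. (l\<^sub>i u)\<^sup>2\<close>. Once these functionals converge along
a minimizing sequence, the parallelogram inequality makes the sequence Cauchy in \<open>H\<^sup>1\<close>. The same
inequality shows that negative subspaces have finite dimension, so all the numbers involved are
finite. For test functions it is obtained by comparison with averages over the cells of a fine grid.

Two facts make these arguments applicable to the given data. Weak gradients are unique by the
fundamental lemma of the calculus of variations, so the selected gradients depend linearly on the
function up to null sets. And the second derivatives of \<open>H\<close> along the solution are measurable, being
compositions of Caratheodory functions with measurable ones.
\<close>

section \<open>Finite-dimensional linear algebra\<close>

definition linear_on :: "'x::real_vector set \<Rightarrow> ('x \<Rightarrow> real) \<Rightarrow> bool" where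
  "linear_on V l \<longleftrightarrow> (\<forall>x\<in>V. \<forall>y\<in>V. l (x + y) = l x + l y) \<and> (\<forall>x\<in>V. \<forall>c. l (c *\<^sub>R x) = c * l x)"

lemma linear_on_diff:
  assumes "subspace V" "linear_on V l" "x \<in> V" "y \<in> V"
  shows "l (x - y) = l x - l y"
proof -
  have "l (x + (-1) *\<^sub>R y) = l x + (-1) * l y"
    using assms unfolding linear_on_def by (metis subspace_scale)
  then show ?thesis by simp
qed

lemma linear_on_compose:
  assumes "linear_on W l" "linear f" "\<And>x. x \<in> V \<Longrightarrow> f x \<in> W"
  shows "linear_on V (\<lambda>x. l (f x))"
  using assms(1,3) unfolding linear_on_def by (simp add: linear_add[OF assms(2)] linear_scale[OF assms(2)])

text \<open>One linear condition lowers the dimension by at most one, so the proof is an induction on the number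
of conditions. Finite-dimensionality of \<open>V\<close> is part of the conclusion: the spaces to which this is
applied sit inside an infinite-dimensional one.\<close>

lemma finite_dim_if_functionals_separate:
  fixes V :: "'x::real_vector set" and l :: "nat \<Rightarrow> 'x \<Rightarrow> real"
  assumes "subspace V" "\<And>i. i < K \<Longrightarrow> linear_on V (l i)"
    and "\<And>w. w \<in> V \<Longrightarrow> (\<And>i. i < K \<Longrightarrow> l i w = 0) \<Longrightarrow> w = 0"
  shows "\<exists>T. finite T \<and> card T \<le> K \<and> V \<subseteq> span T"
  using assms
proof (induction K arbitrary: V)
  case 0
  then have "V \<subseteq> span {}" by auto
  then show ?case by (intro exI[of _ "{}"]) simp
next
  case (Suc K)
  define V' where "V' = {x \<in> V. l K x = 0}"
  have lin: "linear_on V (l K)" using Suc.prems(2) by blast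
  have sub: "subspace V'"
    unfolding V'_def
  proof (rule subspaceI)
    have "0 \<in> V" using Suc.prems(1) by (rule subspace_0)
    then have "l K (0 *\<^sub>R 0) = 0 * l K 0" using lin unfolding linear_on_def by blast
    then show "0 \<in> {x \<in> V. l K x = 0}" using \<open>0 \<in> V\<close> by simp
  qed (use Suc.prems(1) lin in \<open>auto simp: linear_on_def subspace_add subspace_scale\<close>)
  have "\<exists>T. finite T \<and> card T \<le> K \<and> V' \<subseteq> span T"
  proof (rule Suc.IH[OF sub])
    show "linear_on V' (l i)" if "i < K" for i
      using Suc.prems(2)[of i] that unfolding V'_def linear_on_def by auto
    show "w = 0" if "w \<in> V'" "\<And>i. i < K \<Longrightarrow> l i w = 0" for w
      using that Suc.prems(3)[of w] unfolding V'_def by (auto simp: less_Suc_eq)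
  qed
  then obtain T where T: "finite T" "card T \<le> K" "V' \<subseteq> span T" by blast
  show ?case
  proof (cases "V = V'")
    case True
    then show ?thesis using T by (intro exI[of _ T]) auto
  next
    case False
    then obtain s where s: "s \<in> V" "l K s \<noteq> 0" unfolding V'_def by blast
    have "x \<in> span (insert s T)" if x: "x \<in> V" for x
    proof -
      define c where "c = l K x / l K s"
      have cs: "c *\<^sub>R s \<in> V" using s Suc.prems(1) by (simp add: subspace_scale)
      have "l K (x - c *\<^sub>R s) = l K x - c * l K s"
        using linear_on_diff[OF Suc.prems(1) lin x cs] lin s by (simp add: linear_on_def)
      then have "x - c *\<^sub>R s \<in> V'"
        using s x cs Suc.prems(1) by (auto simp: V'_def c_def subspace_diff)
      then have "x - c *\<^sub>R s \<in> span T" using T by blast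
      then show ?thesis unfolding span_insert by blast
    qed
    then show ?thesis using T
      by (intro exI[of _ "insert s T"]) (auto simp: card_insert_if)
  qed
qed

lemma edim_finite:
  assumes "finite T" "V \<subseteq> span T"
  shows "edim V = enat (dim V)"
proof -
  have "\<exists>B. finite B \<and> V \<subseteq> span B" using assms by blast
  then show ?thesis unfolding edim_def by (rule if_P)
qed

text \<open>This is how Morse indices are bounded from above: on a subspace where a form is negative, any
functionals whose common kernel carries a nonnegative form must separate points.\<close>

lemma edim_le_if_functionals_separate:
  assumes "subspace V" "\<And>i. i < K \<Longrightarrow> linear_on V (l i)"
    and "\<And>w. w \<in> V \<Longrightarrow> (\<And>i. i < K \<Longrightarrow> l i w = 0) \<Longrightarrow> w = 0"
  shows "edim V \<le> enat K"
proof -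
  have "\<exists>T. finite T \<and> card T \<le> K \<and> V \<subseteq> span T"
    by (rule finite_dim_if_functionals_separate[where l = l]) (fact assms)+
  then obtain T where T: "finite T" "card T \<le> K" "V \<subseteq> span T"
    by blast
  have "dim V \<le> K" using dim_le_card[OF T(3,1)] T(2) by (rule order_trans)
  then show ?thesis unfolding edim_finite[OF T(1,3)] by simp
qed

text \<open>If \<open>b \<in> T\<close> were in the span of \<open>S\<close> and the rest of \<open>T\<close>, then \<open>b\<close> minus its part along the rest of \<open>T\<close>
would lie in both spans, hence vanish.\<close>

lemma independent_Un:
  assumes "independent S" "independent T" "finite T" "span S \<inter> span T = {0}"
  shows "independent (S \<union> T) \<and> S \<inter> T = {}"
proof
  show "independent (S \<union> T)"
    using assms(3,2,4)
  proof (induction T rule: finite_induct)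
    case empty
    then show ?case using assms(1) by simp
  next
    case (insert b T)
    have sub: "span T \<subseteq> span (insert b T)" by (intro span_mono) auto
    have "independent T" using insert.prems(1) by (rule independent_mono) blast
    moreover have "span S \<inter> span T = {0}"
      using insert.prems(2) sub span_zero[of S] span_zero[of T] by blast
    ultimately have ind: "independent (S \<union> T)" by (rule insert.IH)
    have "b \<notin> span (S \<union> T)"
    proof
      assume "b \<in> span (S \<union> T)"
      then obtain x y where xy: "b = x + y" "x \<in> span S" "y \<in> span T"
        unfolding span_Un by blast
      have "x = b - y" using xy by simp
      moreover have "b - y \<in> span (insert b T)"
        using xy(3) sub by (intro span_diff) (auto intro: span_base)
      ultimately have "x \<in> span S \<inter> span (insert b T)" using xy(2) by simp
      then have "x = 0" using insert.prems(2) by simp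
      then have "b \<in> span T" using xy by simp
      then show False using insert.prems(1) insert.hyps by (simp add: independent_insert)
    qed
    then show ?case using ind by (simp add: independent_insert)
  qed
  have "0 \<notin> S" using assms(1) dependent_zero by blast
  moreover have "S \<inter> T \<subseteq> {0}" unfolding assms(4)[symmetric]
    by (intro Int_mono span_superset)
  ultimately show "S \<inter> T = {}" by blast
qed

lemma dim_sum_direct:
  assumes "subspace V" "subspace V'" "V \<inter> V' = {0}"
    and "finite T" "V \<subseteq> span T" "finite T'" "V' \<subseteq> span T'"
  shows "dim (span (V \<union> V')) = dim V + dim V'"
proof -
  obtain S where S: "S \<subseteq> V" "independent S" "V \<subseteq> span S" "card S = dim V"
    using basis_exists by blast
  obtain S' where S': "S' \<subseteq> V'" "independent S'" "V' \<subseteq> span S'" "card S' = dim V'"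
    using basis_exists by blast
  have sp: "span S = V" "span S' = V'"
    using S S' assms by (simp_all add: span_subspace)
  have fin: "finite S" "finite S'"
    using independent_span_bound[OF assms(4) S(2)] independent_span_bound[OF assms(6) S'(2)]
      S(1) S'(1) assms(5,7) by (meson subset_trans)+
  have ind: "independent (S \<union> S')" "S \<inter> S' = {}"
    using independent_Un[OF S(2) S'(2) fin(2)] sp assms(3) by simp_all
  have "span (V \<union> V') = span (S \<union> S')"
    unfolding span_Un sp using assms(1,2) by (simp add: span_eq_iff[THEN iffD2])
  then have "dim (span (V \<union> V')) = card (S \<union> S')"
    using ind by (simp add: dim_eq_card_independent)
  then show ?thesis using ind fin S S' by (simp add: card_Un_disjoint)
qed

lemma finite_dim_mono:
  assumes "V \<subseteq> V'" "finite T" "V' \<subseteq> span T"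
  shows "dim V \<le> dim V'"
proof -
  obtain S where S: "S \<subseteq> V" "independent S" "V \<subseteq> span S" "card S = dim V"
    using basis_exists by blast
  obtain S' where S': "S' \<subseteq> V'" "independent S'" "V' \<subseteq> span S'" "card S' = dim V'"
    using basis_exists by blast
  have "finite S'"
    using independent_span_bound[OF assms(2) S'(2)] S'(1) assms(3) by (meson subset_trans)
  then show ?thesis
    using independent_span_bound[OF _ S(2), of S'] S S' assms(1) by (metis subset_trans)
qed

section \<open>Symmetric bilinear forms\<close>

definition sym_bilinear_on :: "'x::real_vector set \<Rightarrow> ('x \<Rightarrow> 'x \<Rightarrow> real) \<Rightarrow> bool" where
  "sym_bilinear_on W B \<longleftrightarrow> (\<forall>x\<in>W. linear_on W (B x)) \<and> (\<forall>x\<in>W. \<forall>y\<in>W. B x y = B y x)"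

lemma sym_bilinear_onD:
  assumes "sym_bilinear_on W B" "subspace W" "x \<in> W" "y \<in> W" "z \<in> W"
  shows "B x y = B y x" "B x (y + z) = B x y + B x z" "B (y + z) x = B y x + B z x"
    "B x (c *\<^sub>R y) = c * B x y" "B (c *\<^sub>R y) x = c * B y x"
    "B x (y - z) = B x y - B x z" "B (y - z) x = B y x - B z x"
    "B 0 x = 0" "B x 0 = 0"
proof -
  have *: "B x (y + z) = B x y + B x z" "B x (c *\<^sub>R y) = c * B x y"
    "B x (y - z) = B x y - B x z" "B x y = B y x" "B x z = B z x"
    using assms linear_on_diff[of W "B x" y z] unfolding sym_bilinear_on_def linear_on_def by blast+
  have m: "y + z \<in> W" "c *\<^sub>R y \<in> W" "y - z \<in> W" "0 \<in> W"
    using assms by (simp_all add: subspace_add subspace_scale subspace_diff subspace_0)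
  have s: "B u v = B v u" if "u \<in> W" "v \<in> W" for u v
    using assms that unfolding sym_bilinear_on_def by blast
  have z: "B x 0 = 0" using assms unfolding sym_bilinear_on_def linear_on_def
    by (metis mult_zero_left scaleR_zero_left)
  show "B x y = B y x" "B x (y + z) = B x y + B x z" "B x (c *\<^sub>R y) = c * B x y"
    "B x (y - z) = B x y - B x z" "B x 0 = 0" using * z by auto
  show "B (y + z) x = B y x + B z x" "B (c *\<^sub>R y) x = c * B y x" "B (y - z) x = B y x - B z x"
    "B 0 x = 0"
    using * z m s assms by metis+
qed

lemma sym_bilinear_on_comb:
  assumes "sym_bilinear_on W A" "sym_bilinear_on W B"
  shows "sym_bilinear_on W (\<lambda>x y. A x y + c * B x y)"
  using assms unfolding sym_bilinear_on_def linear_on_def by (auto simp: algebra_simps)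

lemma sym_bilinear_on_subset:
  assumes "sym_bilinear_on W A" "V \<subseteq> W"
  shows "sym_bilinear_on V A"
  using assms unfolding sym_bilinear_on_def linear_on_def by (meson subsetD)

lemma sym_bilinear_quadratic:
  assumes "sym_bilinear_on W B" "subspace W" "x \<in> W" "y \<in> W"
  shows "B (x + c *\<^sub>R y) (x + c *\<^sub>R y) = B x x + 2 * c * B x y + c\<^sup>2 * B y y"
proof -
  note bl = sym_bilinear_onD[OF assms(1,2)]
  have m: "c *\<^sub>R y \<in> W" "x + c *\<^sub>R y \<in> W"
    using assms by (simp_all add: subspace_add subspace_scale)
  show ?thesis
    using bl(3)[of "x + c *\<^sub>R y" x "c *\<^sub>R y"] bl(2)[of x x "c *\<^sub>R y"] bl(5)[of "x + c *\<^sub>R y" y y c]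
      bl(4)[of x y y c] bl(2)[of y x "c *\<^sub>R y"] bl(4)[of y y y c] bl(1)[of y x x] assms m
    by (simp add: power2_eq_square algebra_simps)
qed

text \<open>The form need not be definite. A vector of zero energy is then orthogonal to all others, which is
what turns minimality into an eigenvalue equation in the direct method below.\<close>

lemma form_Cauchy_Schwarz:
  assumes B: "sym_bilinear_on W B" "subspace W" and nn: "\<And>x. x \<in> W \<Longrightarrow> B x x \<ge> 0"
    and xy: "x \<in> W" "y \<in> W"
  shows "(B x y)\<^sup>2 \<le> B x x * B y y"
proof (cases "B y y = 0")
  case True
  have "B x y = 0"
  proof (rule ccontr)
    assume n: "B x y \<noteq> 0"
    define c where "c = - (B x x + 1) / (2 * B x y)"
    have "x + c *\<^sub>R y \<in> W" using assms by (simp add: subspace_add subspace_scale)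
    then have "0 \<le> B (x + c *\<^sub>R y) (x + c *\<^sub>R y)" by (rule nn)
    also have "\<dots> = -1" unfolding sym_bilinear_quadratic[OF B xy] True c_def using n by (simp add: field_simps)
    finally show False by simp
  qed
  then show ?thesis using True by simp
next
  case False
  then have pos: "B y y > 0" using nn[OF xy(2)] by simp
  define c where "c = - B x y / B y y"
  have "x + c *\<^sub>R y \<in> W" using assms by (simp add: subspace_add subspace_scale)
  then have "0 \<le> B (x + c *\<^sub>R y) (x + c *\<^sub>R y)" by (rule nn)
  also have "\<dots> = B x x - (B x y)\<^sup>2 / B y y"
    unfolding sym_bilinear_quadratic[OF B xy] c_def using pos
    by (simp add: field_simps power2_eq_square)
  finally show ?thesis using pos by (simp add: field_simps)
qed

lemma form_parallelogram:
  assumes B: "sym_bilinear_on W B" "subspace W" and nn: "\<And>x. x \<in> W \<Longrightarrow> B x x \<ge> 0"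
    and xy: "x \<in> W" "y \<in> W"
  shows "B (x - y) (x - y) \<le> 2 * B x x + 2 * B y y" "B (x + y) (x + y) \<le> 2 * B x x + 2 * B y y"
proof -
  have "x + y \<in> W" "x - y \<in> W" using assms by (simp_all add: subspace_add subspace_diff)
  then have "0 \<le> B (x + y) (x + y)" "0 \<le> B (x - y) (x - y)" using nn by auto
  then show "B (x - y) (x - y) \<le> 2 * B x x + 2 * B y y" "B (x + y) (x + y) \<le> 2 * B x x + 2 * B y y"
    using sym_bilinear_quadratic[OF B xy, of 1] sym_bilinear_quadratic[OF B xy, of "-1"] by auto
qed

text \<open>Gram-Schmidt: a further spanning vector is first made orthogonal to the span treated so far. If nothing
remains of it, its coefficient is a division by zero, but then it contributes nothing.\<close>

lemma orthogonal_projection_finite_dim: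
  assumes G: "sym_bilinear_on W G" "subspace W" and pos: "\<And>x. x \<in> W \<Longrightarrow> x \<noteq> 0 \<Longrightarrow> G x x > 0"
    and T: "finite T" "T \<subseteq> W" and z: "z \<in> W"
  shows "\<exists>e\<in>span T. \<forall>y\<in>span T. G (z - e) y = 0"
  using T z
proof (induction T arbitrary: z rule: finite_induct)
  case empty
  have "G (z - 0) 0 = 0" using sym_bilinear_onD(9)[OF G, of z] empty by simp
  then show ?case by auto
next
  case (insert b T)
  note bl = sym_bilinear_onD[OF G]
  have TW: "span T \<subseteq> W" using insert.prems G(2) by (simp add: span_minimal)
  have b: "b \<in> W" using insert.prems by simp
  obtain f where f: "f \<in> span T" "\<And>y. y \<in> span T \<Longrightarrow> G (b - f) y = 0"
    using insert.IH[of b] insert.prems by auto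
  obtain e where e: "e \<in> span T" "\<And>y. y \<in> span T \<Longrightarrow> G (z - e) y = 0"
    using insert.IH[of z] insert.prems by auto
  have fW: "f \<in> W" "e \<in> W" "z \<in> W" using f e TW insert.prems by auto
  (* the component of b orthogonal to the span of T *)
  define b' where "b' = b - f"
  have b': "b' \<in> W" "\<And>y. y \<in> span T \<Longrightarrow> G b' y = 0" using f fW b G(2) by (auto simp: b'_def subspace_diff)
  define c where "c = G z b' / G b' b'"
  define e' where "e' = e + c *\<^sub>R b'"
  have sub: "span T \<subseteq> span (insert b T)" by (intro span_mono) auto
  have "b' \<in> span (insert b T)" unfolding b'_def
    using f sub by (intro span_diff) (auto intro: span_base)
  then have e': "e' \<in> span (insert b T)" unfolding e'_def
    using e sub by (intro span_add span_scale) auto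
  have zb: "c * G b' b' = G z b'"
  proof (cases "b' = 0")
    case True
    then show ?thesis using bl(8,9) fW b' by simp
  next
    case False
    then have "G b' b' > 0" using pos b' by blast
    then show ?thesis by (simp add: c_def)
  qed
  have "G (z - e') y = 0" if y: "y \<in> span (insert b T)" for y
  proof -
    obtain k where k: "y - k *\<^sub>R b \<in> span T" using y span_insert by blast
    define y' where "y' = y - k *\<^sub>R b + k *\<^sub>R f"
    have y': "y' \<in> span T" unfolding y'_def using k f by (intro span_add span_scale) auto
    have yy: "y = y' + k *\<^sub>R b'" unfolding y'_def b'_def by (simp add: algebra_simps)
    have yW: "y' \<in> W" using y' TW by auto
    have m: "c *\<^sub>R b' \<in> W" "k *\<^sub>R b' \<in> W" "e' \<in> W" "z - e \<in> W" "z - e' \<in> W"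
      using b' fW G(2) by (simp_all add: e'_def subspace_scale subspace_add subspace_diff)
    have ze: "z - e' = (z - e) - c *\<^sub>R b'" by (simp add: e'_def)
    have 1: "G (z - e') y' = 0"
      unfolding ze using bl(7)[of y' "z - e" "c *\<^sub>R b'"] bl(5)[of y' b' b' c] m yW b' e(2)[OF y'] b'(2)[OF y'] by simp
    have eb: "G e b' = 0" using b'(2)[OF e(1)] bl(1)[of e b' b'] fW b' by simp
    have "G (z - e') b' = G z b' - G e b' - c * G b' b'"
      unfolding ze using bl(7)[of b' "z - e" "c *\<^sub>R b'"] bl(7)[of b' z e] bl(5)[of b' b' b' c] m fW b' by simp
    then have 2: "G (z - e') b' = 0" using eb zb by simp
    show ?thesis unfolding yy
      using bl(2)[of "z - e'" y' "k *\<^sub>R b'"] bl(4)[of "z - e'" b' b' k] 1 2 m b' yW by simp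
  qed
  then show ?case using e' by blast
qed

section \<open>Negative spectrum of a form with a compactness inequality\<close>

lemma bounded_sequences_common_convergent_subseq:
  fixes x :: "nat \<Rightarrow> nat \<Rightarrow> real"
  assumes "\<And>i n. i < K \<Longrightarrow> \<bar>x i n\<bar> \<le> c"
  shows "\<exists>r. strict_mono r \<and> (\<forall>i<K. convergent (\<lambda>n. x i (r n)))"
  using assms
proof (induction K)
  case 0
  then show ?case by (intro exI[of _ id]) (simp add: strict_mono_def)
next
  case (Suc K)
  then obtain r where r: "strict_mono r" "\<And>i. i < K \<Longrightarrow> convergent (\<lambda>n. x i (r n))"
    using less_SucI by blast
  have "bounded (range (\<lambda>n. x K (r n)))"
    using Suc.prems[of K] by (auto simp: bounded_iff)
  then obtain l s where s: "strict_mono s" "((\<lambda>n. x K (r n)) \<circ> s) \<longlonglongrightarrow> l"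
    using bounded_imp_convergent_subsequence by blast
  have "convergent (\<lambda>n. x i ((r \<circ> s) n))" if "i < Suc K" for i
  proof (cases "i = K")
    case True
    then show ?thesis using s(2) by (auto simp: convergent_def o_def)
  next
    case False
    then have "convergent (\<lambda>n. x i (r n))" using that r(2) by simp
    then show ?thesis using convergent_subseq_convergent[OF _ s(1)] by (auto simp: o_def)
  qed
  moreover have "strict_mono (r \<circ> s)" using r(1) s(1) by (rule strict_mono_o)
  ultimately show ?case by blast
qed

text \<open>The abstract setting for \<open>- \<Delta> + c\<close> on \<open>H\<^sup>1\<^sub>0(\<Omega>)\<close>: \<open>D\<close> is the Dirichlet form, \<open>G\<close> the \<open>L\<^sup>2\<close> inner product and
\<open>C\<close> the form of a bounded potential. Compactness of the embedding into \<open>L\<^sup>2\<close> enters only through the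
last assumption: up to a small multiple of the Dirichlet energy, the \<open>L\<^sup>2\<close> norm is controlled by finitely
many bounded functionals. This replaces the extraction of convergent subsequences in \<open>L\<^sup>2\<close> by
Bolzano-Weierstrass for finitely many real sequences.\<close>

locale compact_form =
  fixes W :: "'x::real_vector set" and D G C :: "'x \<Rightarrow> 'x \<Rightarrow> real" and M :: real
  assumes subspace_W: "subspace W"
    and D_form: "sym_bilinear_on W D" and G_form: "sym_bilinear_on W G"
    and C_form: "sym_bilinear_on W C"
    and D_nonneg: "\<And>x. x \<in> W \<Longrightarrow> D x x \<ge> 0"
    and G_pos: "\<And>x. x \<in> W \<Longrightarrow> x \<noteq> 0 \<Longrightarrow> G x x > 0"
    and C_bound: "\<And>x. x \<in> W \<Longrightarrow> \<bar>C x x\<bar> \<le> M * G x x"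
    and M_pos: "M > 0"
    and complete: "\<And>w. (\<And>n. w n \<in> W) \<Longrightarrow>
        (\<And>e. e > 0 \<Longrightarrow> \<exists>N. \<forall>m\<ge>N. \<forall>n\<ge>N. D (w m - w n) (w m - w n) + G (w m - w n) (w m - w n) < e) \<Longrightarrow>
        \<exists>u\<in>W. (\<lambda>n. D (w n - u) (w n - u) + G (w n - u) (w n - u)) \<longlonglongrightarrow> 0"
    and compact: "\<And>\<epsilon>. \<epsilon> > 0 \<Longrightarrow> \<exists>(K::nat) l c. (\<forall>i<K. linear_on W (l i) \<and> (\<forall>x\<in>W. (l i x)\<^sup>2 \<le> c * G x x)) \<and>
        (\<forall>x\<in>W. G x x \<le> \<epsilon> * D x x + (\<Sum>i<K. (l i x)\<^sup>2))"
begin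

definition B :: "'x \<Rightarrow> 'x \<Rightarrow> real" where "B x y = D x y + C x y"

definition eig :: "real \<Rightarrow> 'x set" where
  "eig \<mu> = {x \<in> W. \<forall>z\<in>W. B x z = \<mu> * G x z}"

definition neg :: "real set" where "neg = {\<mu>. \<mu> < 0 \<and> (\<exists>x\<in>eig \<mu>. x \<noteq> 0)}"

definition E :: "'x set" where "E = span (\<Union>\<mu>\<in>neg. eig \<mu>)"

lemma B_form: "sym_bilinear_on W B"
  using sym_bilinear_on_comb[OF D_form C_form, of 1] unfolding B_def[abs_def] by simp

lemmas W_closed = subspace_add[OF subspace_W] subspace_diff[OF subspace_W] subspace_scale[OF subspace_W]
  subspace_0[OF subspace_W]
lemmas G_bl = sym_bilinear_onD[OF G_form subspace_W]
lemmas B_bl = sym_bilinear_onD[OF B_form subspace_W]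

lemma G_nonneg: "x \<in> W \<Longrightarrow> G x x \<ge> 0"
  using G_pos[of x] G_bl(8)[of x] by (cases "x = 0") force+

lemma B_shift_form: "sym_bilinear_on W (\<lambda>x y. B x y - r * G x y)"
  using sym_bilinear_on_comb[OF B_form G_form, of "-r"] by simp

lemma eig_subset: "eig \<mu> \<subseteq> W" unfolding eig_def by auto

lemma subspace_eig: "subspace (eig \<mu>)"
proof (rule subspaceI)
  show "0 \<in> eig \<mu>" unfolding eig_def using B_bl(8) G_bl(8) W_closed by auto
  show "x + y \<in> eig \<mu>" if "x \<in> eig \<mu>" "y \<in> eig \<mu>" for x y
    using that B_bl(3)[of _ x y] G_bl(3)[of _ x y] W_closed(1)[of x y] unfolding eig_def
    by (auto simp: algebra_simps)
  show "c *\<^sub>R x \<in> eig \<mu>" if "x \<in> eig \<mu>" for x c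
    using that B_bl(5)[of _ x x c] G_bl(5)[of _ x x c] W_closed(3)[of x c] unfolding eig_def
    by (auto simp: algebra_simps)
qed

lemma span_eig_subset: "span (\<Union>\<mu>\<in>F. eig \<mu>) \<subseteq> W"
  using eig_subset subspace_W by (intro span_minimal) auto

lemma E_subset: "E \<subseteq> W" unfolding E_def by (rule span_eig_subset)

lemma subspace_E: "subspace E" unfolding E_def by (rule subspace_span)

lemma eig_E: "\<mu> \<in> neg \<Longrightarrow> eig \<mu> \<subseteq> E" 
  unfolding E_def by (rule order_trans[OF _ span_superset]) blast

lemma G_orth_eig:
  assumes "x \<in> eig \<mu>" "y \<in> eig \<nu>" "\<mu> \<noteq> \<nu>"
  shows "G x y = 0"
proof -
  have xy: "x \<in> W" "y \<in> W" using assms eig_subset by auto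
  have "\<mu> * G x y = B x y" using assms(1) xy unfolding eig_def by simp
  also have "\<dots> = B y x" using B_bl(1)[OF xy xy(2)] .
  also have "\<dots> = \<nu> * G y x" using assms(2) xy unfolding eig_def by simp
  also have "\<dots> = \<nu> * G x y" using G_bl(1)[OF xy xy(2)] by simp
  finally show ?thesis using assms(3) by simp
qed

lemma G_orth_span:
  assumes x: "x \<in> W" and T: "T \<subseteq> W" and orth: "\<And>y. y \<in> T \<Longrightarrow> G x y = 0" and y: "y \<in> span T"
  shows "G x y = 0"
proof -
  have "y \<in> W \<and> G x y = 0"
  proof (rule span_induct[OF y])
    show "subspace {y. y \<in> W \<and> G x y = 0}"
      using G_bl(2)[OF x] G_bl(4)[OF x _ x] G_bl(9)[OF x x x] W_closed x by (auto intro!: subspaceI)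
  qed (use T orth in auto)
  then show ?thesis by simp
qed

lemma eig_Int_span:
  assumes "\<mu> \<notin> F"
  shows "eig \<mu> \<inter> span (\<Union>\<nu>\<in>F. eig \<nu>) = {0}"
proof -
  have "x = 0" if x: "x \<in> eig \<mu>" "x \<in> span (\<Union>\<nu>\<in>F. eig \<nu>)" for x
  proof (rule ccontr)
    assume "x \<noteq> 0"
    have "G x x = 0"
    proof (rule G_orth_span[OF _ _ _ x(2)])
      show "x \<in> W" using x(1) eig_subset by blast
      show "\<Union> (eig ` F) \<subseteq> W" using eig_subset by blast
      show "G x y = 0" if "y \<in> \<Union> (eig ` F)" for y
        using that x(1) assms by (auto intro: G_orth_eig)
    qed
    moreover have "G x x > 0" using G_pos \<open>x \<noteq> 0\<close> x(1) eig_subset by blast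
    ultimately show False by simp
  qed
  then show ?thesis using subspace_0[OF subspace_eig[of \<mu>]] span_zero[of "\<Union> (eig ` F)"] by auto
qed

text \<open>Eigenvectors for different eigenvalues are orthogonal for \<open>G\<close>, hence for \<open>B\<close>, so that \<open>B\<close> is diagonal on a
sum of eigenspaces.\<close>

lemma B_negative_finite_span:
  assumes "finite F" "F \<subseteq> {..<0}" "x \<in> span (\<Union>\<mu>\<in>F. eig \<mu>)" "x \<noteq> 0"
  shows "B x x < 0"
  using assms
proof (induction F arbitrary: x rule: finite_induct)
  case empty
  then show ?case by simp
next
  case (insert \<mu> F)
  have "x \<in> span (eig \<mu> \<union> (\<Union>\<nu>\<in>F. eig \<nu>))" using insert.prems by simp
  then obtain y z where yz: "x = y + z" "y \<in> span (eig \<mu>)" "z \<in> span (\<Union>\<nu>\<in>F. eig \<nu>)"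
    unfolding span_Un by auto
  have y: "y \<in> eig \<mu>" using yz(2) span_eq_iff[THEN iffD2, OF subspace_eig] by simp
  have W: "y \<in> W" "z \<in> W" using y yz(3) eig_subset span_eig_subset[of F] by auto
  have "G y z = 0"
  proof (rule G_orth_span[OF W(1) _ _ yz(3)])
    show "\<Union> (eig ` F) \<subseteq> W" using eig_subset by blast
    show "G y t = 0" if "t \<in> \<Union> (eig ` F)" for t
      using that y insert.hyps by (auto intro: G_orth_eig)
  qed
  then have "B y z = 0" using y W unfolding eig_def by simp
  then have eq: "B x x = B y y + B z z"
    unfolding yz(1) using sym_bilinear_quadratic[OF B_form subspace_W W, of 1] by simp
  have By: "B y y = \<mu> * G y y" using y W unfolding eig_def by simp
  have \<mu>: "\<mu> < 0" using insert.prems by simp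
  show ?case
  proof (cases "z = 0")
    case True
    then have "y \<noteq> 0" using yz insert.prems by simp
    then have "B y y < 0" using By \<mu> G_pos[OF W(1)] by (simp add: mult_neg_pos)
    then show ?thesis using True yz(1) by simp
  next
    case False
    then have "B z z < 0" using insert.IH yz(3) insert.prems by simp
    moreover have "B y y \<le> 0" using By \<mu> G_nonneg[OF W(1)] by (simp add: mult_nonpos_nonneg)
    ultimately show ?thesis using eq by simp
  qed
qed

lemma span_UN_finite:
  assumes "x \<in> span (\<Union>\<mu>\<in>F. eig \<mu>)"
  shows "\<exists>F'\<subseteq>F. finite F' \<and> x \<in> span (\<Union>\<mu>\<in>F'. eig \<mu>)"
proof -
  obtain t r where t: "finite t" "t \<subseteq> (\<Union>\<mu>\<in>F. eig \<mu>)" "x = (\<Sum>a\<in>t. r a *\<^sub>R a)"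
    using assms unfolding span_explicit by auto
  have "\<forall>a\<in>t. \<exists>\<mu>\<in>F. a \<in> eig \<mu>" using t(2) by blast
  then obtain m where m: "\<And>a. a \<in> t \<Longrightarrow> m a \<in> F \<and> a \<in> eig (m a)" by metis
  have "x \<in> span (\<Union>\<mu>\<in>m ` t. eig \<mu>)" unfolding t(3)
    using m by (intro span_sum span_scale span_base) blast
  then show ?thesis using m t(1) by (intro exI[of _ "m ` t"]) auto
qed

lemma B_negative_E:
  assumes "x \<in> E" "x \<noteq> 0"
  shows "B x x < 0"
proof -
  obtain F where "F \<subseteq> neg" "finite F" "x \<in> span (\<Union>\<mu>\<in>F. eig \<mu>)"
    using span_UN_finite[of x neg] assms(1) unfolding E_def by auto
  moreover from this have "F \<subseteq> {..<0}" unfolding neg_def by auto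
  ultimately show ?thesis using B_negative_finite_span[of F x] assms(2) by simp
qed

text \<open>With \<open>\<epsilon> = 1/M\<close> in the compactness inequality, \<open>B\<close> is nonnegative wherever all the functionals vanish;
they therefore separate the points of a subspace on which \<open>B\<close> is negative.\<close>

lemma negative_subspace_finite_dim:
  assumes V: "subspace V" "V \<subseteq> W" and neg: "\<And>x. x \<in> V \<Longrightarrow> x \<noteq> 0 \<Longrightarrow> B x x < 0"
  shows "\<exists>T. finite T \<and> V \<subseteq> span T"
proof -
  have "1 / M > 0" using M_pos by simp
  from compact[OF this] obtain K :: nat and l and c :: real where l: "\<And>i. i < K \<Longrightarrow> linear_on W (l i)"
    and est: "\<And>x. x \<in> W \<Longrightarrow> G x x \<le> 1 / M * D x x + (\<Sum>i<K. (l i x)\<^sup>2)"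
    by blast
  have "\<exists>T. finite T \<and> card T \<le> K \<and> V \<subseteq> span T"
  proof (rule finite_dim_if_functionals_separate[where l = l])
    show "linear_on V (l i)" if "i < K" for i
      using l[OF that] V(2) unfolding linear_on_def by blast
    show "w = 0" if w: "w \<in> V" "\<And>i. i < K \<Longrightarrow> l i w = 0" for w
    proof (rule ccontr)
      assume "w \<noteq> 0"
      then have "B w w < 0" using neg w by blast
      moreover have W: "w \<in> W" using w V by blast
      moreover have "M * G w w \<le> D w w"
        using est[OF W] w(2) M_pos by (simp add: field_simps)
      ultimately show False using C_bound[OF W] unfolding B_def by linarith
    qed
  qed (fact V)
  then obtain T where "finite T \<and> card T \<le> K \<and> V \<subseteq> span T" ..
  then show ?thesis by (intro exI[of _ T]) simp
qed

lemma E_finite_dim: "\<exists>T. finite T \<and> T \<subseteq> W \<and> E = span T"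
proof -
  have "\<exists>T. finite T \<and> E \<subseteq> span T"
    by (rule negative_subspace_finite_dim[OF subspace_E E_subset]) (rule B_negative_E)
  then obtain T where "finite T \<and> E \<subseteq> span T" ..
  then have T: "finite T" "E \<subseteq> span T" by simp_all
  obtain S where S: "S \<subseteq> E" "independent S" "E \<subseteq> span S" by (rule basis_exists[of E])
  have "finite S" using independent_span_bound[OF T(1) S(2)] S(1) T(2) by (meson subset_trans)
  moreover have "E = span S" using S subspace_E by (simp add: span_subspace)
  moreover have "S \<subseteq> W" using S(1) E_subset by (rule subset_trans)
  ultimately show ?thesis by (intro exI[of _ S]) simp
qed

text \<open>The direct method. Otherwise the Rayleigh quotient has a negative infimum \<open>m0\<close> on the orthogonal
complement \<open>P\<close> of \<open>E\<close>, and \<open>N = B - m0 G\<close> is nonnegative on \<open>P\<close>. Take a normalized minimizing sequence along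
which the finitely many functionals of the compactness inequality converge. The parallelogram
inequality for \<open>N\<close> bounds \<open>N\<close> on differences of members, and the compactness inequality turns this into
a bound for \<open>D + G\<close>; so the sequence is Cauchy. Its limit \<open>u\<close> satisfies \<open>N u u = 0\<close>, hence is orthogonal to \<open>P\<close>
with respect to \<open>N\<close>, and also to \<open>E\<close> because \<open>E\<close> consists of eigenvectors. Thus \<open>u\<close> is an eigenvector for
\<open>m0 < 0\<close>; it belongs to \<open>E\<close> and is orthogonal to \<open>E\<close>, which is absurd.\<close>

lemma B_nonneg_orth_E:
  assumes z0: "z0 \<in> W" and orth0: "\<And>e. e \<in> E \<Longrightarrow> G z0 e = 0"
  shows "B z0 z0 \<ge> 0"
proof (rule ccontr)
  assume "\<not> B z0 z0 \<ge> 0"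
  then have neg0: "B z0 z0 < 0" by simp
  define P where "P = {x \<in> W. \<forall>e\<in>E. G x e = 0}"
  have P: "P \<subseteq> W" unfolding P_def by blast
  have sub_P: "subspace P"
  proof (rule subspaceI)
    show "0 \<in> P" unfolding P_def using W_closed(4) G_bl(8) E_subset by auto
    show "x + y \<in> P" if "x \<in> P" "y \<in> P" for x y
      using that W_closed(1)[of x y] G_bl(3)[of _ x y] E_subset unfolding P_def by auto
    show "c *\<^sub>R x \<in> P" if "x \<in> P" for c x
      using that W_closed(3)[of x c] G_bl(5)[of _ x x c] E_subset unfolding P_def by auto
  qed
  note P_closed = subspace_add[OF sub_P] subspace_diff[OF sub_P] subspace_scale[OF sub_P]
  define R where "R = {B w w / G w w | w. w \<in> P \<and> w \<noteq> 0}"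
  have "z0 \<noteq> 0" using neg0 B_bl(8)[OF z0 z0 z0] by auto
  then have R0: "B z0 z0 / G z0 z0 \<in> R" using z0 orth0 unfolding R_def P_def by blast
  have R_bdd: "- M \<le> r" if "r \<in> R" for r
  proof -
    obtain w where w: "r = B w w / G w w" "w \<in> W" "w \<noteq> 0"
      using \<open>r \<in> R\<close> P unfolding R_def by blast
    have "- M * G w w \<le> B w w" using C_bound[OF w(2)] D_nonneg[OF w(2)] unfolding B_def by linarith
    then show ?thesis unfolding w(1) using G_pos[OF w(2,3)] by (simp add: field_simps)
  qed
  then have bdd: "bdd_below R" by (meson bdd_belowI)
  define m0 where "m0 = Inf R"
  have "m0 \<le> B z0 z0 / G z0 z0" unfolding m0_def using R0 bdd by (rule cInf_lower)
  also have "\<dots> < 0" using neg0 G_pos[OF z0 \<open>z0 \<noteq> 0\<close>] by (simp add: divide_neg_pos)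
  finally have lam: "m0 < 0" .
  define N where "N = (\<lambda>x y. B x y - m0 * G x y)"
  have N_form_W: "sym_bilinear_on W N" unfolding N_def by (rule B_shift_form)
  have N_form: "sym_bilinear_on P N" using N_form_W P by (rule sym_bilinear_on_subset)
  have N_nonneg: "N x x \<ge> 0" if x: "x \<in> P" for x
  proof (cases "x = 0")
    case True
    then show ?thesis using sym_bilinear_onD(8)[OF N_form sub_P x x x] by simp
  next
    case False
    then have "B x x / G x x \<in> R" using x unfolding R_def by blast
    then have "m0 \<le> B x x / G x x" unfolding m0_def using bdd by (rule cInf_lower)
    then show ?thesis unfolding N_def using G_pos[of x] x False P by (auto simp: field_simps)
  qed
  have "\<exists>w\<in>P. G w w = 1 \<and> N w w < 1 / real (Suc n)" for n
  proof -
    have "m0 < m0 + 1 / real (Suc n)" by simp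
    then obtain r where "r \<in> R" "r < m0 + 1 / real (Suc n)"
      unfolding m0_def using R0 by (metis cInf_lessD empty_iff)
    then obtain w where w: "w \<in> P" "w \<noteq> 0" "B w w / G w w < m0 + 1 / real (Suc n)"
      unfolding R_def by blast
    have wW: "w \<in> W" using w P by blast
    define c where "c = 1 / sqrt (G w w)"
    have gp: "G w w > 0" using G_pos w wW by blast
    then have c: "c\<^sup>2 * G w w = 1" unfolding c_def by (simp add: field_simps)
    have cw: "c *\<^sub>R w \<in> W" using wW by (rule W_closed)
    have 1: "G (c *\<^sub>R w) (c *\<^sub>R w) = c\<^sup>2 * G w w" "B (c *\<^sub>R w) (c *\<^sub>R w) = c\<^sup>2 * B w w"
      using G_bl(5)[OF cw wW wW, of c] G_bl(4)[OF wW wW wW, of c]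
        B_bl(5)[OF cw wW wW, of c] B_bl(4)[OF wW wW wW, of c] by (simp_all add: power2_eq_square)
    have "c\<^sup>2 * B w w = B w w / G w w" using c gp by (simp add: field_simps)
    then have "N (c *\<^sub>R w) (c *\<^sub>R w) < 1 / real (Suc n)" unfolding N_def 1 c using w(3) by simp
    then show ?thesis using P_closed(3)[OF w(1)] 1 c by (intro bexI[of _ "c *\<^sub>R w"]) auto
  qed
  then obtain w where w: "\<And>n. w n \<in> P" "\<And>n. G (w n) (w n) = 1" "\<And>n. N (w n) (w n) < 1 / real (Suc n)"
    by metis
  have "1 / (2 * M) > 0" using M_pos by simp
  from compact[OF this] obtain K :: nat and l and c :: real where
    l: "\<And>i. i < K \<Longrightarrow> linear_on W (l i)" "\<And>i x. i < K \<Longrightarrow> x \<in> W \<Longrightarrow> (l i x)\<^sup>2 \<le> c * G x x"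
    and est: "\<And>x. x \<in> W \<Longrightarrow> G x x \<le> 1 / (2 * M) * D x x + (\<Sum>i<K. (l i x)\<^sup>2)"
    by blast
  have "\<exists>r. strict_mono r \<and> (\<forall>i<K. convergent (\<lambda>n. (\<lambda>i n. l i (w n)) i (r n)))"
  proof (rule bounded_sequences_common_convergent_subseq)
    show "\<bar>l i (w n)\<bar> \<le> c + 1" if "i < K" for i n
    proof -
      (* a square bounded by c bounds the absolute value by c + 1 *)
      have "(l i (w n))\<^sup>2 \<le> c" using l(2)[OF that, of "w n"] w P by auto
      moreover have "0 \<le> (\<bar>l i (w n)\<bar> - 1)\<^sup>2" by simp
      moreover have "0 \<le> \<bar>l i (w n)\<bar>" by simp
      ultimately show ?thesis by (simp add: power2_diff)
    qed
  qed
  then obtain r where r: "strict_mono r" "\<And>i. i < K \<Longrightarrow> convergent (\<lambda>n. l i (w (r n)))"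
    by auto
  define v where "v n = w (r n)" for n
  have v: "v n \<in> P" "v n \<in> W" "G (v n) (v n) = 1" for n using w P unfolding v_def by auto
  have Nv: "(\<lambda>n. N (v n) (v n)) \<longlonglongrightarrow> 0"
  proof (rule tendsto_sandwich)
    show "\<forall>\<^sub>F n in sequentially. 0 \<le> N (v n) (v n)" using N_nonneg v by simp
    have "N (v n) (v n) \<le> 1 / real (Suc n)" for n
    proof -
      have "N (v n) (v n) \<le> 1 / real (Suc (r n))" unfolding v_def using w(3) by (rule less_imp_le)
      also have "\<dots> \<le> 1 / real (Suc n)"
        using seq_suble[OF r(1), of n] by (intro divide_left_mono) auto
      finally show ?thesis .
    qed
    then show "\<forall>\<^sub>F n in sequentially. N (v n) (v n) \<le> 1 / real (Suc n)" by simp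
    show "(\<lambda>n. 1 / real (Suc n)) \<longlonglongrightarrow> 0" using LIMSEQ_Suc[OF lim_1_over_n] by simp
  qed simp
  (* an upper bound for D + G at v m - v n that tends to zero *)
  define h where "h = (\<lambda>(m, n). (1 + 1 / (2 * M)) * (4 * N (v m) (v m) + 4 * N (v n) (v n))
    + (2 * M + 2) * (\<Sum>i<K. (l i (v m) - l i (v n))\<^sup>2))"
  have h_lim: "(h \<longlongrightarrow> 0) (sequentially \<times>\<^sub>F sequentially)"
  proof -
    have l_lim: "((\<lambda>p. (l i (v (fst p)) - l i (v (snd p)))\<^sup>2) \<longlongrightarrow> 0) (sequentially \<times>\<^sub>F sequentially)"
      if i: "i < K" for i
    proof -
      obtain a where "(\<lambda>n. l i (v n)) \<longlonglongrightarrow> a"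
        using r(2)[OF i] unfolding convergent_def v_def by blast
      then have "((\<lambda>p. l i (v (fst p)) - l i (v (snd p))) \<longlongrightarrow> a - a) (sequentially \<times>\<^sub>F sequentially)"
        by (intro tendsto_diff filterlim_compose[OF _ filterlim_fst] filterlim_compose[OF _ filterlim_snd])
      from tendsto_power[OF this, of 2] show ?thesis by simp
    qed
    have "(h \<longlongrightarrow> (1 + 1 / (2 * M)) * (4 * 0 + 4 * 0) + (2 * M + 2) * (\<Sum>i<K. 0))
        (sequentially \<times>\<^sub>F sequentially)"
      unfolding h_def case_prod_beta
      by (intro tendsto_intros l_lim filterlim_compose[OF Nv filterlim_fst]
          filterlim_compose[OF Nv filterlim_snd]) simp
    then show ?thesis by simp
  qed
  have "\<exists>u\<in>W. (\<lambda>n. D (v n - u) (v n - u) + G (v n - u) (v n - u)) \<longlonglongrightarrow> 0"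
  proof (rule complete)
    fix e :: real assume "e > 0"
    then have "\<forall>\<^sub>F p in sequentially \<times>\<^sub>F sequentially. h p < e"
      using order_tendstoD(2)[OF h_lim] by blast
    then obtain n0 where "\<forall>m\<ge>n0. \<forall>n\<ge>n0. h (n, m) < e"
      unfolding eventually_prod_sequentially ..
    then have n0: "h (m, n) < e" if "m \<ge> n0" "n \<ge> n0" for m n using that by simp
    have "D (v m - v n) (v m - v n) + G (v m - v n) (v m - v n) \<le> h (m, n)" for m n
    proof -
      define f where "f = v m - v n"
      define S where "S = (\<Sum>i<K. (l i (v m) - l i (v n))\<^sup>2)"
      have f: "f \<in> P" "f \<in> W" unfolding f_def by (rule P_closed(2)[OF v(1) v(1)] W_closed(2)[OF v(2) v(2)])+
      have S: "(\<Sum>i<K. (l i f)\<^sup>2) = S"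
        unfolding S_def f_def using linear_on_diff[OF subspace_W l(1)] v by (intro sum.cong) auto
      have "S \<ge> 0" unfolding S_def by (intro sum_nonneg) simp
      have Nf: "N f f \<le> 2 * N (v m) (v m) + 2 * N (v n) (v n)"
        unfolding f_def by (rule form_parallelogram[OF N_form sub_P N_nonneg v(1) v(1)])
      have "m0 * G f f \<le> 0" using lam G_nonneg[OF f(2)] by (simp add: mult_nonpos_nonneg)
      then have "D f f - M * G f f \<le> N f f"
        unfolding N_def B_def using C_bound[OF f(2)] by linarith
      moreover have g: "G f f \<le> 1 / (2 * M) * D f f + S" using est[OF f(2)] S by simp
      then have "M * G f f \<le> M * (1 / (2 * M) * D f f + S)" using M_pos by (intro mult_left_mono) auto
      moreover have "M * (1 / (2 * M) * D f f + S) = D f f / 2 + M * S"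
        using M_pos by (simp add: field_simps)
      ultimately have d: "D f f \<le> 4 * N (v m) (v m) + 4 * N (v n) (v n) + 2 * M * S"
        using Nf by linarith
      have "D f f + G f f \<le> (1 + 1 / (2 * M)) * D f f + S" using g by (simp add: algebra_simps)
      also have "\<dots> \<le> (1 + 1 / (2 * M)) * (4 * N (v m) (v m) + 4 * N (v n) (v n) + 2 * M * S) + S"
        using d M_pos by (intro add_right_mono mult_left_mono) auto
      also have "\<dots> = (1 + 1 / (2 * M)) * (4 * N (v m) (v m) + 4 * N (v n) (v n)) + (2 * M + 2) * S"
        using M_pos by (simp add: field_simps)
      finally show ?thesis unfolding h_def S_def f_def by simp
    qed
    then have "D (v m - v n) (v m - v n) + G (v m - v n) (v m - v n) < e" if "m \<ge> n0" "n \<ge> n0" for m n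
      using n0[OF that] by (rule le_less_trans)
    then show "\<exists>n0. \<forall>m\<ge>n0. \<forall>n\<ge>n0. D (v m - v n) (v m - v n) + G (v m - v n) (v m - v n) < e"
      by (intro exI[of _ n0]) simp
  qed (rule v)
  then obtain u where u: "u \<in> W" and u_lim: "(\<lambda>n. D (v n - u) (v n - u) + G (v n - u) (v n - u)) \<longlonglongrightarrow> 0"
    by blast
  define T where "T n = D (v n - u) (v n - u) + G (v n - u) (v n - u)" for n
  have T: "T \<longlonglongrightarrow> 0" unfolding T_def[abs_def] by (rule u_lim)
  have vu: "v n - u \<in> W" for n by (rule W_closed(2)[OF v(2) u])
  have T_G: "G (v n - u) (v n - u) \<le> T n" "D (v n - u) (v n - u) \<le> T n" for n
    unfolding T_def using D_nonneg[OF vu] G_nonneg[OF vu] by simp_all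
  have uE: "G u e = 0" if e: "e \<in> E" for e
  proof -
    have eW: "e \<in> W" using e E_subset by blast
    have "(G u e)\<^sup>2 \<le> T n * G e e" for n
    proof -
      have "G (v n) e = 0" using v(1)[of n] e unfolding P_def by blast
      then have "(G u e)\<^sup>2 = (G (v n - u) e)\<^sup>2" using G_bl(7)[OF eW v(2) u] by simp
      also have "\<dots> \<le> G (v n - u) (v n - u) * G e e"
        by (rule form_Cauchy_Schwarz[OF G_form subspace_W G_nonneg vu eW])
      also have "\<dots> \<le> T n * G e e" using T_G G_nonneg[OF eW] by (intro mult_right_mono)
      finally show ?thesis .
    qed
    moreover have "(\<lambda>n. T n * G e e) \<longlonglongrightarrow> 0 * G e e" by (intro tendsto_intros T)
    ultimately have "(G u e)\<^sup>2 \<le> 0 * G e e" by (intro LIMSEQ_le_const) auto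
    then show ?thesis by simp
  qed
  then have uP: "u \<in> P" using u unfolding P_def by blast
  have vuP: "v n - u \<in> P" for n by (rule P_closed(2)[OF v(1) uP])
  have "1 \<le> 2 * G u u"
  proof (rule LIMSEQ_le_const)
    have "(\<lambda>n. 2 * T n + 2 * G u u) \<longlonglongrightarrow> 2 * 0 + 2 * G u u" by (intro tendsto_intros T)
    then show "(\<lambda>n. 2 * T n + 2 * G u u) \<longlonglongrightarrow> 2 * G u u" by simp
    have "1 \<le> 2 * T n + 2 * G u u" for n
      using form_parallelogram(2)[OF G_form subspace_W G_nonneg vu[of n] u] v(3)[of n] T_G[of n] by simp
    then show "\<exists>n0. \<forall>n\<ge>n0. 1 \<le> 2 * T n + 2 * G u u" by blast
  qed
  then have Gu: "G u u > 0" by simp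
  have "N u u \<le> 0"
  proof (rule LIMSEQ_le_const)
    have "(\<lambda>n. 2 * N (v n) (v n) + 2 * ((1 + M - m0) * T n)) \<longlonglongrightarrow> 2 * 0 + 2 * ((1 + M - m0) * 0)"
      by (intro tendsto_intros T Nv)
    then show "(\<lambda>n. 2 * N (v n) (v n) + 2 * ((1 + M - m0) * T n)) \<longlonglongrightarrow> 0" by simp
    have "N u u \<le> 2 * N (v n) (v n) + 2 * ((1 + M - m0) * T n)" for n
    proof -
      define f where "f = v n - u"
      have "N u u \<le> 2 * N (v n) (v n) + 2 * N f f"
        using form_parallelogram(1)[OF N_form sub_P N_nonneg v(1)[of n] vuP[of n]] unfolding f_def by simp
      moreover have "N f f \<le> D f f + (M - m0) * G f f"
        using C_bound[OF vu[of n]] unfolding N_def B_def f_def by (simp add: algebra_simps)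
      moreover have "(M - m0) * G f f \<le> (M - m0) * T n"
        using T_G M_pos lam unfolding f_def by (intro mult_left_mono) auto
      moreover have "D f f \<le> T n" using T_G unfolding f_def by simp
      ultimately show ?thesis by (simp add: algebra_simps)
    qed
    then show "\<exists>n0. \<forall>n\<ge>n0. N u u \<le> 2 * N (v n) (v n) + 2 * ((1 + M - m0) * T n)" by blast
  qed
  then have Nu: "N u u = 0" using N_nonneg[OF uP] by simp
  have onP: "N u z = 0" if "z \<in> P" for z
    using form_Cauchy_Schwarz[OF N_form sub_P N_nonneg uP that] Nu by simp
  have onE: "N u e = 0" if "e \<in> E" for e
  proof -
    have "e \<in> W \<and> B u e = 0"
    proof (rule span_induct[OF that[unfolded E_def]])
      show "subspace {e \<in> W. B u e = 0}"
        using B_bl(2)[OF u] B_bl(4)[OF u _ u] B_bl(9)[OF u u u] W_closed u by (auto intro!: subspaceI)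
      fix e assume "e \<in> (\<Union>\<mu>\<in>neg. eig \<mu>)"
      then obtain \<mu> where \<mu>: "\<mu> \<in> neg" "e \<in> eig \<mu>" by blast
      have eW: "e \<in> W" and eE: "e \<in> E" using \<mu> eig_subset eig_E by blast+
      have "B u e = B e u" using B_bl(1)[OF u eW eW] .
      also have "\<dots> = \<mu> * G e u" using \<mu>(2) u unfolding eig_def by simp
      also have "\<dots> = 0" using uE[OF eE] G_bl(1)[OF u eW eW] by simp
      finally show "e \<in> W \<and> B u e = 0" using eW by simp
    qed
    then show ?thesis using uE[OF that] unfolding N_def by simp
  qed
  obtain TE where TE: "finite TE" "TE \<subseteq> W" "E = span TE" using E_finite_dim by blast
  have "N u z = 0" if z: "z \<in> W" for z
  proof -
    obtain e where e: "e \<in> E" "\<And>y. y \<in> E \<Longrightarrow> G (z - e) y = 0"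
      using orthogonal_projection_finite_dim[OF G_form subspace_W G_pos TE(1,2) z] unfolding TE(3) by blast
    have eW: "e \<in> W" using e E_subset by blast
    have "z - e \<in> P" unfolding P_def using e(2) W_closed(2)[OF z eW] by simp
    then have "N u (z - e) = 0" by (rule onP)
    then show ?thesis using onE[OF e(1)] sym_bilinear_onD(6)[OF N_form_W subspace_W u z eW] by simp
  qed
  then have eig: "u \<in> eig m0" unfolding eig_def N_def using u by simp
  have "u \<noteq> 0" using Gu G_bl(8)[OF u u u] by auto
  then have "m0 \<in> neg" using eig lam unfolding neg_def by blast
  then have "u \<in> E" using eig eig_E by blast
  then show False using uE[of u] Gu by simp
qed

lemma dim_span_eig:
  assumes "finite F" "F \<subseteq> neg"
  shows "dim (span (\<Union>\<mu>\<in>F. eig \<mu>)) = (\<Sum>\<mu>\<in>F. dim (eig \<mu>))"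
  using assms
proof (induction F rule: finite_induct)
  case empty
  have "dim {0::'x} = dim ({} :: 'x set)" by (rule span_eq_dim) simp
  moreover have "dim ({} :: 'x set) = 0"
    using dim_eq_card_independent[OF independent_empty] by (metis card.empty)
  ultimately show ?case by simp
next
  case (insert \<mu> F)
  obtain T where T: "finite T" "E = span T" using E_finite_dim by blast
  have 1: "eig \<mu> \<subseteq> span T" using eig_E insert.prems T by blast
  have 2: "span (\<Union>\<nu>\<in>F. eig \<nu>) \<subseteq> span T"
    using insert.prems unfolding T(2)[symmetric] E_def by (intro span_mono) auto
  have "span (\<Union>\<nu>\<in>insert \<mu> F. eig \<nu>) = span (eig \<mu> \<union> span (\<Union>\<nu>\<in>F. eig \<nu>))"
    by (simp add: span_Un span_span)
  also have "dim \<dots> = dim (eig \<mu>) + dim (span (\<Union>\<nu>\<in>F. eig \<nu>))"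
    by (rule dim_sum_direct[OF subspace_eig subspace_span eig_Int_span T(1) 1 T(1) 2])
      (rule insert.hyps)
  finally show ?case using insert by simp
qed

lemma dim_eig_pos:
  assumes "\<mu> \<in> neg"
  shows "dim (eig \<mu>) \<ge> 1"
proof -
  obtain T where T: "finite T" "E = span T" using E_finite_dim by blast
  obtain x where x: "x \<in> eig \<mu>" "x \<noteq> 0" using assms unfolding neg_def by blast
  have "card {x} = dim {x}" using x by (intro dim_eq_card_independent[symmetric]) simp
  also have "\<dots> \<le> dim (eig \<mu>)"
    using x(1) eig_E[OF assms] unfolding T(2) by (intro finite_dim_mono[OF _ T(1)]) simp_all
  finally show ?thesis by simp
qed

lemma edim_eig:
  assumes "\<mu> \<in> neg"
  shows "edim (eig \<mu>) = enat (dim (eig \<mu>))"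
proof -
  obtain T where T: "finite T" "E = span T" using E_finite_dim by blast
  show ?thesis using eig_E[OF assms] unfolding T(2) by (rule edim_finite[OF T(1)])
qed

lemma sum_dim_eig_le:
  assumes "finite F" "F \<subseteq> neg"
  shows "(\<Sum>\<mu>\<in>F. dim (eig \<mu>)) \<le> dim E"
proof -
  obtain T where T: "finite T" "E = span T" using E_finite_dim by blast
  have "span (\<Union>\<mu>\<in>F. eig \<mu>) \<subseteq> E" using assms unfolding E_def by (intro span_mono) auto
  then show ?thesis
    unfolding dim_span_eig[OF assms, symmetric]
    by (rule finite_dim_mono[OF _ T(1)]) (simp add: T(2))
qed

lemma finite_neg: "finite neg"
proof (rule ccontr)
  assume "infinite neg"
  then obtain F where F: "finite F" "card F = dim E + 1" "F \<subseteq> neg"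
    by (metis infinite_arbitrarily_large)
  have "card F = (\<Sum>\<mu>\<in>F. 1)" by simp
  also have "\<dots> \<le> (\<Sum>\<mu>\<in>F. dim (eig \<mu>))" using dim_eig_pos F by (intro sum_mono) auto
  also have "\<dots> \<le> dim E" using F by (intro sum_dim_eig_le)
  finally show False using F by simp
qed

text \<open>The supremum is attained at the set of all negative eigenvalues, which is finite because each of
them occupies at least one dimension of \<open>E\<close>.\<close>

lemma SUP_sum_edim_eig: "(SUP F\<in>{F. finite F \<and> F \<subseteq> neg}. \<Sum>\<mu>\<in>F. edim (eig \<mu>)) = enat (dim E)"
proof -
  have eq: "(\<Sum>\<mu>\<in>F. edim (eig \<mu>)) = enat (\<Sum>\<mu>\<in>F. dim (eig \<mu>))" if "F \<subseteq> neg" for F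
  proof -
    have "(\<Sum>\<mu>\<in>F. edim (eig \<mu>)) = (\<Sum>\<mu>\<in>F. enat (dim (eig \<mu>)))"
      using that edim_eig by (intro sum.cong) auto
    also have "\<dots> = enat (\<Sum>\<mu>\<in>F. dim (eig \<mu>))"
      by (induction F rule: infinite_finite_induct) (auto simp: zero_enat_def)
    finally show ?thesis .
  qed
  show ?thesis
  proof (rule antisym)
    show "(SUP F\<in>{F. finite F \<and> F \<subseteq> neg}. \<Sum>\<mu>\<in>F. edim (eig \<mu>)) \<le> enat (dim E)"
      using eq sum_dim_eig_le by (intro SUP_least) auto
    have "enat (dim E) = (\<Sum>\<mu>\<in>neg. edim (eig \<mu>))"
      using dim_span_eig[OF finite_neg order_refl] eq[OF order_refl] unfolding E_def by simp
    also have "\<dots> \<le> (SUP F\<in>{F. finite F \<and> F \<subseteq> neg}. \<Sum>\<mu>\<in>F. edim (eig \<mu>))"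
      using finite_neg by (intro SUP_upper) auto
    finally show "enat (dim E) \<le> (SUP F\<in>{F. finite F \<and> F \<subseteq> neg}. \<Sum>\<mu>\<in>F. edim (eig \<mu>))" .
  qed
qed

end

section \<open>Morse indices of decoupled pairs of forms\<close>

lemma dim_linear_image_inj:
  fixes f :: "'x::real_vector \<Rightarrow> 'y::real_vector"
  assumes f: "linear f" "inj f" and V: "subspace V"
  shows "subspace (f ` V)" "dim (f ` V) = dim V"
    "finite T \<Longrightarrow> V \<subseteq> span T \<Longrightarrow> f ` V \<subseteq> span (f ` T)"
proof -
  show "subspace (f ` V)" by (rule linear_subspace_image[OF f(1) V])
  obtain S where S: "S \<subseteq> V" "independent S" "V \<subseteq> span S" "card S = dim V" by (rule basis_exists[of V])
  have VS: "span S = V" using S V by (simp add: span_subspace)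
  have "independent (f ` S)"
    by (rule linear_independent_injective_image[OF f(1) S(2)]) (rule inj_on_subset[OF f(2) subset_UNIV])
  moreover have sp: "span (f ` S) = f ` V" using linear_span_image[OF f(1), of S] VS by simp
  ultimately have "dim (f ` V) = card (f ` S)" by (metis dim_eq_card_independent dim_span)
  also have "\<dots> = card S" by (rule card_image) (rule inj_on_subset[OF f(2) subset_UNIV])
  finally show "dim (f ` V) = dim V" using S(4) by simp
  show "f ` V \<subseteq> span (f ` T)" if "finite T" "V \<subseteq> span T"
    unfolding linear_span_image[OF f(1)] using that(2) by (rule image_mono)
qed

lemma obtain_finite_basis:
  assumes "subspace V" "finite T" "V \<subseteq> span T"
  shows "\<exists>e::nat \<Rightarrow> 'x::real_vector. e ` {..<dim V} \<subseteq> V \<and> V = span (e ` {..<dim V})"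
proof -
  obtain S where S: "S \<subseteq> V" "independent S" "V \<subseteq> span S" "card S = dim V" by (rule basis_exists[of V])
  have "finite S" using independent_span_bound[OF assms(2) S(2)] S(1) assms(3) by (meson subset_trans)
  then obtain h where h: "bij_betw h {0..<card S} S" using ex_bij_betw_nat_finite by blast
  have "h ` {..<dim V} = S" using h S(4) by (simp add: bij_betw_def atLeast0LessThan)
  moreover have "V = span S" using S assms(1) by (simp add: span_subspace)
  ultimately show ?thesis using S(1) by (intro exI[of _ h]) simp
qed

text \<open>In the coordinates \<open>p + q\<close> and \<open>p - q\<close> the form \<open>Q\<close> is the sum of two scalar forms. The pairs
\<open>(p + q, p - q)\<close> with \<open>p\<close> and \<open>q\<close> in the two negative eigenspaces form a negative subspace of the asserted
dimension. A negative subspace cannot be larger: orthogonality of the sum and the difference of a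
pair to bases of the two negative eigenspaces is that many linear conditions, and under them \<open>Q\<close> is
nonnegative.\<close>

theorem morse_index_decoupled:
  fixes W :: "'x::real_vector set"
  assumes "compact_form W D G Ca Ma" "compact_form W D G Cb Mb"
    and Q: "\<And>p q. p \<in> W \<Longrightarrow> q \<in> W \<Longrightarrow>
      Q (p, q) = (compact_form.B D Ca (p + q) (p + q) + compact_form.B D Cb (p - q) (p - q)) / 2"
  shows "(SUP V\<in>{V. subspace V \<and> V \<subseteq> W \<times> W \<and> (\<forall>w\<in>V. w \<noteq> 0 \<longrightarrow> Q w < 0)}. edim V)
    = enat (dim (compact_form.E W D G Ca)) + enat (dim (compact_form.E W D G Cb))"
proof -
  interpret a: compact_form W D G Ca Ma by fact
  interpret b: compact_form W D G Cb Mb by fact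
  define da db where "da = dim a.E" and "db = dim b.E"
  obtain Ta where Ta: "finite Ta" "a.E = span Ta" using a.E_finite_dim by blast
  obtain Tb where Tb: "finite Tb" "b.E = span Tb" using b.E_finite_dim by blast
  obtain ea where ea: "ea ` {..<da} \<subseteq> a.E" "a.E = span (ea ` {..<da})"
    using obtain_finite_basis[OF a.subspace_E Ta(1)] Ta(2) unfolding da_def by auto
  obtain eb where eb: "eb ` {..<db} \<subseteq> b.E" "b.E = span (eb ` {..<db})"
    using obtain_finite_basis[OF b.subspace_E Tb(1)] Tb(2) unfolding db_def by auto
  have ineq1: "edim V \<le> enat (da + db)"
    if V: "subspace V" "V \<subseteq> W \<times> W" "\<And>w. w \<in> V \<Longrightarrow> w \<noteq> 0 \<Longrightarrow> Q w < 0" for V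
  proof (rule edim_le_if_functionals_separate[OF V(1)])
    define l where "l i w = (if i < da then G (ea i) (fst w + snd w) else G (eb (i - da)) (fst w - snd w))" for i w
    have VW: "fst x + snd x \<in> W" "fst x - snd x \<in> W" if "x \<in> V" for x
    proof -
      have "fst x \<in> W" "snd x \<in> W" using subsetD[OF V(2) that] by (simp_all add: mem_Times_iff)
      then show "fst x + snd x \<in> W" "fst x - snd x \<in> W" by (simp_all add: a.W_closed(1,2))
    qed
    show "linear_on V (l i)" if i: "i < da + db" for i
    proof (cases "i < da")
      case True
      then have "linear_on W (G (ea i))"
        using ea(1) a.E_subset a.G_form unfolding sym_bilinear_on_def by blast
      then have "linear_on V (\<lambda>w. G (ea i) (fst w + snd w))"
        by (rule linear_on_compose) (auto intro!: linearI simp: scaleR_add_right VW)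
      then show ?thesis using True by (simp add: l_def[abs_def])
    next
      case False
      then have "eb (i - da) \<in> W" using i eb(1) b.E_subset by force
      then have "linear_on W (G (eb (i - da)))" using a.G_form unfolding sym_bilinear_on_def by blast
      then have "linear_on V (\<lambda>w. G (eb (i - da)) (fst w - snd w))"
        by (rule linear_on_compose) (auto intro!: linearI simp: scaleR_diff_right VW)
      then show ?thesis using False by (simp add: l_def[abs_def])
    qed
    show "w = 0" if w: "w \<in> V" "\<And>i. i < da + db \<Longrightarrow> l i w = 0" for w
    proof (rule ccontr)
      assume "w \<noteq> 0"
      obtain p q where pq: "w = (p, q)" by (cases w)
      have W: "p \<in> W" "q \<in> W" using w(1) V(2) pq by auto
      have pW: "p + q \<in> W" "p - q \<in> W" using a.W_closed(1,2)[OF W] by auto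
      have "G (p + q) e = 0" if "e \<in> a.E" for e
      proof (rule a.G_orth_span[OF pW(1) _ _ that[unfolded ea(2)]])
        show "ea ` {..<da} \<subseteq> W" using ea(1) a.E_subset by (rule subset_trans)
        fix y assume "y \<in> ea ` {..<da}"
        then obtain i where i: "i < da" "y = ea i" by auto
        then have yW: "y \<in> W" using ea(1) a.E_subset by blast
        show "G (p + q) y = 0" using w(2)[of i] i a.G_bl(1)[OF pW(1) yW yW] by (simp add: l_def pq)
      qed
      then have 1: "a.B (p + q) (p + q) \<ge> 0" by (rule a.B_nonneg_orth_E[OF pW(1)])
      have "G (p - q) e = 0" if "e \<in> b.E" for e
      proof (rule a.G_orth_span[OF pW(2) _ _ that[unfolded eb(2)]])
        show "eb ` {..<db} \<subseteq> W" using eb(1) b.E_subset by (rule subset_trans)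
        fix y assume "y \<in> eb ` {..<db}"
        then obtain i where i: "i < db" "y = eb i" by auto
        then have yW: "y \<in> W" using eb(1) b.E_subset by blast
        show "G (p - q) y = 0" using w(2)[of "da + i"] i a.G_bl(1)[OF pW(2) yW yW] by (simp add: l_def pq)
      qed
      then have 2: "b.B (p - q) (p - q) \<ge> 0" by (rule b.B_nonneg_orth_E[OF pW(2)])
      have "Q w \<ge> 0" unfolding pq Q[OF W] using 1 2 by simp
      then show False using V(3)[OF w(1) \<open>w \<noteq> 0\<close>] by simp
    qed
  qed
  define fa fb where "fa = (\<lambda>p::'x. (p, p))" and "fb = (\<lambda>q::'x. (q, - q))"
  have la: "linear fa" "inj fa" unfolding fa_def by (auto intro!: linearI injI)
  have lb: "linear fb" "inj fb" unfolding fb_def by (auto intro!: linearI injI)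
  (* the pairs (p + q, p - q) with p and q in the two negative eigenspaces *)
  define V where "V = span (fa ` a.E \<union> fb ` b.E)"
  note ia = dim_linear_image_inj[OF la a.subspace_E] and ib = dim_linear_image_inj[OF lb b.subspace_E]
  have Tfa: "finite (fa ` Ta)" "fa ` a.E \<subseteq> span (fa ` Ta)" using Ta(1) ia(3)[OF Ta(1)] Ta(2) by simp_all
  have Tfb: "finite (fb ` Tb)" "fb ` b.E \<subseteq> span (fb ` Tb)" using Tb(1) ib(3)[OF Tb(1)] Tb(2) by simp_all
  have int: "fa ` a.E \<inter> fb ` b.E = {0}"
  proof
    show "fa ` a.E \<inter> fb ` b.E \<subseteq> {0}"
    proof
      fix w assume "w \<in> fa ` a.E \<inter> fb ` b.E"
      then obtain p q where "w = (p, p)" "w = (q, - q)" unfolding fa_def fb_def by blast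
      then have "(p, p) = (q, - q)" by metis
      then have "p = q" "p = - q" by (metis prod.inject)+
      then have "p = - p" by metis
      then have "2 *\<^sub>R p = 0" by (metis add.right_inverse scaleR_2)
      then show "w \<in> {0}" using \<open>w = (p, p)\<close> by (simp add: zero_prod_def)
    qed
    show "{0} \<subseteq> fa ` a.E \<inter> fb ` b.E" using subspace_0[OF ia(1)] subspace_0[OF ib(1)] by simp
  qed
  have dimV: "dim V = da + db"
    unfolding V_def da_def db_def
    using dim_sum_direct[OF ia(1) ib(1) int Tfa Tfb] ia(2) ib(2) by simp
  have "V \<subseteq> span (fa ` Ta \<union> fb ` Tb)"
    unfolding V_def
  proof (rule span_minimal[OF _ subspace_span], rule Un_least)
    show "fa ` a.E \<subseteq> span (fa ` Ta \<union> fb ` Tb)" by (rule subset_trans[OF Tfa(2) span_mono]) simp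
    show "fb ` b.E \<subseteq> span (fa ` Ta \<union> fb ` Tb)" by (rule subset_trans[OF Tfb(2) span_mono]) simp
  qed
  then have edimV: "edim V = enat (da + db)"
    using edim_finite[of "fa ` Ta \<union> fb ` Tb" V] Tfa(1) Tfb(1) dimV by simp
  have V_elem: "\<exists>p\<in>a.E. \<exists>q\<in>b.E. w = (p + q, p - q)" if w: "w \<in> V" for w
  proof -
    have "w \<in> {x + y |x y. x \<in> span (fa ` a.E) \<and> y \<in> span (fb ` b.E)}"
      using w unfolding V_def span_Un .
    then obtain x y where xy: "w = x + y" "x \<in> fa ` a.E" "y \<in> fb ` b.E"
      unfolding span_eq_iff[THEN iffD2, OF ia(1)] span_eq_iff[THEN iffD2, OF ib(1)] by auto
    obtain p where p: "p \<in> a.E" "x = (p, p)" using xy(2) unfolding fa_def by blast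
    obtain q where q: "q \<in> b.E" "y = (q, - q)" using xy(3) unfolding fb_def by blast
    show ?thesis using p q xy(1) by (intro bexI[of _ p] bexI[of _ q]) simp_all
  qed
  have EW: "p \<in> W" if "p \<in> a.E \<or> p \<in> b.E" for p using that a.E_subset b.E_subset by blast
  have "V \<subseteq> W \<times> W"
  proof
    fix w assume "w \<in> V"
    then obtain p q where "p \<in> a.E" "q \<in> b.E" "w = (p + q, p - q)" using V_elem by blast
    then show "w \<in> W \<times> W" using EW a.W_closed(1,2)[of p q] by simp
  qed
  moreover have "Q w < 0" if w: "w \<in> V" "w \<noteq> 0" for w
  proof -
    obtain p q where pq: "p \<in> a.E" "q \<in> b.E" "w = (p + q, p - q)" using V_elem[OF w(1)] by blast
    have W: "p \<in> W" "q \<in> W" using EW pq by auto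
    have ap: "a.B (2 *\<^sub>R p) (2 *\<^sub>R p) = 4 * a.B p p"
      using a.B_bl(4)[OF a.W_closed(3)[OF W(1)] W(1) W(1), of 2 2] a.B_bl(5)[OF W(1) W(1) W(1), of 2] by simp
    have bq: "b.B (2 *\<^sub>R q) (2 *\<^sub>R q) = 4 * b.B q q"
      using b.B_bl(4)[OF b.W_closed(3)[OF W(2)] W(2) W(2), of 2 2] b.B_bl(5)[OF W(2) W(2) W(2), of 2] by simp
    have e: "p + q + (p - q) = 2 *\<^sub>R p" "p + q - (p - q) = 2 *\<^sub>R q" by (simp_all add: scaleR_2)
    have "Q w = 2 * a.B p p + 2 * b.B q q"
      unfolding pq(3) Q[OF a.W_closed(1,2)[OF W]] e ap bq by simp
    moreover have "a.B p p \<le> 0" using a.B_negative_E[OF pq(1)] a.B_bl(8)[OF W(1) W(1) W(1)] by (cases "p = 0") auto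
    moreover have "b.B q q \<le> 0" using b.B_negative_E[OF pq(2)] b.B_bl(8)[OF W(2) W(2) W(2)] by (cases "q = 0") auto
    moreover have "p \<noteq> 0 \<or> q \<noteq> 0" using w(2) pq(3) by (auto simp: zero_prod_def)
    ultimately show ?thesis using a.B_negative_E[OF pq(1)] b.B_negative_E[OF pq(2)] by auto
  qed
  ultimately have "V \<in> {V. subspace V \<and> V \<subseteq> W \<times> W \<and> (\<forall>w\<in>V. w \<noteq> 0 \<longrightarrow> Q w < 0)}"
    unfolding V_def by simp
  then have "enat (da + db) \<le> (SUP V\<in>{V. subspace V \<and> V \<subseteq> W \<times> W \<and> (\<forall>w\<in>V. w \<noteq> 0 \<longrightarrow> Q w < 0)}. edim V)"
    unfolding edimV[symmetric] by (rule SUP_upper)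
  moreover have "(SUP V\<in>{V. subspace V \<and> V \<subseteq> W \<times> W \<and> (\<forall>w\<in>V. w \<noteq> 0 \<longrightarrow> Q w < 0)}. edim V) \<le> enat (da + db)"
    using ineq1 by (intro SUP_least) simp
  ultimately show ?thesis unfolding da_def db_def by (simp add: antisym)
qed

section \<open>Square-integrable functions\<close>

definition l2 :: "'a measure \<Rightarrow> ('a \<Rightarrow> 'b::euclidean_space) \<Rightarrow> bool" where
  "l2 M f \<longleftrightarrow> f \<in> borel_measurable M \<and> integrable M (\<lambda>x. (norm (f x))\<^sup>2)"

lemma square_integrable_l2: "square_integrable \<Omega> f \<longleftrightarrow> l2 (lebesgue_on \<Omega>) f"
  unfolding square_integrable_def l2_def ..

lemma l2_measurable: "l2 M f \<Longrightarrow> f \<in> borel_measurable M"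
  unfolding l2_def by simp

lemma l2_norm_integrable: "l2 M f \<Longrightarrow> integrable M (\<lambda>x. (norm (f x))\<^sup>2)"
  unfolding l2_def by simp

lemma l2_inner_integrable:
  assumes "l2 M f" "l2 M g"
  shows "integrable M (\<lambda>x. f x \<bullet> g x)"
proof (rule Bochner_Integration.integrable_bound)
  show "integrable M (\<lambda>x. (norm (f x))\<^sup>2 + (norm (g x))\<^sup>2)"
    using assms unfolding l2_def by auto
  show "(\<lambda>x. f x \<bullet> g x) \<in> borel_measurable M" using assms unfolding l2_def by auto
  have "\<bar>f x \<bullet> g x\<bar> \<le> (norm (f x))\<^sup>2 + (norm (g x))\<^sup>2" for x
  proof -
    have "\<bar>f x \<bullet> g x\<bar> \<le> norm (f x) * norm (g x)" by (rule Cauchy_Schwarz_ineq2)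
    moreover have "0 \<le> (norm (f x) - norm (g x))\<^sup>2" "0 \<le> norm (f x) * norm (g x)" by simp_all
    ultimately show ?thesis unfolding power2_diff by linarith
  qed
  then show "AE x in M. norm (f x \<bullet> g x) \<le> norm ((norm (f x))\<^sup>2 + (norm (g x))\<^sup>2)" by simp
qed

lemma l2_mult_integrable:
  fixes f g :: "'a \<Rightarrow> real"
  shows "l2 M f \<Longrightarrow> l2 M g \<Longrightarrow> integrable M (\<lambda>x. f x * g x)"
  using l2_inner_integrable[of M f g] by simp

lemma l2_add:
  assumes "l2 M f" "l2 M g"
  shows "l2 M (\<lambda>x. f x + g x)"
  unfolding l2_def
proof
  show "(\<lambda>x. f x + g x) \<in> borel_measurable M" using assms unfolding l2_def by auto
  have "(\<lambda>x. (norm (f x + g x))\<^sup>2) = (\<lambda>x. (norm (f x))\<^sup>2 + 2 * (f x \<bullet> g x) + (norm (g x))\<^sup>2)"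
    by (auto simp: power2_norm_eq_inner inner_add_left inner_add_right inner_commute)
  then show "integrable M (\<lambda>x. (norm (f x + g x))\<^sup>2)"
    using assms l2_inner_integrable[OF assms] by (auto simp: l2_def)
qed

lemma l2_scale:
  assumes "l2 M f"
  shows "l2 M (\<lambda>x. c *\<^sub>R f x)"
  using assms unfolding l2_def by (auto simp: power_mult_distrib)

lemma l2_diff: "l2 M f \<Longrightarrow> l2 M g \<Longrightarrow> l2 M (\<lambda>x. f x - g x)"
  using l2_add[of M f "\<lambda>x. (-1) *\<^sub>R g x"] l2_scale[of M g "-1"] by simp

lemma l2_bounded_scaleR:
  fixes c :: "'a \<Rightarrow> real"
  assumes "l2 M f" "c \<in> borel_measurable M" "AE x in M. \<bar>c x\<bar> \<le> K"
  shows "l2 M (\<lambda>x. c x *\<^sub>R f x)"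
  unfolding l2_def
proof
  show m: "(\<lambda>x. c x *\<^sub>R f x) \<in> borel_measurable M" using assms unfolding l2_def by auto
  show "integrable M (\<lambda>x. (norm (c x *\<^sub>R f x))\<^sup>2)"
  proof (rule Bochner_Integration.integrable_bound)
    show "integrable M (\<lambda>x. K\<^sup>2 * (norm (f x))\<^sup>2)" using assms unfolding l2_def by auto
    show "(\<lambda>x. (norm (c x *\<^sub>R f x))\<^sup>2) \<in> borel_measurable M"
      by (rule borel_measurable_power[OF measurable_compose[OF m borel_measurable_norm]])
    show "AE x in M. norm ((norm (c x *\<^sub>R f x))\<^sup>2) \<le> norm (K\<^sup>2 * (norm (f x))\<^sup>2)"
      using assms(3)
    proof eventually_elim
      case (elim x)
      then have "\<bar>c x\<bar>\<^sup>2 \<le> K\<^sup>2" by (intro power_mono) auto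
      then show ?case by (simp add: power_mult_distrib mult_right_mono)
    qed
  qed
qed

lemma l2_inner_Cauchy_Schwarz:
  assumes "l2 M f" "l2 M g"
  shows "(LINT x|M. f x \<bullet> g x)\<^sup>2 \<le> (LINT x|M. (norm (f x))\<^sup>2) * (LINT x|M. (norm (g x))\<^sup>2)"
proof -
  define A where "A = (LINT x|M. (norm (f x))\<^sup>2)"
  define B where "B = (LINT x|M. f x \<bullet> g x)"
  define C where "C = (LINT x|M. (norm (g x))\<^sup>2)"
  have int: "integrable M (\<lambda>x. f x \<bullet> g x)" by (rule l2_inner_integrable[OF assms])
  have q: "0 \<le> A + 2 * t * B + t\<^sup>2 * C" for t
  proof -
    have "0 \<le> (LINT x|M. (norm (f x + t *\<^sub>R g x))\<^sup>2)" by simp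
    also have "(\<lambda>x. (norm (f x + t *\<^sub>R g x))\<^sup>2)
        = (\<lambda>x. (norm (f x))\<^sup>2 + 2 * t * (f x \<bullet> g x) + t\<^sup>2 * (norm (g x))\<^sup>2)"
      by (rule ext) (simp add: power2_norm_eq_inner inner_add_left inner_add_right inner_commute
          algebra_simps power2_eq_square[of t])
    also have "(LINT x|M. (norm (f x))\<^sup>2 + 2 * t * (f x \<bullet> g x) + t\<^sup>2 * (norm (g x))\<^sup>2)
        = A + 2 * t * B + t\<^sup>2 * C"
      unfolding A_def B_def C_def using assms int by (simp add: l2_def)
    finally show ?thesis .
  qed
  have "C \<ge> 0" unfolding C_def by simp
  show ?thesis
  proof (cases "C = 0")
    case True
    have "B = 0"
    proof (rule ccontr)
      assume "B \<noteq> 0"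
      then have "A + 2 * (- (A + 1) / (2 * B)) * B = -1" by (simp add: field_simps)
      then show False using q[of "- (A + 1) / (2 * B)"] True by simp
    qed
    then show ?thesis using True unfolding A_def B_def C_def by simp
  next
    case False
    then have "C > 0" using \<open>C \<ge> 0\<close> by simp
    moreover have "A + 2 * (- B / C) * B + (- B / C)\<^sup>2 * C = A - B\<^sup>2 / C"
      using \<open>C > 0\<close> by (simp add: field_simps power2_eq_square)
    ultimately have "B\<^sup>2 / C \<le> A" using q[of "- B / C"] by simp
    then show ?thesis using \<open>C > 0\<close> unfolding A_def B_def C_def by (simp add: field_simps)
  qed
qed

lemma l2_parallelogram:
  assumes "l2 M f" "l2 M g"
  shows "(LINT x|M. (norm (f x + g x))\<^sup>2) \<le> 2 * (LINT x|M. (norm (f x))\<^sup>2) + 2 * (LINT x|M. (norm (g x))\<^sup>2)"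
    "(LINT x|M. (norm (f x - g x))\<^sup>2) \<le> 2 * (LINT x|M. (norm (f x))\<^sup>2) + 2 * (LINT x|M. (norm (g x))\<^sup>2)"
proof -
  have *: "(norm (a + b))\<^sup>2 \<le> 2 * (norm a)\<^sup>2 + 2 * (norm b)\<^sup>2" for a b :: 'b
  proof -
    have "0 \<le> (norm (a - b))\<^sup>2" by simp
    then show ?thesis
      by (simp add: power2_norm_eq_inner inner_diff_left inner_diff_right inner_add_left inner_add_right inner_commute)
  qed
  have **: "(LINT x|M. (norm (f x + g x))\<^sup>2) \<le> 2 * (LINT x|M. (norm (f x))\<^sup>2) + 2 * (LINT x|M. (norm (g x))\<^sup>2)"
    if "l2 M f" "l2 M g" for f g :: "'a \<Rightarrow> 'b"
  proof -
    have "(LINT x|M. (norm (f x + g x))\<^sup>2) \<le> (LINT x|M. 2 * (norm (f x))\<^sup>2 + 2 * (norm (g x))\<^sup>2)"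
      using that l2_add[OF that] * by (intro integral_mono) (auto simp: l2_def)
    also have "\<dots> = 2 * (LINT x|M. (norm (f x))\<^sup>2) + 2 * (LINT x|M. (norm (g x))\<^sup>2)"
      using that by (simp add: l2_def)
    finally show ?thesis .
  qed
  show "(LINT x|M. (norm (f x + g x))\<^sup>2) \<le> 2 * (LINT x|M. (norm (f x))\<^sup>2) + 2 * (LINT x|M. (norm (g x))\<^sup>2)"
    by (rule **[OF assms])
  show "(LINT x|M. (norm (f x - g x))\<^sup>2) \<le> 2 * (LINT x|M. (norm (f x))\<^sup>2) + 2 * (LINT x|M. (norm (g x))\<^sup>2)"
    using **[OF assms(1) l2_scale[OF assms(2), of "-1"]] by simp
qed

lemma l2_tendsto_inner:
  assumes f: "\<And>n. l2 M (f n)" "l2 M g" and h: "l2 M h"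
    and lim: "(\<lambda>n. LINT x|M. (norm (f n x - g x))\<^sup>2) \<longlonglongrightarrow> 0"
  shows "(\<lambda>n. LINT x|M. f n x \<bullet> h x) \<longlonglongrightarrow> (LINT x|M. g x \<bullet> h x)"
proof -
  have "(\<lambda>n. (LINT x|M. f n x \<bullet> h x) - (LINT x|M. g x \<bullet> h x)) \<longlonglongrightarrow> 0"
  proof (rule Lim_null_comparison)
    define c where "c = sqrt (LINT x|M. (norm (h x))\<^sup>2)"
    have "norm ((LINT x|M. f n x \<bullet> h x) - (LINT x|M. g x \<bullet> h x))
        \<le> sqrt (LINT x|M. (norm (f n x - g x))\<^sup>2) * c" for n
    proof -
      have "(LINT x|M. f n x \<bullet> h x) - (LINT x|M. g x \<bullet> h x) = (LINT x|M. (f n x - g x) \<bullet> h x)"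
        using l2_inner_integrable[OF f(1) h] l2_inner_integrable[OF f(2) h]
        by (simp add: inner_diff_left)
      moreover have "(LINT x|M. (f n x - g x) \<bullet> h x)\<^sup>2 \<le> (sqrt (LINT x|M. (norm (f n x - g x))\<^sup>2) * c)\<^sup>2"
        using l2_inner_Cauchy_Schwarz[OF l2_diff[OF f] h]
        by (simp add: c_def power_mult_distrib)
      ultimately show ?thesis
        by (simp add: c_def abs_le_square_iff[symmetric])
    qed
    then show "\<forall>\<^sub>F n in sequentially. norm ((LINT x|M. f n x \<bullet> h x) - (LINT x|M. g x \<bullet> h x))
        \<le> sqrt (LINT x|M. (norm (f n x - g x))\<^sup>2) * c" by simp
    have "(\<lambda>n. sqrt (LINT x|M. (norm (f n x - g x))\<^sup>2) * c) \<longlonglongrightarrow> sqrt 0 * c"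
      by (intro tendsto_intros lim)
    then show "(\<lambda>n. sqrt (LINT x|M. (norm (f n x - g x))\<^sup>2) * c) \<longlonglongrightarrow> 0" by simp
  qed
  then show ?thesis by (rule LIM_zero_cancel)
qed

text \<open>Let \<open>d\<^sub>k\<close> be the increments of a subsequence, chosen with squared norms below \<open>4\<^sup>-\<^sup>k\<close>. Then
\<open>\<Sum>k. 2\<^sup>k \<bar>d\<^sub>k\<bar>\<^sup>2\<close> has finite integral and is finite almost everywhere; since
\<open>\<bar>d\<^sub>k\<bar> \<le> 2\<^sup>-\<^sup>k + 2\<^sup>k \<bar>d\<^sub>k\<bar>\<^sup>2\<close>, the subsequence converges almost everywhere. Fatou's lemma identifies
the pointwise limit as the limit in \<open>L\<^sup>2\<close>.\<close>

theorem Riesz_Fischer_l2: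
  fixes f :: "nat \<Rightarrow> 'a \<Rightarrow> 'b::euclidean_space"
  assumes f: "\<And>n. l2 M (f n)"
    and Cauchy: "\<And>e. e > 0 \<Longrightarrow> \<exists>N. \<forall>m\<ge>N. \<forall>n\<ge>N. (LINT x|M. (norm (f m x - f n x))\<^sup>2) < e"
  shows "\<exists>g. l2 M g \<and> (\<lambda>n. LINT x|M. (norm (f n x - g x))\<^sup>2) \<longlonglongrightarrow> 0"
proof -
  have meas[measurable]: "f n \<in> borel_measurable M" for n using f unfolding l2_def by blast
  define I where "I m n = (LINT x|M. (norm (f m x - f n x))\<^sup>2)" for m n
  have nnI: "(\<integral>\<^sup>+x. ennreal ((norm (f m x - f n x))\<^sup>2) \<partial>M) = ennreal (I m n)" for m n
    unfolding I_def using l2_norm_integrable[OF l2_diff[OF f f]] by (intro nn_integral_eq_integral) auto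
  have "\<exists>N. \<forall>m\<ge>N. \<forall>n\<ge>N. I m n < (1/4) ^ k" for k
    unfolding I_def by (rule Cauchy) simp
  then obtain N where N: "\<And>k m n. m \<ge> N k \<Longrightarrow> n \<ge> N k \<Longrightarrow> I m n < (1/4) ^ k" by metis
  (* increasing, unbounded and at least N k *)
  define r where "r k = (\<Sum>j\<le>k. N j) + k" for k
  have r_ge: "r k \<ge> N k" for k
    unfolding r_def by (meson finite_atMost atMost_iff le_refl member_le_sum trans_le_add1 zero_le)
  have r_Suc: "r (Suc k) \<ge> r k" for k unfolding r_def by simp
  have r_top: "r k \<ge> k" for k unfolding r_def by simp
  define d where "d k x = f (r (Suc k)) x - f (r k) x" for k x
  have "(\<integral>\<^sup>+x. (\<Sum>k. ennreal (2 ^ k * (norm (d k x))\<^sup>2)) \<partial>M)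
      = (\<Sum>k. \<integral>\<^sup>+x. ennreal (2 ^ k * (norm (d k x))\<^sup>2) \<partial>M)"
    unfolding d_def by (intro nn_integral_suminf) auto
  also have "\<dots> \<le> (\<Sum>k. ennreal ((1/2) ^ k))"
  proof (rule suminf_le)
    fix k
    have "(\<integral>\<^sup>+x. ennreal (2 ^ k * (norm (d k x))\<^sup>2) \<partial>M)
        = ennreal (2 ^ k) * (\<integral>\<^sup>+x. ennreal ((norm (d k x))\<^sup>2) \<partial>M)"
      unfolding d_def by (subst nn_integral_cmult[symmetric]) (auto simp: ennreal_mult)
    also have "\<dots> = ennreal (2 ^ k) * ennreal (I (r (Suc k)) (r k))"
      unfolding d_def nnI ..
    also have "\<dots> \<le> ennreal (2 ^ k) * ennreal ((1/4) ^ k)"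
      using N[of k "r (Suc k)" "r k"] r_ge[of k] r_Suc[of k]
      by (intro mult_left_mono ennreal_leI) auto
    also have "\<dots> = ennreal ((1/2) ^ k)"
      by (simp add: ennreal_mult[symmetric] power_mult_distrib[symmetric])
    finally show "(\<integral>\<^sup>+x. ennreal (2 ^ k * (norm (d k x))\<^sup>2) \<partial>M) \<le> ennreal ((1/2) ^ k)" .
  qed auto
  also have "\<dots> < \<infinity>"
    by (subst suminf_ennreal2) (auto intro: summable_geometric)
  finally have "(\<integral>\<^sup>+x. (\<Sum>k. ennreal (2 ^ k * (norm (d k x))\<^sup>2)) \<partial>M) \<noteq> \<infinity>" by simp
  then have AE_fin: "AE x in M. (\<Sum>k. ennreal (2 ^ k * (norm (d k x))\<^sup>2)) \<noteq> \<infinity>"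
    unfolding d_def by (intro nn_integral_PInf_AE) auto
  define g where "g x = lim (\<lambda>k. f (r k) x)" for x
  have g_meas[measurable]: "g \<in> borel_measurable M" unfolding g_def by simp
  have AE_lim: "AE x in M. (\<lambda>k. f (r k) x) \<longlonglongrightarrow> g x"
    using AE_fin
  proof eventually_elim
    case (elim x)
    then have s1: "summable (\<lambda>k. 2 ^ k * (norm (d k x))\<^sup>2)"
      by (intro summable_suminf_not_top) auto
    have s2: "summable (\<lambda>k. (1/2) ^ k + 2 ^ k * (norm (d k x))\<^sup>2 :: real)"
      by (intro summable_add s1 summable_geometric) simp
    have "summable (\<lambda>k. d k x)"
    proof (rule summable_comparison_test[OF _ s2], intro exI[of _ 0] allI impI)
      fix k :: nat
      have "0 \<le> 2 ^ k * ((1/2) ^ k - norm (d k x))\<^sup>2" by simp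
      also have "\<dots> = 2 ^ k * ((1/2) ^ k)\<^sup>2 - 2 * (2 ^ k * (1/2) ^ k) * norm (d k x) + 2 ^ k * (norm (d k x))\<^sup>2"
        by (simp add: power2_diff algebra_simps)
      also have "(2::real) ^ k * (1/2) ^ k = 1" by (simp add: power_mult_distrib[symmetric])
      also have "(2::real) ^ k * ((1/2) ^ k)\<^sup>2 = (1/2) ^ k"
        by (simp add: power2_eq_square power_mult_distrib[symmetric] mult.assoc[symmetric])
      finally show "norm (d k x) \<le> (1/2) ^ k + 2 ^ k * (norm (d k x))\<^sup>2"
        using norm_ge_zero[of "d k x"] by linarith
    qed
    then have "convergent (\<lambda>k. \<Sum>j<k. d j x)" by (simp add: summable_iff_convergent)
    also have "(\<lambda>k. \<Sum>j<k. d j x) = (\<lambda>k. f (r k) x - f (r 0) x)"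
      unfolding d_def using sum_lessThan_telescope[of "\<lambda>j. f (r j) x"] by (intro ext) simp
    finally have "convergent (\<lambda>k. f (r k) x)" by (simp add: convergent_diff_const_right_iff)
    then show ?case unfolding g_def by (simp add: convergent_LIMSEQ_iff)
  qed
  have bound: "(\<integral>\<^sup>+x. ennreal ((norm (f n x - g x))\<^sup>2) \<partial>M) \<le> ennreal ((1/4) ^ k)" if n: "n \<ge> N k" for n k
  proof -
    have "(\<integral>\<^sup>+x. ennreal ((norm (f n x - g x))\<^sup>2) \<partial>M)
        = (\<integral>\<^sup>+x. liminf (\<lambda>j. ennreal ((norm (f n x - f (r j) x))\<^sup>2)) \<partial>M)"
    proof (rule nn_integral_cong_AE)
      show "AE x in M. ennreal ((norm (f n x - g x))\<^sup>2) = liminf (\<lambda>j. ennreal ((norm (f n x - f (r j) x))\<^sup>2))"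
        using AE_lim
      proof eventually_elim
        case (elim x)
        have "(\<lambda>j. ennreal ((norm (f n x - f (r j) x))\<^sup>2)) \<longlonglongrightarrow> ennreal ((norm (f n x - g x))\<^sup>2)"
          by (intro tendsto_ennrealI tendsto_intros elim)
        then show ?case by (intro lim_imp_Liminf[symmetric]) auto
      qed
    qed
    also have "\<dots> \<le> liminf (\<lambda>j. \<integral>\<^sup>+x. ennreal ((norm (f n x - f (r j) x))\<^sup>2) \<partial>M)"
      by (intro nn_integral_liminf) auto
    also have "\<dots> = liminf (\<lambda>j. ennreal (I n (r j)))" unfolding nnI ..
    also have "\<dots> \<le> liminf (\<lambda>j. ennreal ((1/4) ^ k))"
    proof (rule Liminf_mono)
      have "ennreal (I n (r j)) \<le> ennreal ((1/4) ^ k)" if "j \<ge> N k" for j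
        using N[OF n, of "r j"] that r_top[of j] by (intro ennreal_leI) auto
      then show "\<forall>\<^sub>F j in sequentially. ennreal (I n (r j)) \<le> ennreal ((1/4) ^ k)"
        unfolding eventually_sequentially by blast
    qed
    also have "\<dots> = ennreal ((1/4) ^ k)" by (simp add: Liminf_const)
    finally show ?thesis .
  qed
  have fin: "(\<integral>\<^sup>+x. ennreal ((norm (f n x - g x))\<^sup>2) \<partial>M) < \<infinity>" if "n \<ge> N 0" for n
    using bound[OF that] by (rule le_less_trans) simp
  have l2_fg: "l2 M (\<lambda>x. f n x - g x)" if "n \<ge> N 0" for n
    unfolding l2_def using fin[OF that] by (auto intro!: integrableI_bounded)
  have "l2 M (\<lambda>x. f (N 0) x - (f (N 0) x - g x))"
    by (rule l2_diff[OF f l2_fg]) simp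
  then have g: "l2 M g" by simp
  have "(\<lambda>n. LINT x|M. (norm (f n x - g x))\<^sup>2) \<longlonglongrightarrow> 0"
  proof (rule LIMSEQ_I)
    fix e :: real assume "e > 0"
    then obtain k where k: "(1/4) ^ k < e" using real_arch_pow_inv[of e "1/4"] by auto
    have "norm ((LINT x|M. (norm (f n x - g x))\<^sup>2) - 0) < e" if n: "n \<ge> N k" for n
    proof -
      have "ennreal (LINT x|M. (norm (f n x - g x))\<^sup>2) = (\<integral>\<^sup>+x. ennreal ((norm (f n x - g x))\<^sup>2) \<partial>M)"
        using l2_norm_integrable[OF l2_diff[OF f g]] by (intro nn_integral_eq_integral[symmetric]) auto
      also have "\<dots> \<le> ennreal ((1/4) ^ k)" by (rule bound[OF n])
      finally have "(LINT x|M. (norm (f n x - g x))\<^sup>2) \<le> (1/4) ^ k" by simp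
      then show ?thesis using k by simp
    qed
    then show "\<exists>no. \<forall>n\<ge>no. norm ((LINT x|M. (norm (f n x - g x))\<^sup>2) - 0) < e" by blast
  qed
  then show ?thesis using g by blast
qed

section \<open>Calculus of smooth functions\<close>

lemma pdiff_eq: "(f has_derivative f') (at x) \<Longrightarrow> pdiff b f x = f' b"
  unfolding pdiff_def using frechet_derivative_at by metis

lemma Ck_on_const: "Ck_on k UNIV (\<lambda>x. c)"
proof (induction k arbitrary: c)
  case (Suc k)
  have "pdiff b (\<lambda>x. c) = (\<lambda>x. 0)" for b :: 'a
    using pdiff_eq[OF has_derivative_const] by auto
  then show ?case using Suc[of 0] by simp
qed simp

lemma Ck_on_add: "Ck_on k UNIV f \<Longrightarrow> Ck_on k UNIV g \<Longrightarrow> Ck_on k UNIV (\<lambda>x. f x + g x)"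
proof (induction k arbitrary: f g)
  case 0
  then show ?case by (simp add: continuous_on_add)
next
  case (Suc k)
  have "pdiff b (\<lambda>x. f x + g x) = (\<lambda>x. pdiff b f x + pdiff b g x)" for b :: 'a
  proof
    fix x
    have "(f has_derivative frechet_derivative f (at x)) (at x)"
      "(g has_derivative frechet_derivative g (at x)) (at x)"
      using Suc.prems by (simp_all add: frechet_derivative_works[symmetric])
    from pdiff_eq[OF has_derivative_add[OF this]]
    show "pdiff b (\<lambda>x. f x + g x) x = pdiff b f x + pdiff b g x" by (simp add: pdiff_def)
  qed
  then show ?case using Suc by (simp add: continuous_on_add)
qed

lemma Ck_on_Suc: "Ck_on (Suc k) S f \<Longrightarrow> Ck_on k S f"
  by (induction k arbitrary: f) auto

lemma Ck_on_mult: "Ck_on k UNIV f \<Longrightarrow> Ck_on k UNIV g \<Longrightarrow> Ck_on k UNIV (\<lambda>x. f x * g x)"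
proof (induction k arbitrary: f g)
  case 0
  then show ?case by (simp add: continuous_on_mult)
next
  case (Suc k)
  have "pdiff b (\<lambda>x. f x * g x) = (\<lambda>x. f x * pdiff b g x + pdiff b f x * g x)" for b :: 'a
  proof
    fix x
    have "(f has_derivative frechet_derivative f (at x)) (at x)"
      "(g has_derivative frechet_derivative g (at x)) (at x)"
      using Suc.prems by (simp_all add: frechet_derivative_works[symmetric])
    from pdiff_eq[OF has_derivative_mult[OF this]]
    show "pdiff b (\<lambda>x. f x * g x) x = f x * pdiff b g x + pdiff b f x * g x" by (simp add: pdiff_def)
  qed
  moreover have "Ck_on k UNIV f" "Ck_on k UNIV g" by (fact Suc.prems[THEN Ck_on_Suc])+
  ultimately show ?case using Suc by (simp add: continuous_on_mult Ck_on_add)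
qed

lemma Ck_on_prod:
  assumes "finite A" "\<And>i. i \<in> A \<Longrightarrow> Ck_on k UNIV (f i)"
  shows "Ck_on k UNIV (\<lambda>x. \<Prod>i\<in>A. f i x)"
  using assms by (induction A rule: finite_induct) (auto intro: Ck_on_const Ck_on_mult)

section \<open>Smooth bump functions on boxes\<close>

text \<open>A one-variable counterpart of \<open>Ck_on\<close> in which derivatives are ordinary ones; composing with affine
functions produces functions of several variables.\<close>

primrec real_Ck :: "nat \<Rightarrow> (real \<Rightarrow> real) \<Rightarrow> bool" where
  "real_Ck 0 h = continuous_on UNIV h"
| "real_Ck (Suc k) h = (\<exists>h'. (\<forall>t. (h has_real_derivative h' t) (at t)) \<and> real_Ck k h')"

lemma real_Ck_comb: "real_Ck k f \<Longrightarrow> real_Ck k g \<Longrightarrow> real_Ck k (\<lambda>t. c * f t + d * g t)"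
proof (induction k arbitrary: f g)
  case 0
  then show ?case by (auto intro!: continuous_intros)
next
  case (Suc k)
  then obtain f' g' where "\<And>t. (f has_real_derivative f' t) (at t)" "real_Ck k f'"
    "\<And>t. (g has_real_derivative g' t) (at t)" "real_Ck k g'" by auto
  then show ?case using Suc.IH[of f' g']
    by (auto intro!: exI[of _ "\<lambda>t. c * f' t + d * g' t"] derivative_eq_intros)
qed

lemma Ck_on_compose_linear:
  "real_Ck k h \<Longrightarrow> Ck_on k UNIV (\<lambda>x::'a::euclidean_space. h (x \<bullet> e + d))"
proof (induction k arbitrary: h)
  case 0
  have "continuous_on UNIV (\<lambda>x::'a. x \<bullet> e + d)" by (intro continuous_intros)
  then show ?case using 0 continuous_on_compose2[of UNIV h UNIV "\<lambda>x. x \<bullet> e + d"] by simp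
next
  case (Suc k)
  then obtain h' where h': "\<And>t. (h has_real_derivative h' t) (at t)" "real_Ck k h'" by auto
  have d: "((\<lambda>x::'a. h (x \<bullet> e + d)) has_derivative (\<lambda>y. h' (x \<bullet> e + d) * (y \<bullet> e))) (at x)" for x
    by (rule has_derivative_eq_rhs[OF DERIV_compose_FDERIV[OF h'(1)]])
      (auto intro!: derivative_eq_intros)
  have p: "pdiff b (\<lambda>x::'a. h (x \<bullet> e + d)) = (\<lambda>x. h' (x \<bullet> e + d) * (b \<bullet> e))" for b
    using pdiff_eq[OF d] by auto
  have "(\<lambda>x::'a. h (x \<bullet> e + d)) differentiable (at x)" for x
    using d unfolding differentiable_def by blast
  moreover from this have "continuous_on UNIV (\<lambda>x::'a. h (x \<bullet> e + d))"
    by (simp add: continuous_at_imp_continuous_on differentiable_imp_continuous_within)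
  ultimately show ?case using Suc.IH[OF h'(2)] by (simp add: p Ck_on_mult Ck_on_const)
qed

text \<open>The functions \<open>t\<^sup>-\<^sup>n exp (- 1/t)\<close>, extended by zero to \<open>t \<le> 0\<close>. Only \<open>n = 0\<close> is used as a cutoff; the others
make the family closed under differentiation.\<close>

definition flat :: "nat \<Rightarrow> real \<Rightarrow> real" where
  "flat n t = (if t > 0 then exp (- inverse t) * inverse t ^ n else 0)"

lemma flat_tendsto_0: "(flat n \<longlongrightarrow> 0) (at 0)"
proof -
  have "((\<lambda>x::real. x ^ n / exp x) \<longlongrightarrow> 0) at_top" by (rule tendsto_power_div_exp_0)
  from filterlim_compose[OF this filterlim_inverse_at_top_right]
  have "((\<lambda>t::real. inverse t ^ n / exp (inverse t)) \<longlongrightarrow> 0) (at_right 0)" .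
  then have r: "(flat n \<longlongrightarrow> 0) (at_right 0)"
    by (rule Lim_transform_eventually)
      (auto simp: flat_def exp_minus field_simps eventually_at_right_less intro!: eventually_at_rightI[of 0 1])
  have "(flat n \<longlongrightarrow> 0) (at_left 0)"
    by (rule tendsto_eventually) (auto simp: flat_def intro!: eventually_at_leftI[of "-1" 0])
  with r show ?thesis by (simp add: filterlim_at_split)
qed

lemma flat_has_derivative:
  "(flat n has_real_derivative - real n * flat (Suc n) t + flat (Suc (Suc n)) t) (at t)"
proof (cases t "0::real" rule: linorder_cases)
  case less
  have "((\<lambda>_. 0) has_real_derivative 0) (at t)" by simp
  then have "(flat n has_real_derivative 0) (at t)"
    by (rule has_field_derivative_transform_within_open[where S = "{..<0}"]) (use less in \<open>auto simp: flat_def\<close>)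
  then show ?thesis using less by (simp add: flat_def)
next
  case equal
  have "((\<lambda>h. (flat n (0 + h) - flat n 0) / h) \<longlongrightarrow> 0) (at 0)"
  proof (rule Lim_transform_eventually[OF flat_tendsto_0[of "Suc n"]])
    show "\<forall>\<^sub>F h in at 0. flat (Suc n) h = (flat n (0 + h) - flat n 0) / h"
      by (rule always_eventually) (auto simp: flat_def field_simps)
  qed
  then show ?thesis using equal by (simp add: DERIV_def flat_def)
next
  case greater
  have e: "((\<lambda>t. exp (- inverse t)) has_real_derivative exp (- inverse t) * (inverse t)\<^sup>2) (at t)"
    using greater by (auto intro!: derivative_eq_intros simp: power2_eq_square)
  have p: "((\<lambda>t. inverse t ^ n) has_real_derivative - real n * inverse t ^ Suc n) (at t)"
  proof (rule DERIV_cong[OF DERIV_power[OF DERIV_inverse]])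
    show "real n * (- (inverse t ^ Suc (Suc 0)) * inverse t ^ (n - Suc 0)) = - real n * inverse t ^ Suc n"
      by (cases n) (simp_all add: algebra_simps)
  qed (use greater in simp)
  have "((\<lambda>t. exp (- inverse t) * inverse t ^ n) has_real_derivative
      - real n * flat (Suc n) t + flat (Suc (Suc n)) t) (at t)"
    using greater by (intro DERIV_cong[OF DERIV_mult[OF e p]]) (simp add: flat_def power2_eq_square)
  then show ?thesis
    by (rule has_field_derivative_transform_within_open[where S = "{0<..}"]) (use greater in \<open>auto simp: flat_def\<close>)
qed

text \<open>The derivative of \<open>flat n\<close> is a combination of \<open>flat (n + 1)\<close> and \<open>flat (n + 2)\<close>, so the induction on the order
of differentiability has to cover all \<open>n\<close> simultaneously.\<close>

lemma real_Ck_flat: "real_Ck k (flat n)"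
proof (induction k arbitrary: n)
  case 0
  then show ?case
    using flat_has_derivative[of n] by (auto intro!: continuous_at_imp_continuous_on DERIV_isCont)
next
  case (Suc k)
  have "real_Ck k (\<lambda>t. - real n * flat (Suc n) t + 1 * flat (Suc (Suc n)) t)"
    by (intro real_Ck_comb Suc)
  then show ?case unfolding real_Ck.simps using flat_has_derivative[of n]
    by (intro exI[of _ "\<lambda>t. - real n * flat (Suc n) t + flat (Suc (Suc n)) t"]) simp
qed

lemma real_Ck_scale_arg: "real_Ck k h \<Longrightarrow> real_Ck k (\<lambda>t. h (c * t))"
proof (induction k arbitrary: h)
  case 0
  have "continuous_on UNIV (\<lambda>t::real. c * t)" by (intro continuous_intros)
  then show ?case using 0 continuous_on_compose2[of UNIV h UNIV "\<lambda>t. c * t"] by simp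
next
  case (Suc k)
  then obtain h' where h': "\<And>t. (h has_real_derivative h' t) (at t)" "real_Ck k h'" by auto
  have "((\<lambda>t. h (c * t)) has_real_derivative h' (c * t) * c) (at t)" for t
    by (rule DERIV_chain2[OF h'(1)]) (auto intro!: derivative_eq_intros)
  moreover have "real_Ck k (\<lambda>t. c * h' (c * t) + 0 * h' (c * t))"
    by (intro real_Ck_comb Suc.IH h')
  ultimately show ?case by (auto simp: mult.commute intro!: exI[of _ "\<lambda>t. c * h' (c * t)"])
qed

text \<open>Smooth functions that vanish outside the box and converge to its indicator as \<open>k \<rightarrow> \<infinity>\<close>: the argument of
the cutoff in each coordinate is magnified.\<close>

definition box_bump :: "'a::euclidean_space \<Rightarrow> 'a \<Rightarrow> nat \<Rightarrow> 'a \<Rightarrow> real" where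
  "box_bump p q k x = (\<Prod>b\<in>Basis. flat 0 (real (Suc k) * (x \<bullet> b - p \<bullet> b)) * flat 0 (real (Suc k) * (q \<bullet> b - x \<bullet> b)))"

lemma smooth_box_bump: "smooth (box_bump p q k)"
  unfolding smooth_def box_bump_def
proof (intro allI Ck_on_prod Ck_on_mult)
  fix j and b :: 'a
  have r: "real_Ck j (\<lambda>t. flat 0 (c * t))" for c by (intro real_Ck_scale_arg real_Ck_flat)
  show "Ck_on j UNIV (\<lambda>x::'a. flat 0 (real (Suc k) * (x \<bullet> b - p \<bullet> b)))"
    using Ck_on_compose_linear[OF r[of "real (Suc k)"], of b "- (p \<bullet> b)"] by simp
  have "(\<lambda>x::'a. flat 0 (real (Suc k) * (q \<bullet> b - x \<bullet> b)))
      = (\<lambda>x. flat 0 (real (Suc k) * (x \<bullet> (- b) + q \<bullet> b)))"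
    by (simp add: algebra_simps)
  then show "Ck_on j UNIV (\<lambda>x::'a. flat 0 (real (Suc k) * (q \<bullet> b - x \<bullet> b)))"
    using Ck_on_compose_linear[OF r[of "real (Suc k)"], of "- b" "q \<bullet> b"] by simp
qed simp

lemma flat_0_bounds: "0 \<le> flat 0 t" "flat 0 t \<le> 1"
  by (auto simp: flat_def)

lemma box_bump_bounds: "0 \<le> box_bump p q k x" "box_bump p q k x \<le> 1"
  unfolding box_bump_def by (auto intro!: prod_nonneg prod_le_1 mult_le_one simp: flat_0_bounds)

lemma box_bump_eq_0: "x \<notin> box p q \<Longrightarrow> box_bump p q k x = 0"
proof -
  assume "x \<notin> box p q"
  then obtain b where b: "b \<in> Basis" "x \<bullet> b \<le> p \<bullet> b \<or> q \<bullet> b \<le> x \<bullet> b"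
    by (auto simp: mem_box not_less)
  have "flat 0 (real (Suc k) * (x \<bullet> b - p \<bullet> b)) * flat 0 (real (Suc k) * (q \<bullet> b - x \<bullet> b)) = 0"
    using b(2) by (auto simp: flat_def zero_less_mult_iff)
  then show ?thesis unfolding box_bump_def using b(1) by (subst prod_zero_iff) auto
qed

lemma box_bump_tendsto: "(\<lambda>k. box_bump p q k x) \<longlonglongrightarrow> indicator (box p q) x"
proof (cases "x \<in> box p q")
  case True
  have f: "(\<lambda>k. flat 0 (real (Suc k) * c)) \<longlonglongrightarrow> 1" if "c > 0" for c
  proof -
    have "(\<lambda>k. inverse (real (Suc k)) * inverse c) \<longlonglongrightarrow> 0"
      by (rule tendsto_mult_left_zero[OF LIMSEQ_inverse_real_of_nat])
    from tendsto_exp[OF tendsto_minus[OF this]]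
    have "(\<lambda>k. exp (- (inverse (real (Suc k)) * inverse c))) \<longlonglongrightarrow> 1" by simp
    moreover have "(\<lambda>k. flat 0 (real (Suc k) * c)) = (\<lambda>k. exp (- (inverse (real (Suc k)) * inverse c)))"
      using that by (auto simp: flat_def zero_less_mult_iff)
    ultimately show ?thesis by simp
  qed
  have "(\<lambda>k. box_bump p q k x) \<longlonglongrightarrow> (\<Prod>b\<in>(Basis::'a set). 1 * 1)"
    unfolding box_bump_def using True by (intro tendsto_prod tendsto_mult f) (auto simp: mem_box)
  then show ?thesis using True by simp
next
  case False
  then show ?thesis by (simp add: box_bump_eq_0)
qed

lemma box_bump_test:
  assumes "cbox p q \<subseteq> \<Omega>"
  shows "box_bump p q k \<in> test_functions \<Omega>"
proof -
  have "box_bump p q k x = 0" if "x \<notin> cbox p q" for x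
    using that box_subset_cbox[of p q] by (intro box_bump_eq_0) auto
  then show ?thesis
    unfolding test_functions_def using assms smooth_box_bump compact_cbox[of p q]
    by (intro CollectI conjI exI[of _ "cbox p q"]) simp_all
qed

section \<open>Gradients and test functions\<close>

lemma smooth_differentiable: "smooth f \<Longrightarrow> f differentiable (at x)"
  unfolding smooth_def by (drule spec[of _ "Suc 0"]) simp

lemma smooth_continuous: "smooth f \<Longrightarrow> continuous_on UNIV f"
  unfolding smooth_def by (drule spec[of _ 0]) simp

lemma smooth_continuous_pdiff: "smooth f \<Longrightarrow> b \<in> Basis \<Longrightarrow> continuous_on UNIV (pdiff b f)"
  unfolding smooth_def by (drule spec[of _ "Suc 0"]) simp

lemma smooth_add: "smooth f \<Longrightarrow> smooth g \<Longrightarrow> smooth (\<lambda>x. f x + g x)"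
  unfolding smooth_def by (simp add: Ck_on_add)

lemma smooth_mult: "smooth f \<Longrightarrow> smooth g \<Longrightarrow> smooth (\<lambda>x. f x * g x)"
  unfolding smooth_def by (simp add: Ck_on_mult)

lemma smooth_const: "smooth (\<lambda>x. c)"
  unfolding smooth_def by (simp add: Ck_on_const)

lemma frechet_eq_grad:
  assumes "f differentiable (at x)"
  shows "frechet_derivative f (at x) h = grad f x \<bullet> h"
proof -
  have lin: "linear (frechet_derivative f (at x))" by (rule linear_frechet_derivative[OF assms])
  have "frechet_derivative f (at x) h = frechet_derivative f (at x) (\<Sum>b\<in>Basis. (h \<bullet> b) *\<^sub>R b)"
    by (simp add: euclidean_representation)
  also have "\<dots> = (\<Sum>b\<in>Basis. (h \<bullet> b) * frechet_derivative f (at x) b)"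
    using lin by (simp add: linear_sum linear_scale)
  also have "\<dots> = grad f x \<bullet> h"
    unfolding grad_def pdiff_def inner_sum_left by (simp add: inner_commute mult.commute)
  finally show ?thesis .
qed

lemma has_derivative_grad:
  assumes "f differentiable (at x)"
  shows "(f has_derivative (\<lambda>h. grad f x \<bullet> h)) (at x)"
proof -
  have "frechet_derivative f (at x) = (\<lambda>h. grad f x \<bullet> h)"
    using frechet_eq_grad[OF assms] by (rule ext)
  then show ?thesis using frechet_derivative_works assms by metis
qed

lemma pdiff_eq_grad: "f differentiable (at x) \<Longrightarrow> pdiff b f x = grad f x \<bullet> b"
  unfolding pdiff_def by (rule frechet_eq_grad)

lemma grad_eqI:
  assumes "(f has_derivative (\<lambda>h. g \<bullet> h)) (at x)"
  shows "grad f x = g"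
  using pdiff_eq[OF assms] by (simp add: grad_def euclidean_representation)

lemma smooth_continuous_grad:
  assumes "smooth f"
  shows "continuous_on UNIV (grad f)"
  unfolding grad_def[abs_def]
  by (intro continuous_on_sum continuous_on_scaleR continuous_on_const smooth_continuous_pdiff assms)

lemma grad_eq_0_outside:
  assumes "compact K" "\<And>x. x \<notin> K \<Longrightarrow> f x = 0" "x \<notin> K"
  shows "grad f x = 0"
proof (rule grad_eqI)
  have "((\<lambda>x. 0) has_derivative (\<lambda>h. 0)) (at x)" by simp
  then have "(f has_derivative (\<lambda>h. 0)) (at x)"
    by (rule has_derivative_transform_within_open[where s = "- K"])
      (use assms in \<open>auto simp: compact_imp_closed open_Compl\<close>)
  then show "(f has_derivative (\<lambda>h. 0 \<bullet> h)) (at x)" by simp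
qed

lemma test_functionsE:
  assumes "\<eta> \<in> test_functions \<Omega>"
  obtains K where "smooth \<eta>" "compact K" "K \<subseteq> \<Omega>" "\<forall>x. x \<notin> K \<longrightarrow> \<eta> x = 0"
  using assms unfolding test_functions_def by blast

lemma test_functions_add:
  assumes "\<eta> \<in> test_functions \<Omega>" "\<zeta> \<in> test_functions \<Omega>"
  shows "(\<lambda>x. \<eta> x + \<zeta> x) \<in> test_functions \<Omega>"
proof -
  obtain K where K0: "smooth \<eta>" "compact K" "K \<subseteq> \<Omega>" "\<forall>x. x \<notin> K \<longrightarrow> \<eta> x = 0"
    using assms(1) by (rule test_functionsE)
  note K = K0(1-3) K0(4)[rule_format]
  obtain L where L0: "smooth \<zeta>" "compact L" "L \<subseteq> \<Omega>" "\<forall>x. x \<notin> L \<longrightarrow> \<zeta> x = 0"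
    using assms(2) by (rule test_functionsE)
  note L = L0(1-3) L0(4)[rule_format]
  show ?thesis unfolding test_functions_def using K L
    by (intro CollectI conjI exI[of _ "K \<union> L"]) (auto simp: smooth_add compact_Un)
qed

lemma test_functions_scale:
  assumes "\<eta> \<in> test_functions \<Omega>"
  shows "(\<lambda>x. c * \<eta> x) \<in> test_functions \<Omega>"
proof -
  obtain K where K0: "smooth \<eta>" "compact K" "K \<subseteq> \<Omega>" "\<forall>x. x \<notin> K \<longrightarrow> \<eta> x = 0"
    using assms(1) by (rule test_functionsE)
  note K = K0(1-3) K0(4)[rule_format]
  show ?thesis unfolding test_functions_def using K
    by (intro CollectI conjI exI[of _ K]) (auto simp: smooth_mult smooth_const)
qed

lemma test_functions_0: "(\<lambda>x. 0) \<in> test_functions \<Omega>"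
  unfolding test_functions_def by (intro CollectI conjI exI[of _ "{}"]) (auto simp: smooth_const)

lemma grad_add:
  assumes "smooth f" "smooth g"
  shows "grad (\<lambda>x. f x + g x) x = grad f x + grad g x"
proof (rule grad_eqI)
  have "((\<lambda>x. f x + g x) has_derivative (\<lambda>h. grad f x \<bullet> h + grad g x \<bullet> h)) (at x)"
    using assms by (intro has_derivative_add has_derivative_grad smooth_differentiable)
  then show "((\<lambda>x. f x + g x) has_derivative (\<bullet>) (grad f x + grad g x)) (at x)"
    by (rule has_derivative_eq_rhs) (simp add: inner_add_left fun_eq_iff)
qed

lemma grad_scale:
  assumes "smooth f"
  shows "grad (\<lambda>x. c * f x) x = c *\<^sub>R grad f x"
proof (rule grad_eqI)
  have "((\<lambda>x. c * f x) has_derivative (\<lambda>h. c * (grad f x \<bullet> h))) (at x)"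
    using assms by (intro has_derivative_mult_right has_derivative_grad smooth_differentiable)
  then show "((\<lambda>x. c * f x) has_derivative (\<bullet>) (c *\<^sub>R grad f x)) (at x)"
    by (rule has_derivative_eq_rhs) (simp add: fun_eq_iff)
qed

lemma has_real_derivative_along_line:
  assumes "smooth f"
  shows "((\<lambda>t. f (x + t *\<^sub>R h)) has_real_derivative (grad f (x + t *\<^sub>R h) \<bullet> h)) (at t)"
proof -
  have "((\<lambda>t. x + t *\<^sub>R h) has_derivative (\<lambda>s. s *\<^sub>R h)) (at t)"
    by (auto intro!: derivative_eq_intros)
  from has_derivative_compose[OF this has_derivative_grad[OF smooth_differentiable[OF assms]]]
  show ?thesis unfolding has_field_derivative_def
    by (rule has_derivative_eq_rhs) (simp add: fun_eq_iff mult.commute)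
qed

section \<open>Integrals of compactly supported functions\<close>

lemma compact_support_integrable:
  fixes f :: "'a::euclidean_space \<Rightarrow> 'b::euclidean_space"
  assumes "continuous_on UNIV f" "compact K" "\<And>x. x \<notin> K \<Longrightarrow> f x = 0"
  shows "integrable lborel f"
proof -
  have "integrable lborel (\<lambda>x. indicator K x *\<^sub>R f x)"
    using assms(1) by (intro borel_integrable_compact assms(2)) (rule continuous_on_subset, auto)
  moreover have "(\<lambda>x. indicator K x *\<^sub>R f x) = f" using assms(3) by (auto simp: indicator_def)
  ultimately show ?thesis by simp
qed

lemma compact_support_lebesgue_on:
  fixes f :: "'a::euclidean_space \<Rightarrow> 'b::euclidean_space"
  assumes "continuous_on UNIV f" "compact K" "K \<subseteq> \<Omega>" "\<And>x. x \<notin> K \<Longrightarrow> f x = 0" "open \<Omega>"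
  shows "integrable (lebesgue_on \<Omega>) f" "(LINT x|lebesgue_on \<Omega>. f x) = (LINT x|lborel. f x)"
    "l2 (lebesgue_on \<Omega>) f"
proof -
  have O: "\<Omega> \<inter> space lebesgue \<in> sets lebesgue" using assms(5) by simp
  have *: "integrable (lebesgue_on \<Omega>) f \<and> (LINT x|lebesgue_on \<Omega>. f x) = (LINT x|lborel. f x)"
    if f: "continuous_on UNIV f" "\<And>x. x \<notin> K \<Longrightarrow> f x = 0" for f :: "'a \<Rightarrow> 'c::euclidean_space"
  proof -
    have i: "integrable lborel f" using f assms(2) by (intro compact_support_integrable)
    have "indicator \<Omega> x *\<^sub>R f x = f x" for x
      by (cases "x \<in> K") (use f(2) assms(3) in \<open>auto simp: indicator_def\<close>)
    then have e: "(\<lambda>x. indicator \<Omega> x *\<^sub>R f x) = f" by (rule ext)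
    have m: "f \<in> borel_measurable lborel" using i by (rule borel_measurable_integrable)
    have "integrable lebesgue f" using i m by (simp add: integrable_completion)
    then have "integrable (lebesgue_on \<Omega>) f" unfolding integrable_restrict_space[OF O] e .
    moreover have "(LINT x|lebesgue_on \<Omega>. f x) = (LINT x|lborel. f x)"
      unfolding integral_restrict_space[OF O] e using m by (simp add: integral_completion)
    ultimately show ?thesis by simp
  qed
  show "integrable (lebesgue_on \<Omega>) f" "(LINT x|lebesgue_on \<Omega>. f x) = (LINT x|lborel. f x)"
    using *[OF assms(1,4)] by simp_all
  moreover have "integrable (lebesgue_on \<Omega>) (\<lambda>x. (norm (f x))\<^sup>2)"
    using *[OF continuous_on_power[OF continuous_on_norm[OF assms(1)]], of 2] assms(4) by simp
  ultimately show "l2 (lebesgue_on \<Omega>) f" unfolding l2_def by (auto intro: borel_measurable_integrable)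
qed

lemma compact_support_bounded:
  fixes f :: "'a::euclidean_space \<Rightarrow> 'b::euclidean_space"
  assumes "continuous_on UNIV f" "compact K" "\<And>x. x \<notin> K \<Longrightarrow> f x = 0"
  shows "\<exists>B\<ge>0. \<forall>x. norm (f x) \<le> B"
proof -
  have "bounded (f ` K)"
    using assms(1,2) by (intro compact_imp_bounded compact_continuous_image) (auto intro: continuous_on_subset)
  then obtain B where "B > 0" "\<And>x. x \<in> K \<Longrightarrow> norm (f x) \<le> B"
    unfolding bounded_pos by auto
  then show ?thesis using assms(3) by (intro exI[of _ B]) (metis less_imp_le norm_zero)
qed

lemma integral_translation:
  fixes f :: "'a::euclidean_space \<Rightarrow> real"
  assumes "f \<in> borel_measurable borel"
  shows "(LINT x|lborel. f (x + c)) = (LINT x|lborel. f x)"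
proof -
  have "(LINT x|lborel. f x) = (LINT x|distr lborel borel ((+) c). f x)" by (simp add: lborel_distr_plus)
  also have "\<dots> = (LINT x|lborel. f (c + x))" using assms by (intro integral_distr) auto
  finally show ?thesis by (simp add: add.commute)
qed

text \<open>Difference quotients of \<open>f\<close> have integral zero by translation invariance, and by the mean value theorem
they are dominated by a multiple of the indicator of a ball.\<close>

lemma integral_pdiff_eq_0:
  fixes f :: "'a::euclidean_space \<Rightarrow> real"
  assumes f: "smooth f" "compact K" "\<And>x. x \<notin> K \<Longrightarrow> f x = 0"
  shows "(LINT x|lborel. grad f x \<bullet> b) = 0"
proof -
  have cont: "continuous_on UNIV f" using f by (intro smooth_continuous)
  have cont': "continuous_on UNIV (\<lambda>x. grad f x \<bullet> b)"
    by (intro continuous_on_inner smooth_continuous_grad f continuous_on_const)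
  have zero': "grad f x \<bullet> b = 0" if "x \<notin> K" for x using grad_eq_0_outside[OF f(2,3) that] by simp
  obtain B where B: "B \<ge> 0" "\<And>x. norm (grad f x \<bullet> b) \<le> B"
    using compact_support_bounded[OF cont' f(2) zero'] by blast
  obtain R where R: "\<And>x. x \<in> K \<Longrightarrow> norm x \<le> R"
    using compact_imp_bounded[OF f(2)] unfolding bounded_iff by blast
  have int: "integrable lborel f" by (rule compact_support_integrable[OF cont f(2,3)])
  have meas: "f \<in> borel_measurable borel" using cont by (rule borel_measurable_continuous_onI)
  define h where "h k = inverse (real (Suc k))" for k
  have h: "0 < h k" "h k \<le> 1" for k unfolding h_def by (simp_all add: inverse_le_1_iff)
  define q where "q k x = (f (x + h k *\<^sub>R b) - f x) / h k" for k x
  have q0: "(LINT x|lborel. q k x) = 0" for k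
  proof -
    have "integrable lborel (\<lambda>x. f (x + h k *\<^sub>R b))"
    proof (rule compact_support_integrable)
      show "continuous_on UNIV (\<lambda>x. f (x + h k *\<^sub>R b))"
        by (rule continuous_on_compose2[OF cont]) (intro continuous_intros, simp)
      show "compact ((\<lambda>x. x - h k *\<^sub>R b) ` K)" by (rule compact_translation_subtract[OF f(2)])
      show "f (x + h k *\<^sub>R b) = 0" if "x \<notin> (\<lambda>x. x - h k *\<^sub>R b) ` K" for x
      proof (rule f(3))
        show "x + h k *\<^sub>R b \<notin> K" using that by (force simp: image_iff)
      qed
    qed
    then have "(LINT x|lborel. q k x) = ((LINT x|lborel. f (x + h k *\<^sub>R b)) - (LINT x|lborel. f x)) / h k"
      unfolding q_def using int by simp
    then show ?thesis using integral_translation[OF meas] by simp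
  qed
  have "(\<lambda>k. LINT x|lborel. q k x) \<longlonglongrightarrow> (LINT x|lborel. grad f x \<bullet> b)"
  proof (rule integral_dominated_convergence)
    show "(\<lambda>x. grad f x \<bullet> b) \<in> borel_measurable lborel"
      using borel_measurable_continuous_onI[OF cont'] by simp
    show "q k \<in> borel_measurable lborel" for k
      using meas unfolding q_def by measurable
    show "integrable lborel (\<lambda>x. indicator (cball 0 (R + norm b)) x *\<^sub>R B)"
      by (intro borel_integrable_compact) auto
    have "(\<lambda>k. q k x) \<longlonglongrightarrow> grad f x \<bullet> b" for x
    proof -
      have "((\<lambda>t. (f (x + (0 + t) *\<^sub>R b) - f (x + 0 *\<^sub>R b)) / t) \<longlongrightarrow> grad f (x + 0 *\<^sub>R b) \<bullet> b) (at 0)"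
        using has_real_derivative_along_line[OF f(1), of x b 0] unfolding DERIV_def .
      moreover have "filterlim h (at 0) sequentially"
        using LIMSEQ_inverse_real_of_nat h(1) unfolding filterlim_at h_def[abs_def] by (auto simp: eventually_sequentially)
      ultimately have "(\<lambda>k. (f (x + (0 + h k) *\<^sub>R b) - f (x + 0 *\<^sub>R b)) / h k) \<longlonglongrightarrow> grad f (x + 0 *\<^sub>R b) \<bullet> b"
        by (rule filterlim_compose)
      then show ?thesis unfolding q_def by simp
    qed
    then show "AE x in lborel. (\<lambda>k. q k x) \<longlonglongrightarrow> grad f x \<bullet> b" by simp
    have "norm (q k x) \<le> indicator (cball 0 (R + norm b)) x *\<^sub>R B" for k x
    proof (cases "x \<in> cball 0 (R + norm b)")
      case True
      have "\<exists>z. 0 < z \<and> z < h k \<and> f (x + h k *\<^sub>R b) - f (x + 0 *\<^sub>R b) = (h k - 0) * (grad f (x + z *\<^sub>R b) \<bullet> b)"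
        by (rule MVT2[OF h(1) has_real_derivative_along_line[OF f(1)]])
      then obtain z where "f (x + h k *\<^sub>R b) - f x = h k * (grad f (x + z *\<^sub>R b) \<bullet> b)" by auto
      then have "q k x = grad f (x + z *\<^sub>R b) \<bullet> b" unfolding q_def using h(1)[of k] by simp
      then show ?thesis using True B by simp
    next
      case False
      then have n: "norm x > R + norm b" by simp
      have "norm (h k *\<^sub>R b) \<le> norm b" using h[of k] by (simp add: mult_left_le_one_le)
      then have "norm (x + h k *\<^sub>R b) > R" using n norm_diff_ineq[of x "h k *\<^sub>R b"] by simp
      then have "f (x + h k *\<^sub>R b) = 0" using R f(3) by (meson not_le)
      moreover have "norm x > R" using n norm_ge_zero[of b] by linarith
      then have "f x = 0" using R f(3) by (meson not_le)
      ultimately show ?thesis using False by (simp add: q_def)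
    qed
    then show "AE x in lborel. norm (q k x) \<le> indicator (cball 0 (R + norm b)) x *\<^sub>R B" for k by simp
  qed
  then show ?thesis unfolding q0 using LIMSEQ_unique tendsto_const by blast
qed

text \<open>Integration by parts: the product of two test functions has compact support, so its derivatives
integrate to zero.\<close>

lemma test_weak_grad:
  assumes "open \<Omega>" and \<eta>: "\<eta> \<in> test_functions \<Omega>"
  shows "has_weak_grad \<Omega> \<eta> (grad \<eta>)"
proof -
  obtain K where K0: "smooth \<eta>" "compact K" "K \<subseteq> \<Omega>" "\<forall>x. x \<notin> K \<longrightarrow> \<eta> x = 0"
    using \<eta> by (rule test_functionsE)
  note K = K0(1-3) K0(4)[rule_format]
  have c: "continuous_on UNIV \<eta>" "continuous_on UNIV (grad \<eta>)"
    using K by (simp_all add: smooth_continuous smooth_continuous_grad)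
  have z: "grad \<eta> x = 0" if "x \<notin> K" for x using grad_eq_0_outside[OF K(2,4) that] .
  have "(LINT x|lebesgue_on \<Omega>. \<eta> x * pdiff b \<zeta> x) = - (LINT x|lebesgue_on \<Omega>. (grad \<eta> x \<bullet> b) * \<zeta> x)"
    if \<zeta>: "\<zeta> \<in> test_functions \<Omega>" for \<zeta> b
  proof -
    obtain L where L0: "smooth \<zeta>" "compact L" "L \<subseteq> \<Omega>" "\<forall>x. x \<notin> L \<longrightarrow> \<zeta> x = 0"
      using \<zeta> by (rule test_functionsE)
    note L = L0(1-3) L0(4)[rule_format]
    have cL: "continuous_on UNIV \<zeta>" "continuous_on UNIV (grad \<zeta>)"
      using L by (simp_all add: smooth_continuous smooth_continuous_grad)
    have p: "pdiff b \<zeta> x = grad \<zeta> x \<bullet> b" for x by (intro pdiff_eq_grad smooth_differentiable L)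
    have 1: "continuous_on UNIV (\<lambda>x. \<eta> x * pdiff b \<zeta> x)" unfolding p
      by (intro continuous_on_mult continuous_on_inner continuous_on_const c cL)
    have 2: "continuous_on UNIV (\<lambda>x. (grad \<eta> x \<bullet> b) * \<zeta> x)"
      by (intro continuous_on_mult continuous_on_inner continuous_on_const c cL)
    have eq1: "(LINT x|lebesgue_on \<Omega>. \<eta> x * pdiff b \<zeta> x) = (LINT x|lborel. \<eta> x * pdiff b \<zeta> x)"
      by (rule compact_support_lebesgue_on(2)[OF 1 K(2,3) _ assms(1)]) (simp add: K)
    have eq2: "(LINT x|lebesgue_on \<Omega>. (grad \<eta> x \<bullet> b) * \<zeta> x) = (LINT x|lborel. (grad \<eta> x \<bullet> b) * \<zeta> x)"
      by (rule compact_support_lebesgue_on(2)[OF 2 K(2,3) _ assms(1)]) (simp add: z)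
    have i1: "integrable lborel (\<lambda>x. \<eta> x * pdiff b \<zeta> x)"
      by (rule compact_support_integrable[OF 1 K(2)]) (simp add: K)
    have i2: "integrable lborel (\<lambda>x. (grad \<eta> x \<bullet> b) * \<zeta> x)"
      by (rule compact_support_integrable[OF 2 K(2)]) (simp add: z)
    have g: "grad (\<lambda>x. \<eta> x * \<zeta> x) x = \<eta> x *\<^sub>R grad \<zeta> x + \<zeta> x *\<^sub>R grad \<eta> x" for x
    proof (rule grad_eqI)
      have "((\<lambda>x. \<eta> x * \<zeta> x) has_derivative (\<lambda>h. \<eta> x * (grad \<zeta> x \<bullet> h) + (grad \<eta> x \<bullet> h) * \<zeta> x)) (at x)"
        by (intro has_derivative_mult has_derivative_grad smooth_differentiable K L)
      then show "((\<lambda>x. \<eta> x * \<zeta> x) has_derivative (\<bullet>) (\<eta> x *\<^sub>R grad \<zeta> x + \<zeta> x *\<^sub>R grad \<eta> x)) (at x)"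
        by (rule has_derivative_eq_rhs) (simp add: inner_add_left mult.commute fun_eq_iff)
    qed
    have "0 = (LINT x|lborel. grad (\<lambda>x. \<eta> x * \<zeta> x) x \<bullet> b)"
      by (rule integral_pdiff_eq_0[OF smooth_mult[OF K(1) L(1)] K(2), symmetric]) (simp add: K)
    also have "\<dots> = (LINT x|lborel. \<eta> x * pdiff b \<zeta> x + (grad \<eta> x \<bullet> b) * \<zeta> x)"
      unfolding g p by (simp add: inner_add_left mult.commute)
    also have "\<dots> = (LINT x|lborel. \<eta> x * pdiff b \<zeta> x) + (LINT x|lborel. (grad \<eta> x \<bullet> b) * \<zeta> x)"
      by (rule Bochner_Integration.integral_add[OF i1 i2])
    finally show ?thesis unfolding eq1 eq2 by simp
  qed
  then show ?thesis unfolding has_weak_grad_def square_integrable_l2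
    using compact_support_lebesgue_on(3)[OF c(1) K(2,3,4) assms(1)]
      compact_support_lebesgue_on(3)[OF c(2) K(2,3) z assms(1)] by simp
qed

section \<open>The fundamental lemma of the calculus of variations\<close>

text \<open>Testing with bump functions shows that \<open>f\<close> integrates to zero over every box whose closure lies in \<open>\<Omega>\<close>.
Inside one such box these boxes form an intersection-stable generator of the Borel sets, so \<open>f\<close> integrates
to zero over all Borel subsets and vanishes almost everywhere there. Finally \<open>\<Omega>\<close> is a countable union
of closed boxes, which differ from open ones by null sets.\<close>

theorem fundamental_lemma:
  fixes f :: "'a::euclidean_space \<Rightarrow> real"
  assumes "open \<Omega>" and f: "integrable (lebesgue_on \<Omega>) f"
    and zero: "\<And>\<eta>. \<eta> \<in> test_functions \<Omega> \<Longrightarrow> (LINT x|lebesgue_on \<Omega>. f x * \<eta> x) = 0"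
  shows "AE x in lebesgue_on \<Omega>. f x = 0"
proof -
  have O: "\<Omega> \<inter> space lebesgue \<in> sets lebesgue" using assms(1) by simp
  define F where "F x = indicator \<Omega> x * f x" for x
  have F: "integrable lebesgue F" using f unfolding F_def integrable_restrict_space[OF O] by simp
  then obtain F' where F'[measurable]: "F' \<in> borel_measurable lborel" and AE_F: "AE x in lborel. F x = F' x"
    using completion_ex_borel_measurable_real[OF borel_measurable_integrable[OF F]] by blast
  have AE_F2: "AE x in lebesgue. F x = F' x" using AE_F by (rule AE_completion)
  have F'_leb: "F' \<in> borel_measurable lebesgue" using F' by (rule measurable_completion)
  have "integrable lebesgue F'"
    using integrable_cong_AE[OF borel_measurable_integrable[OF F] F'_leb AE_F2] F by simp
  then have int: "integrable lborel F'" using integrable_completion[OF F'] by simp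
  have bump: "(LINT x|lborel. F' x * box_bump p q k x) = 0" if "cbox p q \<subseteq> \<Omega>" for p q k
  proof -
    have \<eta>: "box_bump p q k \<in> test_functions \<Omega>" using that by (rule box_bump_test)
    have m[measurable]: "box_bump p q k \<in> borel_measurable borel"
      by (intro borel_measurable_continuous_onI smooth_continuous smooth_box_bump)
    then have m2: "box_bump p q k \<in> borel_measurable lebesgue" by (simp add: measurable_completion)
    have "(LINT x|lborel. F' x * box_bump p q k x) = (LINT x|lebesgue. F' x * box_bump p q k x)"
      by (rule integral_completion[symmetric]) simp
    also have "\<dots> = (LINT x|lebesgue. F x * box_bump p q k x)"
    proof (rule integral_cong_AE)
      show "AE x in lebesgue. F' x * box_bump p q k x = F x * box_bump p q k x"
        using AE_F2 by eventually_elim simp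
    qed (use F'_leb m2 borel_measurable_integrable[OF F] in auto)
    also have "\<dots> = (LINT x|lebesgue_on \<Omega>. f x * box_bump p q k x)"
      unfolding integral_restrict_space[OF O] F_def by (simp add: mult.assoc)
    finally show ?thesis using zero[OF \<eta>] by simp
  qed
  have box0: "(LINT x|lborel. F' x * indicator (box p q) x) = 0" if sub: "cbox p q \<subseteq> \<Omega>" for p q
  proof -
    have "(\<lambda>k. LINT x|lborel. F' x * box_bump p q k x) \<longlonglongrightarrow> (LINT x|lborel. F' x * indicator (box p q) x)"
    proof (rule integral_dominated_convergence)
      have m[measurable]: "box_bump p q k \<in> borel_measurable borel" for k
        by (intro borel_measurable_continuous_onI smooth_continuous smooth_box_bump)
      show "(\<lambda>x. F' x * box_bump p q k x) \<in> borel_measurable lborel" for k by simp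
      show "(\<lambda>x. F' x * indicator (box p q) x) \<in> borel_measurable lborel" by simp
      show "integrable lborel (\<lambda>x. norm (F' x))" using int by (rule integrable_norm)
      show "AE x in lborel. (\<lambda>k. F' x * box_bump p q k x) \<longlonglongrightarrow> F' x * indicator (box p q) x"
        by (intro AE_I2 tendsto_mult tendsto_const box_bump_tendsto)
      have "norm (F' x * box_bump p q k x) \<le> norm (F' x)" for k x
        using box_bump_bounds[of p q k x] by (simp add: abs_mult mult_left_le)
      then show "AE x in lborel. norm (F' x * box_bump p q k x) \<le> norm (F' x)" for k by simp
    qed
    then show ?thesis unfolding bump[OF sub] using LIMSEQ_unique tendsto_const by blast
  qed
  have cb: "AE x in lborel. x \<in> cbox p q \<longrightarrow> F' x = 0" if sub: "cbox p q \<subseteq> \<Omega>" for p q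
  proof -
    define g where "g x = indicator (box p q) x * F' x" for x
    have g: "integrable lborel g" unfolding g_def
      using integrable_mult_indicator[OF _ int, of "box p q"] by simp
    have sg: "set_integrable lborel A g" if "A \<in> sets borel" for A
      unfolding set_integrable_def using g that by (intro integrable_mult_indicator) auto
    have base: "(LINT x:A|lborel. g x) = 0" if A: "A \<in> range (\<lambda>(a, b). box a b)" for A
    proof -
      obtain a b where "A = box a b" using A by auto
      then obtain p' q' where pq: "A \<inter> box p q = box p' q'" using box_Int_box by blast
      have "(LINT x:A|lborel. g x) = (LINT x|lborel. F' x * indicator (box p' q') x)"
        unfolding set_lebesgue_integral_def g_def pq[symmetric]
        by (simp add: indicator_inter_arith ac_simps)
      also have "\<dots> = 0"
      proof (cases "box p' q' = {}")
        case False
        have "cbox p' q' = closure (box p' q')" using False by simp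
        also have "\<dots> \<subseteq> closure (box p q)" using pq by (intro closure_mono) blast
        also have "\<dots> \<subseteq> cbox p q" by (rule closure_minimal[OF box_subset_cbox closed_cbox])
        finally show ?thesis using sub by (intro box0) blast
      qed simp
      finally show ?thesis .
    qed
    have univ: "(LINT x:UNIV|lborel. g x) = 0"
      using box0[OF sub] unfolding set_lebesgue_integral_def g_def by (simp add: mult.commute)
    have "(LINT x:A|lborel. g x) = 0" if "A \<in> sigma_sets UNIV (range (\<lambda>(a, b). box a b :: 'a set))" for A
    proof (rule sigma_sets_induct_disjoint[OF _ _ that])
      have S: "sigma_sets UNIV (range (\<lambda>(a, b). box a b :: 'a set)) = sets borel"
        by (simp add: borel_eq_box)
      show "Int_stable (range (\<lambda>(a, b). box a b :: 'a set))" by (auto simp: Int_stable_def box_Int_box)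
      show "(LINT x:A|lborel. g x) = 0" if "A \<in> range (\<lambda>(a, b). box a b)" for A by (rule base[OF that])
      show "(LINT x:{}|lborel. g x) = 0" by (simp add: set_lebesgue_integral_def)
      show "(LINT x:UNIV - A|lborel. g x) = 0"
        if "A \<in> sigma_sets UNIV (range (\<lambda>(a, b). box a b))" "(LINT x:A|lborel. g x) = 0" for A
      proof -
        have A: "A \<in> sets borel" using that S by simp
        have "(LINT x:UNIV|lborel. g x) = (LINT x:(UNIV - A) \<union> A|lborel. g x)" by simp
        also have "\<dots> = (LINT x:UNIV - A|lborel. g x) + (LINT x:A|lborel. g x)"
          using A by (intro set_integral_Un sg) auto
        finally show ?thesis using that univ by simp
      qed
      show "(LINT x:(\<Union>i. A i)|lborel. g x) = 0"
        if "disjoint_family A" "range A \<subseteq> sigma_sets UNIV (range (\<lambda>(a, b). box a b))"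
          "\<And>i. (LINT x:A i|lborel. g x) = 0" for A :: "nat \<Rightarrow> 'a set"
      proof -
        have A: "A i \<in> sets borel" for i using that(2) S by auto
        have "(LINT x:(\<Union>i. A i)|lborel. g x) = (\<Sum>i. (LINT x:A i|lborel. g x))"
        proof (rule lebesgue_integral_countable_add)
          show "A i \<in> sets lborel" for i using A by simp
          show "A i \<inter> A j = {}" if "i \<noteq> j" for i j
            using \<open>disjoint_family A\<close> that by (auto simp: disjoint_family_on_def)
          show "set_integrable lborel (\<Union>i. A i) g" using A by (intro sg) auto
        qed
        then show ?thesis using that(3) by simp
      qed
    qed simp
    then have "(LINT x:A|lborel. g x) = 0" if "A \<in> sets lborel" for A
      using that by (simp add: borel_eq_box)
    from sigma_finite_measure.density_zero[OF sigma_finite_lborel g this] have "AE x in lborel. g x = 0" by simp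
    moreover have "AE x in lborel. x \<notin> cbox p q - box p q"
      by (rule AE_not_in[OF null_sets_cbox_Diff_box])
    ultimately show ?thesis by eventually_elim (auto simp: g_def indicator_def split: if_splits)
  qed
  obtain \<D> where \<D>: "countable \<D>" "\<D> \<subseteq> Pow \<Omega>" "\<And>X. X \<in> \<D> \<Longrightarrow> \<exists>a b. X = cbox a b" "\<Union>\<D> = \<Omega>"
    using open_countable_Union_open_cbox[OF assms(1)] by metis
  have "AE x in lborel. \<forall>X\<in>\<D>. x \<in> X \<longrightarrow> F' x = 0"
  proof (rule AE_ball_countable'[OF _ \<D>(1)])
    fix X assume X: "X \<in> \<D>"
    then obtain a b where "X = cbox a b" using \<D>(3) by blast
    then show "AE x in lborel. x \<in> X \<longrightarrow> F' x = 0" using cb[of a b] X \<D>(2) by auto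
  qed
  then have "AE x in lborel. x \<in> \<Omega> \<longrightarrow> f x = 0"
    using AE_F
  proof eventually_elim
    case (elim x)
    have "x \<in> \<Omega> \<Longrightarrow> F' x = 0" using elim(1) \<D>(4) by blast
    then show ?case using elim(2) by (cases "x \<in> \<Omega>") (simp_all add: F_def)
  qed
  then have "AE x in lebesgue. x \<in> \<Omega> \<longrightarrow> f x = 0" by (rule AE_completion)
  then show ?thesis unfolding AE_restrict_space_iff[OF O] .
qed

section \<open>A quantitative form of Rellich's theorem\<close>

lemma nn_integral_translation:
  fixes f :: "'a::euclidean_space \<Rightarrow> ennreal"
  assumes [measurable]: "f \<in> borel_measurable borel"
  shows "(\<integral>\<^sup>+x. f (c + x) \<partial>lborel) = (\<integral>\<^sup>+x. f x \<partial>lborel)"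
proof -
  have "(\<integral>\<^sup>+x. f x \<partial>lborel) = (\<integral>\<^sup>+x. f x \<partial>distr lborel borel ((+) c))" by (simp add: lborel_distr_plus)
  also have "\<dots> = (\<integral>\<^sup>+x. f (c + x) \<partial>lborel)" by (intro nn_integral_distr) auto
  finally show ?thesis ..
qed

text \<open>The difference is the integral of the derivative along the segment, and its square is at most the
integral of the square because \<open>\<integral>(k - d)\<^sup>2 \<ge> 0\<close> for \<open>d = \<integral>k\<close> over the unit interval.\<close>

lemma difference_squared_le:
  fixes f :: "'a::euclidean_space \<Rightarrow> real"
  assumes f: "smooth f"
  shows "ennreal ((f (x + h) - f x)\<^sup>2)
    \<le> (\<integral>\<^sup>+t. indicator {0..1::real} t * ennreal ((grad f (x + t *\<^sub>R h) \<bullet> h)\<^sup>2) \<partial>lborel)"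
proof -
  define k where "k t = grad f (x + t *\<^sub>R h) \<bullet> h" for t
  define d where "d = f (x + h) - f x"
  have "continuous_on UNIV (\<lambda>t. x + t *\<^sub>R h)" by (intro continuous_intros)
  from continuous_on_compose2[OF smooth_continuous_grad[OF f] this]
  have k: "continuous_on UNIV k" unfolding k_def by (intro continuous_on_inner continuous_on_const) simp
  have k2: "continuous_on UNIV (\<lambda>t. (k t)\<^sup>2)" by (intro continuous_on_power k)
  have i1: "integrable lborel (\<lambda>t. indicator {0..1::real} t *\<^sub>R k t)"
    using k by (intro borel_integrable_compact) (auto intro: continuous_on_subset)
  have i2: "integrable lborel (\<lambda>t. indicator {0..1::real} t *\<^sub>R (k t)\<^sup>2)"
    using k2 by (intro borel_integrable_compact) (auto intro: continuous_on_subset)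
  have i0: "integrable lborel (\<lambda>t. indicator {0..1::real} t *\<^sub>R (1::real))"
    by (intro borel_integrable_compact compact_Icc continuous_on_const)
  have e0: "(LINT t|lborel. indicator {0..1::real} t *\<^sub>R (1::real)) = 1" by simp
  have e1: "(LINT t|lborel. indicator {0..1::real} t *\<^sub>R k t) = d"
  proof -
    have "(LINT t|lborel. k t * indicator {0..1::real} t) = f (x + 1 *\<^sub>R h) - f (x + 0 *\<^sub>R h)"
    proof (rule integral_FTC_Icc_real)
      show "((\<lambda>t. f (x + t *\<^sub>R h)) has_real_derivative k t) (at t)" for t
        unfolding k_def by (rule has_real_derivative_along_line[OF f])
      show "isCont k t" for t using k by (simp add: continuous_on_eq_continuous_at)
    qed simp
    then show ?thesis by (simp add: d_def mult.commute)
  qed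
  have "0 \<le> (LINT t|lborel. indicator {0..1::real} t *\<^sub>R (k t - d)\<^sup>2)" by simp
  also have "\<dots> = (LINT t|lborel. indicator {0..1::real} t *\<^sub>R (k t)\<^sup>2 - 2 * d * (indicator {0..1::real} t *\<^sub>R k t)
      + d\<^sup>2 * (indicator {0..1::real} t *\<^sub>R 1))"
    by (intro Bochner_Integration.integral_cong) (auto simp: power2_diff algebra_simps)
  also have "\<dots> = (LINT t|lborel. indicator {0..1::real} t *\<^sub>R (k t)\<^sup>2)
      - 2 * d * (LINT t|lborel. indicator {0..1::real} t *\<^sub>R k t)
      + d\<^sup>2 * (LINT t|lborel. indicator {0..1::real} t *\<^sub>R 1)"
    by (simp only: Bochner_Integration.integral_add Bochner_Integration.integral_diff
        Bochner_Integration.integrable_diff integrable_mult_right i0 i1 i2 integral_mult_right_zero)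
  also have "\<dots> = (LINT t|lborel. indicator {0..1::real} t *\<^sub>R (k t)\<^sup>2) - 2 * d * d + d\<^sup>2 * 1"
    unfolding e0 e1 ..
  finally have "d\<^sup>2 \<le> (LINT t|lborel. indicator {0..1::real} t *\<^sub>R (k t)\<^sup>2)" by (simp add: power2_eq_square)
  then have "ennreal (d\<^sup>2) \<le> ennreal (LINT t|lborel. indicator {0..1::real} t *\<^sub>R (k t)\<^sup>2)" by (rule ennreal_leI)
  also have "\<dots> = (\<integral>\<^sup>+t. ennreal (indicator {0..1::real} t *\<^sub>R (k t)\<^sup>2) \<partial>lborel)"
    using i2 by (intro nn_integral_eq_integral[symmetric]) auto
  also have "\<dots> = (\<integral>\<^sup>+t. indicator {0..1::real} t * ennreal ((k t)\<^sup>2) \<partial>lborel)"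
    by (intro nn_integral_cong) (auto simp: indicator_def)
  finally show ?thesis unfolding d_def k_def .
qed

lemma translation_estimate:
  fixes f :: "'a::euclidean_space \<Rightarrow> real"
  assumes f: "smooth f"
  shows "(\<integral>\<^sup>+x. ennreal ((f (x + h) - f x)\<^sup>2) \<partial>lborel)
    \<le> ennreal ((norm h)\<^sup>2) * (\<integral>\<^sup>+x. ennreal ((norm (grad f x))\<^sup>2) \<partial>lborel)"
proof -
  have g[measurable]: "grad f \<in> borel_measurable borel"
    by (intro borel_measurable_continuous_onI smooth_continuous_grad f)
  define D where "D = (\<integral>\<^sup>+x. ennreal ((norm (grad f x))\<^sup>2) \<partial>lborel)"
  have "(\<integral>\<^sup>+x. ennreal ((f (x + h) - f x)\<^sup>2) \<partial>lborel)
      \<le> (\<integral>\<^sup>+x. \<integral>\<^sup>+t. indicator {0..1::real} t * ennreal ((grad f (x + t *\<^sub>R h) \<bullet> h)\<^sup>2) \<partial>lborel \<partial>lborel)"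
    by (intro nn_integral_mono difference_squared_le f)
  also have "\<dots> = (\<integral>\<^sup>+t. \<integral>\<^sup>+x. indicator {0..1::real} t * ennreal ((grad f (x + t *\<^sub>R h) \<bullet> h)\<^sup>2) \<partial>lborel \<partial>lborel)"
    by (rule lborel_pair.Fubini'[symmetric]) measurable
  also have "\<dots> \<le> (\<integral>\<^sup>+t. indicator {0..1::real} t * (ennreal ((norm h)\<^sup>2) * D) \<partial>lborel)"
  proof (rule nn_integral_mono)
    fix t :: real
    have "(\<integral>\<^sup>+x. ennreal ((grad f (x + t *\<^sub>R h) \<bullet> h)\<^sup>2) \<partial>lborel) = (\<integral>\<^sup>+x. ennreal ((grad f x \<bullet> h)\<^sup>2) \<partial>lborel)"
      using nn_integral_translation[of "\<lambda>x. ennreal ((grad f x \<bullet> h)\<^sup>2)" "t *\<^sub>R h"]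
      by (simp add: add.commute)
    also have "\<dots> \<le> (\<integral>\<^sup>+x. ennreal ((norm h)\<^sup>2) * ennreal ((norm (grad f x))\<^sup>2) \<partial>lborel)"
    proof (intro nn_integral_mono)
      fix x
      have "(grad f x \<bullet> h)\<^sup>2 \<le> (norm h)\<^sup>2 * (norm (grad f x))\<^sup>2"
        using Cauchy_Schwarz_ineq[of "grad f x" h] by (simp add: power2_norm_eq_inner mult.commute)
      then show "ennreal ((grad f x \<bullet> h)\<^sup>2) \<le> ennreal ((norm h)\<^sup>2) * ennreal ((norm (grad f x))\<^sup>2)"
        by (simp add: ennreal_mult[symmetric] ennreal_leI)
    qed
    also have "\<dots> = ennreal ((norm h)\<^sup>2) * D" unfolding D_def by (intro nn_integral_cmult) simp
    finally have le: "(\<integral>\<^sup>+x. ennreal ((grad f (x + t *\<^sub>R h) \<bullet> h)\<^sup>2) \<partial>lborel) \<le> ennreal ((norm h)\<^sup>2) * D" .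
    have "(\<integral>\<^sup>+x. indicator {0..1::real} t * ennreal ((grad f (x + t *\<^sub>R h) \<bullet> h)\<^sup>2) \<partial>lborel)
        = indicator {0..1::real} t * (\<integral>\<^sup>+x. ennreal ((grad f (x + t *\<^sub>R h) \<bullet> h)\<^sup>2) \<partial>lborel)"
      by (intro nn_integral_cmult) simp
    also have "\<dots> \<le> indicator {0..1::real} t * (ennreal ((norm h)\<^sup>2) * D)" by (intro mult_left_mono le) simp
    finally show "(\<integral>\<^sup>+x. indicator {0..1::real} t * ennreal ((grad f (x + t *\<^sub>R h) \<bullet> h)\<^sup>2) \<partial>lborel)
        \<le> indicator {0..1::real} t * (ennreal ((norm h)\<^sup>2) * D)" .
  qed
  also have "\<dots> = (\<integral>\<^sup>+t. indicator {0..1::real} t \<partial>lborel) * (ennreal ((norm h)\<^sup>2) * D)"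
    by (intro nn_integral_multc) simp
  also have "\<dots> = ennreal ((norm h)\<^sup>2) * D" by simp
  finally show ?thesis unfolding D_def .
qed

text \<open>The half-open cells of a grid of mesh \<open>s\<close> are indexed by the integer coordinates of their lower corner.
Indices are zero off the basis, so that a bounded set meets cells with finitely many indices only.\<close>

definition cell_index :: "real \<Rightarrow> 'a::euclidean_space \<Rightarrow> 'a \<Rightarrow> int" where
  "cell_index s x b = (if b \<in> Basis then \<lfloor>(x \<bullet> b) / s\<rfloor> else 0)"

definition cell :: "real \<Rightarrow> ('a::euclidean_space \<Rightarrow> int) \<Rightarrow> 'a set" where
  "cell s i = {x. cell_index s x = i}"

lemma cell_eq:
  assumes s: "s > 0" and i: "\<forall>b. b \<notin> Basis \<longrightarrow> i b = 0"
  shows "cell s i = {x. \<forall>b\<in>Basis. of_int (i b) * s \<le> x \<bullet> b \<and> x \<bullet> b < (of_int (i b) + 1) * s}"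
proof -
  have "\<lfloor>(x \<bullet> b) / s\<rfloor> = i b \<longleftrightarrow> of_int (i b) * s \<le> x \<bullet> b \<and> x \<bullet> b < (of_int (i b) + 1) * s" for x b :: 'a
    unfolding floor_eq_iff using s by (simp add: field_simps)
  then show ?thesis using i unfolding cell_def cell_index_def fun_eq_iff by auto
qed

lemma cell_bounds:
  fixes i :: "'a::euclidean_space \<Rightarrow> int"
  assumes s: "s > 0" and i: "\<forall>b. b \<notin> Basis \<longrightarrow> i b = 0"
  shows "cell s i \<in> sets borel" "emeasure lborel (cell s i) = ennreal (s ^ DIM('a))"
    "x \<in> cell s i \<Longrightarrow> y \<in> cell s i \<Longrightarrow> y - x \<in> cbox (- (s *\<^sub>R One)) (s *\<^sub>R One)"
proof -
  note eq = cell_eq[OF s i]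
  define p q where "p = (\<Sum>b\<in>Basis. (of_int (i b) * s) *\<^sub>R b)" and "q = (\<Sum>b\<in>Basis. ((of_int (i b) + 1) * s) *\<^sub>R b)"
  have pq: "p \<bullet> b = of_int (i b) * s" "q \<bullet> b = (of_int (i b) + 1) * s" if "b \<in> Basis" for b
    using that unfolding p_def q_def by simp_all
  have "cell s i = (\<Inter>b\<in>Basis. {x. of_int (i b) * s \<le> x \<bullet> b} \<inter> {x. x \<bullet> b < (of_int (i b) + 1) * s})"
    unfolding eq by auto
  moreover have "\<dots> \<in> sets borel"
    by (intro sets.finite_INT sets.Int borel_closed borel_open closed_Collect_le open_Collect_less continuous_intros) auto
  ultimately show m: "cell s i \<in> sets borel" by simp
  have le: "p \<bullet> b \<le> q \<bullet> b" if "b \<in> Basis" for b using pq[OF that] s by (simp add: algebra_simps)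
  have pr: "(\<Prod>b\<in>Basis. (q - p) \<bullet> b) = s ^ DIM('a)"
    using pq by (simp add: inner_diff_left algebra_simps)
  have "box p q \<subseteq> cell s i" unfolding eq using pq by (auto simp: mem_box intro: less_imp_le)
  then have "emeasure lborel (box p q) \<le> emeasure lborel (cell s i)" using m by (intro emeasure_mono) simp_all
  moreover have "cell s i \<subseteq> cbox p q" unfolding eq using pq by (auto simp: mem_box less_imp_le)
  then have "emeasure lborel (cell s i) \<le> emeasure lborel (cbox p q)" by (intro emeasure_mono) simp_all
  ultimately show "emeasure lborel (cell s i) = ennreal (s ^ DIM('a))"
    using emeasure_lborel_box[of p q, OF le] emeasure_lborel_cbox[of p q, OF le] pr by simp
  show "y - x \<in> cbox (- (s *\<^sub>R One)) (s *\<^sub>R One)" if "x \<in> cell s i" "y \<in> cell s i"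
    using that unfolding eq by (fastforce simp: mem_box inner_diff_left algebra_simps)
qed

lemma finite_cell_index:
  fixes S :: "'a::euclidean_space set"
  assumes s: "s > 0" and "bounded S"
  shows "finite (cell_index s ` S)"
proof -
  obtain R where R: "\<And>x. x \<in> S \<Longrightarrow> norm x \<le> R" using assms(2) unfolding bounded_iff by blast
  define m where "m = \<lceil>R / s\<rceil> + 1"
  have "cell_index s ` S \<subseteq> {g. \<forall>b. (b \<in> Basis \<longrightarrow> g b \<in> {- m..m}) \<and> (b \<notin> Basis \<longrightarrow> g b = 0)}"
  proof (clarsimp simp: cell_index_def)
    fix x b :: 'a assume x: "x \<in> S" and b: "b \<in> Basis"
    have "\<bar>x \<bullet> b\<bar> \<le> R" using Basis_le_norm[OF b, of x] R[OF x] by linarith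
    then have "(x \<bullet> b) / s \<le> R / s" "- (R / s) \<le> (x \<bullet> b) / s" using s by (simp_all add: field_simps)
    then have "real_of_int (- m) \<le> (x \<bullet> b) / s" "(x \<bullet> b) / s \<le> real_of_int m" unfolding m_def by linarith+
    then show "- m \<le> \<lfloor>x \<bullet> b / s\<rfloor> \<and> \<lfloor>x \<bullet> b / s\<rfloor> \<le> m" by linarith
  qed
  moreover have "finite {g. \<forall>b::'a. (b \<in> Basis \<longrightarrow> g b \<in> {- m..m}) \<and> (b \<notin> Basis \<longrightarrow> g b = 0)}"
    by (rule finite_set_of_finite_funs) auto
  ultimately show ?thesis by (rule finite_subset)
qed

text \<open>Let \<open>A\<close> be the mean of \<open>f\<close> over \<open>Q\<close>. Then \<open>f\<^sup>2 \<le> 2 A\<^sup>2 + 2 (f - A)\<^sup>2\<close>, and \<open>(f x - A)\<^sup>2\<close> is at most the mean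
of \<open>(f x - f y)\<^sup>2\<close> over \<open>y \<in> Q\<close>, the difference being the variance of \<open>f\<close> on \<open>Q\<close>.\<close>

lemma square_le_cell_average:
  fixes f :: "'a::euclidean_space \<Rightarrow> real"
  assumes f: "continuous_on UNIV f" "compact K" "\<And>x. x \<notin> K \<Longrightarrow> f x = 0"
    and Q: "Q \<in> sets borel" "emeasure lborel Q = ennreal m" and m: "m > 0"
  shows "ennreal ((f x)\<^sup>2) \<le> ennreal (2 * ((LINT y|lborel. indicator Q y * f y) / m)\<^sup>2)
     + ennreal (2 / m) * (\<integral>\<^sup>+y. indicator Q y * ennreal ((f x - f y)\<^sup>2) \<partial>lborel)"
proof -
  have fi: "integrable lborel f" by (rule compact_support_integrable[OF f])
  have f2: "integrable lborel (\<lambda>x. (f x)\<^sup>2)"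
    by (rule compact_support_integrable[OF continuous_on_power[OF f(1)] f(2)]) (simp add: f(3))
  have i1: "integrable lborel (\<lambda>y. indicator Q y * f y)"
    using integrable_mult_indicator[OF _ fi, of Q] Q by simp
  have i2: "integrable lborel (\<lambda>y. indicator Q y * (f y)\<^sup>2)"
    using integrable_mult_indicator[OF _ f2, of Q] Q by simp
  have i0: "integrable lborel (\<lambda>y. indicator Q y :: real)" using Q by simp
  have e0: "(LINT y|lborel. indicator Q y) = m" using Q m by (simp add: measure_def)
  define A where "A = (LINT y|lborel. indicator Q y * f y) / m"
  define J where "J = (LINT y|lborel. indicator Q y * (f y)\<^sup>2)"
  have e1: "(LINT y|lborel. indicator Q y * f y) = m * A" using m by (simp add: A_def)
  (* m times the mean square deviation of f from c on Q *)
  define V where "V c = (LINT y|lborel. indicator Q y * (c - f y)\<^sup>2)" for c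
  have iV: "integrable lborel (\<lambda>y. indicator Q y * (c - f y)\<^sup>2)" and
    V: "V c = c\<^sup>2 * m - 2 * c * (m * A) + J" for c
  proof -
    have eq: "(\<lambda>y. indicator Q y * (c - f y)\<^sup>2)
      = (\<lambda>y. c\<^sup>2 * indicator Q y - 2 * c * (indicator Q y * f y) + indicator Q y * (f y)\<^sup>2)"
      by (auto simp: power2_diff algebra_simps)
    show "integrable lborel (\<lambda>y. indicator Q y * (c - f y)\<^sup>2)" unfolding eq
      by (intro Bochner_Integration.integrable_add Bochner_Integration.integrable_diff integrable_mult_right i0 i1 i2)
    have "V c = (LINT y|lborel. c\<^sup>2 * indicator Q y - 2 * c * (indicator Q y * f y)) + J"
      unfolding V_def eq J_def
      by (intro Bochner_Integration.integral_add Bochner_Integration.integrable_diff integrable_mult_right i0 i1 i2)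
    also have "(LINT y|lborel. c\<^sup>2 * indicator Q y - 2 * c * (indicator Q y * f y))
        = (LINT y|lborel. c\<^sup>2 * indicator Q y) - (LINT y|lborel. 2 * c * (indicator Q y * f y))"
      by (intro Bochner_Integration.integral_diff integrable_mult_right i0 i1)
    also have "\<dots> = c\<^sup>2 * m - 2 * c * (m * A)" by (simp only: integral_mult_right_zero e0 e1)
    finally show "V c = c\<^sup>2 * m - 2 * c * (m * A) + J" .
  qed
  have "0 \<le> V A" unfolding V_def by simp
  then have J: "m * A\<^sup>2 \<le> J" unfolding V by (simp add: power2_eq_square algebra_simps)
  have "m * (f x - A)\<^sup>2 \<le> V (f x)" unfolding V using J by (simp add: power2_eq_square algebra_simps)
  then have "(f x - A)\<^sup>2 \<le> V (f x) / m" using m by (simp add: field_simps)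
  moreover have "(f x)\<^sup>2 \<le> 2 * A\<^sup>2 + 2 * (f x - A)\<^sup>2"
  proof -
    have "0 \<le> (2 * A - f x)\<^sup>2" by simp
    then show ?thesis by (simp add: power2_eq_square algebra_simps)
  qed
  ultimately have "(f x)\<^sup>2 \<le> 2 * A\<^sup>2 + 2 / m * V (f x)" by simp
  then have "ennreal ((f x)\<^sup>2) \<le> ennreal (2 * A\<^sup>2 + 2 / m * V (f x))" by (rule ennreal_leI)
  also have "\<dots> = ennreal (2 * A\<^sup>2) + ennreal (2 / m) * ennreal (V (f x))"
  proof -
    have "V (f x) \<ge> 0" unfolding V_def by simp
    then have "ennreal (2 * A\<^sup>2 + 2 / m * V (f x)) = ennreal (2 * A\<^sup>2) + ennreal (2 / m * V (f x))"
      using m by (intro ennreal_plus) auto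
    also have "ennreal (2 / m * V (f x)) = ennreal (2 / m) * ennreal (V (f x))"
      using m \<open>V (f x) \<ge> 0\<close> by (intro ennreal_mult) auto
    finally show ?thesis .
  qed
  also have "ennreal (V (f x)) = (\<integral>\<^sup>+y. ennreal (indicator Q y * (f x - f y)\<^sup>2) \<partial>lborel)"
    unfolding V_def by (intro nn_integral_eq_integral[symmetric] iV) simp
  also have "\<dots> = (\<integral>\<^sup>+y. indicator Q y * ennreal ((f x - f y)\<^sup>2) \<partial>lborel)"
    by (intro nn_integral_cong) (auto simp: indicator_def)
  finally show ?thesis unfolding A_def .
qed

lemma norm_cbox_le:
  fixes h :: "'a::euclidean_space" and s :: real
  assumes "h \<in> cbox (- (s *\<^sub>R One)) (s *\<^sub>R One)"
  shows "(norm h)\<^sup>2 \<le> DIM('a) * s\<^sup>2"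
proof -
  have "(norm h)\<^sup>2 = (\<Sum>b\<in>Basis. (h \<bullet> b)\<^sup>2)"
    unfolding norm_eq_sqrt_inner by (simp add: euclidean_inner[of h h] power2_eq_square sum_nonneg)
  also have "\<dots> \<le> (\<Sum>b\<in>(Basis::'a set). s\<^sup>2)"
  proof (rule sum_mono)
    fix b :: 'a assume "b \<in> Basis"
    then have "\<bar>h \<bullet> b\<bar> \<le> s" using assms by (force simp: mem_box)
    then show "(h \<bullet> b)\<^sup>2 \<le> s\<^sup>2" using power_mono[of "\<bar>h \<bullet> b\<bar>" s 2] by simp
  qed
  finally show ?thesis by simp
qed

text \<open>Two points of one cell differ by a vector of the cube \<open>[-s, s]\<^sup>d\<close>. Hence the mean square oscillations of \<open>f\<close>
within cells, summed over all cells, are at most an average over this cube of the \<open>L\<^sup>2\<close> distances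
between \<open>f\<close> and its translates, and these are of order \<open>s\<close> times the norm of the gradient. What remains
of \<open>f\<close> are its means over the finitely many cells that meet \<open>\<Omega>\<close>.\<close>

lemma Rellich_cells:
  fixes f :: "'a::euclidean_space \<Rightarrow> real" and s :: real
  assumes \<Omega>: "bounded \<Omega>" and s: "s > 0"
    and f: "smooth f" "compact K" "K \<subseteq> \<Omega>" "\<And>x. x \<notin> K \<Longrightarrow> f x = 0"
  defines "m \<equiv> s ^ DIM('a)"
  shows "(\<integral>\<^sup>+x. ennreal ((f x)\<^sup>2) \<partial>lborel)
    \<le> (\<Sum>i\<in>cell_index s ` \<Omega>. ennreal (2 / m * (LINT y|lborel. indicator (cell s i) y * f y)\<^sup>2))
      + ennreal (2 * 2 ^ DIM('a) * DIM('a) * s\<^sup>2) * (\<integral>\<^sup>+x. ennreal ((norm (grad f x))\<^sup>2) \<partial>lborel)"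
proof -
  define I where "I = cell_index s ` \<Omega>"
  define B where "B = cbox (- (s *\<^sub>R One)) (s *\<^sub>R One :: 'a)"
  define D where "D = (\<integral>\<^sup>+x. ennreal ((norm (grad f x))\<^sup>2) \<partial>lborel)"
  define a where "a i = (LINT y|lborel. indicator (cell s i) y * f y)" for i
  have m: "m > 0" using s by (simp add: m_def)
  have I: "\<forall>b. b \<notin> Basis \<longrightarrow> i b = 0" if "i \<in> I" for i using that unfolding I_def cell_index_def by auto
  have fin: "finite I" unfolding I_def by (rule finite_cell_index[OF s \<Omega>])
  have c: "continuous_on UNIV f" by (rule smooth_continuous[OF f(1)])
  have [measurable]: "f \<in> borel_measurable borel" by (rule borel_measurable_continuous_onI[OF c])
  have [measurable]: "B \<in> sets borel" unfolding B_def by simp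
  have cellm: "cell s i \<in> sets borel" if "i \<in> I" for i
    by (rule cell_bounds(1)[OF s I[OF that]])
  define T where "T x = (\<integral>\<^sup>+h. indicator B h * ennreal ((f (x + h) - f x)\<^sup>2) \<partial>lborel)" for x
  have pt: "ennreal ((f x)\<^sup>2) \<le> (\<Sum>i\<in>I. indicator (cell s i) x * ennreal (2 * (a i / m)\<^sup>2)) + ennreal (2 / m) * T x" for x
  proof (cases "x \<in> K")
    case False
    then show ?thesis using f(4) by simp
  next
    case True
    define i where "i = cell_index s x"
    have i: "i \<in> I" "x \<in> cell s i" using True f(3) unfolding I_def i_def cell_def by auto
    note cb = cell_bounds[OF s I[OF i(1)]]
    have [measurable]: "cell s i \<in> sets borel" by (rule cb(1))
    have "ennreal ((f x)\<^sup>2) \<le> ennreal (2 * (a i / m)\<^sup>2)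
       + ennreal (2 / m) * (\<integral>\<^sup>+y. indicator (cell s i) y * ennreal ((f x - f y)\<^sup>2) \<partial>lborel)"
      unfolding a_def by (rule square_le_cell_average[OF c f(2,4) cb(1) cb(2)[folded m_def] m])
    also have "ennreal (2 * (a i / m)\<^sup>2) \<le> (\<Sum>i\<in>I. indicator (cell s i) x * ennreal (2 * (a i / m)\<^sup>2))"
      using member_le_sum[OF i(1), of "\<lambda>i. indicator (cell s i) x * ennreal (2 * (a i / m)\<^sup>2)"] fin i(2) by simp
    also have "(\<integral>\<^sup>+y. indicator (cell s i) y * ennreal ((f x - f y)\<^sup>2) \<partial>lborel)
        = (\<integral>\<^sup>+h. indicator (cell s i) (x + h) * ennreal ((f x - f (x + h))\<^sup>2) \<partial>lborel)"
      by (rule nn_integral_translation[symmetric]) measurable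
    also have "\<dots> \<le> T x" unfolding T_def
    proof (rule nn_integral_mono)
      fix h
      show "indicator (cell s i) (x + h) * ennreal ((f x - f (x + h))\<^sup>2) \<le> indicator B h * ennreal ((f (x + h) - f x)\<^sup>2)"
      proof (cases "x + h \<in> cell s i")
        case True
        then have "h \<in> B" using cb(3)[OF i(2) True] unfolding B_def by simp
        then show ?thesis using True by (simp add: power2_commute)
      qed simp
    qed
    finally show ?thesis by (simp add: add_mono mult_left_mono)
  qed
  have "(\<integral>\<^sup>+x. T x \<partial>lborel) = (\<integral>\<^sup>+h. \<integral>\<^sup>+x. indicator B h * ennreal ((f (x + h) - f x)\<^sup>2) \<partial>lborel \<partial>lborel)"
    unfolding T_def by (rule lborel_pair.Fubini'[symmetric]) measurable
  also have "\<dots> \<le> (\<integral>\<^sup>+h. indicator B h * (ennreal (DIM('a) * s\<^sup>2) * D) \<partial>lborel)"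
  proof (rule nn_integral_mono)
    fix h :: 'a
    have "(\<integral>\<^sup>+x. indicator B h * ennreal ((f (x + h) - f x)\<^sup>2) \<partial>lborel)
      = indicator B h * (\<integral>\<^sup>+x. ennreal ((f (x + h) - f x)\<^sup>2) \<partial>lborel)" by (intro nn_integral_cmult) simp
    also have "\<dots> \<le> indicator B h * (ennreal (DIM('a) * s\<^sup>2) * D)"
    proof (cases "h \<in> B")
      case True
      have "(\<integral>\<^sup>+x. ennreal ((f (x + h) - f x)\<^sup>2) \<partial>lborel) \<le> ennreal ((norm h)\<^sup>2) * D"
        unfolding D_def by (rule translation_estimate[OF f(1)])
      also have "\<dots> \<le> ennreal (DIM('a) * s\<^sup>2) * D"
        using norm_cbox_le True unfolding B_def by (intro mult_right_mono ennreal_leI) auto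
      finally show ?thesis by (intro mult_left_mono) auto
    qed simp
    finally show "(\<integral>\<^sup>+x. indicator B h * ennreal ((f (x + h) - f x)\<^sup>2) \<partial>lborel)
      \<le> indicator B h * (ennreal (DIM('a) * s\<^sup>2) * D)" .
  qed
  also have "\<dots> = emeasure lborel B * (ennreal (DIM('a) * s\<^sup>2) * D)"
    by (subst nn_integral_multc) simp_all
  also have "emeasure lborel B = ennreal ((2 * s) ^ DIM('a))"
  proof -
    have "emeasure lborel B = ennreal (\<Prod>b\<in>(Basis::'a set). (s *\<^sub>R One - (- (s *\<^sub>R One)) :: 'a) \<bullet> b)"
      unfolding B_def using s by (intro emeasure_lborel_cbox) simp
    also have "(\<Prod>b\<in>(Basis::'a set). (s *\<^sub>R One - (- (s *\<^sub>R One)) :: 'a) \<bullet> b) = (\<Prod>b\<in>(Basis::'a set). 2 * s)"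
      by (intro prod.cong) (auto simp: inner_add_left)
    finally show ?thesis by simp
  qed
  finally have T: "(\<integral>\<^sup>+x. T x \<partial>lborel) \<le> ennreal ((2 * s) ^ DIM('a)) * (ennreal (DIM('a) * s\<^sup>2) * D)" .
  have Tm[measurable]: "T \<in> borel_measurable borel" unfolding T_def by measurable
  have "(\<integral>\<^sup>+x. ennreal ((f x)\<^sup>2) \<partial>lborel)
      \<le> (\<integral>\<^sup>+x. (\<Sum>i\<in>I. indicator (cell s i) x * ennreal (2 * (a i / m)\<^sup>2)) + ennreal (2 / m) * T x \<partial>lborel)"
    by (intro nn_integral_mono pt)
  also have "\<dots> = (\<integral>\<^sup>+x. (\<Sum>i\<in>I. indicator (cell s i) x * ennreal (2 * (a i / m)\<^sup>2)) \<partial>lborel)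
      + (\<integral>\<^sup>+x. ennreal (2 / m) * T x \<partial>lborel)"
    using cellm by (intro nn_integral_add borel_measurable_sum borel_measurable_times) auto
  also have "(\<integral>\<^sup>+x. (\<Sum>i\<in>I. indicator (cell s i) x * ennreal (2 * (a i / m)\<^sup>2)) \<partial>lborel)
      = (\<Sum>i\<in>I. \<integral>\<^sup>+x. indicator (cell s i) x * ennreal (2 * (a i / m)\<^sup>2) \<partial>lborel)"
    using cellm by (intro nn_integral_sum) auto
  also have "\<dots> = (\<Sum>i\<in>I. ennreal (2 / m * (a i)\<^sup>2))"
  proof (rule sum.cong[OF refl])
    fix i assume i: "i \<in> I"
    have "(\<integral>\<^sup>+x. indicator (cell s i) x * ennreal (2 * (a i / m)\<^sup>2) \<partial>lborel)
        = ennreal m * ennreal (2 * (a i / m)\<^sup>2)"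
      using cellm[OF i] cell_bounds(2)[OF s I[OF i]] by (subst nn_integral_multc) (simp_all add: m_def)
    also have "\<dots> = ennreal (2 / m * (a i)\<^sup>2)"
      using m by (simp add: ennreal_mult[symmetric] power2_eq_square field_simps)
    finally show "(\<integral>\<^sup>+x. indicator (cell s i) x * ennreal (2 * (a i / m)\<^sup>2) \<partial>lborel) = ennreal (2 / m * (a i)\<^sup>2)" .
  qed
  also have "(\<integral>\<^sup>+x. ennreal (2 / m) * T x \<partial>lborel) = ennreal (2 / m) * (\<integral>\<^sup>+x. T x \<partial>lborel)"
    by (intro nn_integral_cmult) simp
  also have "\<dots> \<le> ennreal (2 / m) * (ennreal ((2 * s) ^ DIM('a)) * (ennreal (DIM('a) * s\<^sup>2) * D))"
    by (intro mult_left_mono T) simp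
  also have "\<dots> = ennreal (2 / m * ((2 * s) ^ DIM('a) * (DIM('a) * s\<^sup>2))) * D"
  proof -
    have "ennreal \<alpha> * (ennreal \<beta> * (ennreal \<gamma> * D)) = ennreal (\<alpha> * (\<beta> * \<gamma>)) * D"
      if "\<alpha> \<ge> 0" "\<beta> \<ge> 0" "\<gamma> \<ge> 0" for \<alpha> \<beta> \<gamma>
      using that by (simp add: ennreal_mult mult.assoc)
    then show ?thesis by this (use m s in simp_all)
  qed
  also have "2 / m * ((2 * s) ^ DIM('a) * (DIM('a) * s\<^sup>2)) = 2 * 2 ^ DIM('a) * DIM('a) * s\<^sup>2"
    using m s by (simp add: m_def power_mult_distrib)
  finally show ?thesis unfolding I_def a_def D_def by (simp add: add_left_mono)
qed

text \<open>The constant of the grid estimate tends to zero with the mesh, so the mesh can be chosen according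
to \<open>\<epsilon>\<close>.\<close>

theorem Rellich_inequality:
  fixes \<Omega> :: "'a::euclidean_space set"
  assumes \<Omega>: "open \<Omega>" "bounded \<Omega>" and e: "\<epsilon> > 0"
  shows "\<exists>(N::nat) Q c. (\<forall>i<N. Q i \<in> sets borel) \<and> (\<forall>\<eta>\<in>test_functions \<Omega>.
    (LINT x|lebesgue_on \<Omega>. (\<eta> x)\<^sup>2) \<le> \<epsilon> * (LINT x|lebesgue_on \<Omega>. (norm (grad \<eta> x))\<^sup>2)
      + (\<Sum>i<N. (c * (LINT x|lebesgue_on \<Omega>. indicator (Q i) x * \<eta> x))\<^sup>2))"
proof -
  (* the constant of the grid estimate, with the factor s^2 removed *)
  define L where "L = 2 * 2 ^ DIM('a) * real DIM('a)"
  have L: "L > 0" unfolding L_def by simp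
  define s where "s = sqrt (\<epsilon> / L)"
  have s: "s > 0" "L * s\<^sup>2 = \<epsilon>" using L e by (simp_all add: s_def)
  define m where "m = s ^ DIM('a)"
  have m: "m > 0" using s by (simp add: m_def)
  define I where "I = cell_index s ` \<Omega>"
  have fin: "finite I" unfolding I_def by (rule finite_cell_index[OF s(1) \<Omega>(2)])
  have I: "\<forall>b. b \<notin> Basis \<longrightarrow> i b = 0" if "i \<in> I" for i using that unfolding I_def cell_index_def by auto
  obtain h where h: "bij_betw h {0..<card I} I" using ex_bij_betw_nat_finite[OF fin] by blast
  define Q where "Q k = cell s (h k)" for k
  define c where "c = sqrt (2 / m)"
  have c2: "c\<^sup>2 = 2 / m" using m by (simp add: c_def)
  have hI: "h k \<in> I" if "k < card I" for k using h that by (auto simp: bij_betw_def)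
  have Q: "Q k \<in> sets borel" if "k < card I" for k
    unfolding Q_def by (rule cell_bounds(1)[OF s(1) I[OF hI[OF that]]])
  have "(LINT x|lebesgue_on \<Omega>. (\<eta> x)\<^sup>2) \<le> \<epsilon> * (LINT x|lebesgue_on \<Omega>. (norm (grad \<eta> x))\<^sup>2)
      + (\<Sum>i<card I. (c * (LINT x|lebesgue_on \<Omega>. indicator (Q i) x * \<eta> x))\<^sup>2)"
    if \<eta>: "\<eta> \<in> test_functions \<Omega>" for \<eta>
  proof -
    obtain K where K0: "smooth \<eta>" "compact K" "K \<subseteq> \<Omega>" "\<forall>x. x \<notin> K \<longrightarrow> \<eta> x = 0"
      using \<eta> by (rule test_functionsE)
    note K = K0(1-3) K0(4)[rule_format]
    have z: "grad \<eta> x = 0" if "x \<notin> K" for x using grad_eq_0_outside[OF K(2,4) that] .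
    have c1: "continuous_on UNIV (\<lambda>x. (\<eta> x)\<^sup>2)" by (intro continuous_on_power smooth_continuous K)
    have c2': "continuous_on UNIV (\<lambda>x. (norm (grad \<eta> x))\<^sup>2)"
      by (intro continuous_on_power continuous_on_norm smooth_continuous_grad K)
    have 1: "(\<integral>\<^sup>+x. ennreal ((\<eta> x)\<^sup>2) \<partial>lborel) = ennreal (LINT x|lebesgue_on \<Omega>. (\<eta> x)\<^sup>2)"
      using compact_support_lebesgue_on(2)[OF c1 K(2,3) _ \<Omega>(1)] compact_support_integrable[OF c1 K(2)] K(4)
      by (subst nn_integral_eq_integral) auto
    have 2: "(\<integral>\<^sup>+x. ennreal ((norm (grad \<eta> x))\<^sup>2) \<partial>lborel) = ennreal (LINT x|lebesgue_on \<Omega>. (norm (grad \<eta> x))\<^sup>2)"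
      using compact_support_lebesgue_on(2)[OF c2' K(2,3) _ \<Omega>(1)] compact_support_integrable[OF c2' K(2)] z
      by (subst nn_integral_eq_integral) auto
    have 3: "(LINT y|lborel. indicator (cell s i) y * \<eta> y) = (LINT x|lebesgue_on \<Omega>. indicator (cell s i) x * \<eta> x)" if "i \<in> I" for i
    proof -
      have O: "\<Omega> \<inter> space lebesgue \<in> sets lebesgue" using \<Omega>(1) by simp
      have [measurable]: "cell s i \<in> sets borel" by (rule cell_bounds(1)[OF s(1) I[OF that]])
      have [measurable]: "\<eta> \<in> borel_measurable borel"
        by (intro borel_measurable_continuous_onI smooth_continuous K)
      have "indicator \<Omega> x *\<^sub>R (indicator (cell s i) x * \<eta> x) = indicator (cell s i) x * \<eta> x" for x
        by (cases "x \<in> K") (use K in \<open>auto simp: indicator_def\<close>)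
      then have eq: "(\<lambda>x. indicator \<Omega> x *\<^sub>R (indicator (cell s i) x * \<eta> x)) = (\<lambda>x. indicator (cell s i) x * \<eta> x)"
        by (rule ext)
      have "(LINT x|lebesgue_on \<Omega>. indicator (cell s i) x * \<eta> x) = (LINT x|lebesgue. indicator (cell s i) x * \<eta> x)"
        unfolding integral_restrict_space[OF O] eq ..
      also have "\<dots> = (LINT y|lborel. indicator (cell s i) y * \<eta> y)" by (rule integral_completion) simp
      finally show ?thesis by simp
    qed
    define a where "a i = (LINT x|lebesgue_on \<Omega>. indicator (cell s i) x * \<eta> x)" for i
    have "ennreal (LINT x|lebesgue_on \<Omega>. (\<eta> x)\<^sup>2)
      \<le> (\<Sum>i\<in>I. ennreal (2 / m * (LINT y|lborel. indicator (cell s i) y * \<eta> y)\<^sup>2))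
        + ennreal (L * s\<^sup>2) * ennreal (LINT x|lebesgue_on \<Omega>. (norm (grad \<eta> x))\<^sup>2)"
      using Rellich_cells[OF \<Omega>(2) s(1) K] unfolding 1 2 I_def m_def L_def by simp
    also have "(\<Sum>i\<in>I. ennreal (2 / m * (LINT y|lborel. indicator (cell s i) y * \<eta> y)\<^sup>2))
        = (\<Sum>i\<in>I. ennreal ((c * a i)\<^sup>2))"
      using 3 by (intro sum.cong) (auto simp: a_def power_mult_distrib c2)
    also have "\<dots> = ennreal (\<Sum>i\<in>I. (c * a i)\<^sup>2)" by (rule sum_ennreal) simp
    also have "(\<Sum>i\<in>I. (c * a i)\<^sup>2) = (\<Sum>k<card I. (c * a (h k))\<^sup>2)"
      using sum.reindex_bij_betw[OF h, of "\<lambda>i. (c * a i)\<^sup>2"] by (simp add: atLeast0LessThan)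
    also have "ennreal (\<Sum>k<card I. (c * a (h k))\<^sup>2) + ennreal (L * s\<^sup>2) * ennreal (LINT x|lebesgue_on \<Omega>. (norm (grad \<eta> x))\<^sup>2)
        = ennreal ((\<Sum>k<card I. (c * a (h k))\<^sup>2) + \<epsilon> * (LINT x|lebesgue_on \<Omega>. (norm (grad \<eta> x))\<^sup>2))"
      unfolding s(2) using e by (subst ennreal_plus) (auto simp: ennreal_mult sum_nonneg)
    finally have "(LINT x|lebesgue_on \<Omega>. (\<eta> x)\<^sup>2) \<le> (\<Sum>k<card I. (c * a (h k))\<^sup>2) + \<epsilon> * (LINT x|lebesgue_on \<Omega>. (norm (grad \<eta> x))\<^sup>2)"
      using e by (subst (asm) ennreal_le_iff) (auto simp: sum_nonneg)
    then show ?thesis unfolding a_def Q_def by simp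
  qed
  then show ?thesis using Q by blast
qed

section \<open>Classes of functions modulo null sets\<close>

lemma rep_abs_aefun: "AE x in lebesgue. rep_aefun (abs_aefun f) x = f x"
  using Quotient3_rep_abs[OF Quotient3_aefun, of f] by simp

lemma abs_rep_aefun: "abs_aefun (rep_aefun u) = u"
  by (rule Quotient3_abs_rep[OF Quotient3_aefun])

lemma aefun_eqI: "AE x in lebesgue. rep_aefun u x = rep_aefun v x \<Longrightarrow> u = v"
  using Quotient3_rel_rep[OF Quotient3_aefun, of u v] by simp

lemma rep_add: "AE x in lebesgue. rep_aefun (u + v) x = rep_aefun u x + rep_aefun v x"
proof -
  have "u + v = abs_aefun (\<lambda>x. rep_aefun u x + rep_aefun v x)"
    using plus_aefun.abs_eq[of "rep_aefun u" "rep_aefun v"] by (simp add: abs_rep_aefun)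
  then show ?thesis using rep_abs_aefun by metis
qed

lemma rep_scaleR: "AE x in lebesgue. rep_aefun (c *\<^sub>R u) x = c * rep_aefun u x"
proof -
  have "c *\<^sub>R u = abs_aefun (\<lambda>x. c * rep_aefun u x)"
    using scaleR_aefun.abs_eq[of c "rep_aefun u"] by (simp add: abs_rep_aefun)
  then show ?thesis using rep_abs_aefun by metis
qed

lemma rep_0: "AE x in lebesgue. rep_aefun 0 x = 0"
  unfolding zero_aefun_def using rep_abs_aefun[of "\<lambda>_. 0"] .

section \<open>The Sobolev space\<close>

lemma l2_tendsto_norm:
  assumes f: "\<And>n. l2 M (f n)" "l2 M g"
    and lim: "(\<lambda>n. LINT x|M. (norm (f n x - g x))\<^sup>2) \<longlonglongrightarrow> 0"
  shows "(\<lambda>n. LINT x|M. (norm (f n x))\<^sup>2) \<longlonglongrightarrow> (LINT x|M. (norm (g x))\<^sup>2)"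
proof -
  have eq: "(LINT x|M. (norm (f n x))\<^sup>2)
      = (LINT x|M. (norm (f n x - g x))\<^sup>2) + 2 * (LINT x|M. f n x \<bullet> g x) - (LINT x|M. (norm (g x))\<^sup>2)" for n
  proof -
    have "(LINT x|M. (norm (f n x))\<^sup>2)
        = (LINT x|M. (norm (f n x - g x))\<^sup>2 + 2 * (f n x \<bullet> g x) - (norm (g x))\<^sup>2)"
      by (intro Bochner_Integration.integral_cong)
        (auto simp: power2_norm_eq_inner inner_diff_left inner_diff_right inner_commute)
    also have "\<dots> = (LINT x|M. (norm (f n x - g x))\<^sup>2) + 2 * (LINT x|M. f n x \<bullet> g x) - (LINT x|M. (norm (g x))\<^sup>2)"
      using l2_norm_integrable[OF l2_diff[OF f]] l2_inner_integrable[OF f] l2_norm_integrable[OF f(2)] by simp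
    finally show ?thesis .
  qed
  have "(\<lambda>n. (LINT x|M. (norm (f n x - g x))\<^sup>2) + 2 * (LINT x|M. f n x \<bullet> g x) - (LINT x|M. (norm (g x))\<^sup>2))
      \<longlonglongrightarrow> 0 + 2 * (LINT x|M. g x \<bullet> g x) - (LINT x|M. (norm (g x))\<^sup>2)"
    by (intro tendsto_intros lim l2_tendsto_inner f)
  then show ?thesis unfolding eq by (simp add: power2_norm_eq_inner)
qed

locale bounded_open_set =
  fixes \<Omega> :: "'a::euclidean_space set"
  assumes open_\<Omega>: "open \<Omega>" and bounded_\<Omega>: "bounded \<Omega>"
begin

abbreviation M :: "'a measure" where "M \<equiv> lebesgue_on \<Omega>"

lemma \<Omega>_sets: "\<Omega> \<inter> space lebesgue \<in> sets lebesgue" using open_\<Omega> by simp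

lemma finite_measure_M: "finite_measure M"
proof
  have "\<Omega> \<in> lmeasurable" using bounded_\<Omega> open_\<Omega> by (simp add: bounded_set_imp_lmeasurable)
  then have "emeasure lebesgue \<Omega> \<noteq> \<infinity>" unfolding infinity_ennreal_def by (rule fmeasurableD2)
  moreover have "emeasure M \<Omega> = emeasure lebesgue \<Omega>"
    by (rule emeasure_restrict_space[OF \<Omega>_sets]) simp
  moreover have "space M = \<Omega>" by (simp add: space_restrict_space)
  ultimately show "emeasure M (space M) \<noteq> \<infinity>" by simp
qed

lemma AE_M:
  assumes "AE x in lebesgue. P x"
  shows "AE x in M. P x"
  using assms unfolding AE_restrict_space_iff[OF \<Omega>_sets] by eventually_elim simp

lemma l2_indicator: "Q \<in> sets borel \<Longrightarrow> l2 M (indicator Q :: 'a \<Rightarrow> real)"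
proof -
  assume Q: "Q \<in> sets borel"
  interpret finite_measure M by (rule finite_measure_M)
  have "Q \<in> sets lebesgue" using Q by simp
  then have m: "(indicator Q :: 'a \<Rightarrow> real) \<in> borel_measurable M"
    by (intro measurable_restrict_space1) simp
  have "integrable M (\<lambda>x. (norm (indicator Q x :: real))\<^sup>2)"
  proof -
    have "(\<lambda>x. (norm (indicator Q x :: real))\<^sup>2) = (indicator Q :: 'a \<Rightarrow> real)"
      by (auto simp: indicator_def fun_eq_iff)
    moreover have "integrable M (indicator Q :: 'a \<Rightarrow> real)"
      by (rule integrable_const_bound[where B = 1]) (use m in \<open>auto simp: indicator_def\<close>)
    ultimately show ?thesis by simp
  qed
  then show ?thesis using m unfolding l2_def by simp
qed

lemma l2_const: "l2 M (\<lambda>x. c :: 'b::euclidean_space)"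
proof -
  interpret finite_measure M by (rule finite_measure_M)
  show ?thesis unfolding l2_def by simp
qed

text \<open>By completeness of Lebesgue measure, measurability depends on the class of a function only.\<close>

lemma measurable_M_cong_AE:
  fixes f g :: "'a \<Rightarrow> real"
  assumes "f \<in> borel_measurable M" "AE x in lebesgue. f x = g x"
  shows "g \<in> borel_measurable M"
proof -
  have "(\<lambda>x. indicator \<Omega> x *\<^sub>R f x) \<in> borel_measurable lebesgue"
    using assms(1) unfolding borel_measurable_restrict_space_iff[OF \<Omega>_sets] .
  moreover have "AE x in lebesgue. indicator \<Omega> x *\<^sub>R f x = indicator \<Omega> x *\<^sub>R g x"
    using assms(2) by eventually_elim simp
  ultimately have "(\<lambda>x. indicator \<Omega> x *\<^sub>R g x) \<in> borel_measurable lebesgue"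
    by (rule borel_measurable_AE)
  then show ?thesis unfolding borel_measurable_restrict_space_iff[OF \<Omega>_sets] .
qed

lemma has_weak_gradD:
  assumes "has_weak_grad \<Omega> f g"
  shows "l2 M f" "l2 M g"
    "\<eta> \<in> test_functions \<Omega> \<Longrightarrow> b \<in> Basis \<Longrightarrow>
      (LINT x|M. f x * pdiff b \<eta> x) = - (LINT x|M. (g x \<bullet> b) * \<eta> x)"
  using assms unfolding has_weak_grad_def square_integrable_l2 by blast+

lemma l2_test:
  assumes \<eta>: "\<eta> \<in> test_functions \<Omega>"
  shows "l2 M \<eta>" "l2 M (grad \<eta>)" "pdiff b \<eta> x = grad \<eta> x \<bullet> b" "l2 M (\<lambda>x. grad \<eta> x \<bullet> b)"
    "l2 M (\<lambda>x. \<eta> x *\<^sub>R b)"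
proof -
  obtain K where K0: "smooth \<eta>" "compact K" "K \<subseteq> \<Omega>" "\<forall>x. x \<notin> K \<longrightarrow> \<eta> x = 0"
    using \<eta> by (rule test_functionsE)
  note K = K0(1-3) K0(4)[rule_format]
  note g0 = grad_eq_0_outside[OF K(2,4)]
  have c: "continuous_on UNIV \<eta>" "continuous_on UNIV (grad \<eta>)"
    using K by (simp_all add: smooth_continuous smooth_continuous_grad)
  have c': "continuous_on UNIV (\<lambda>x. grad \<eta> x \<bullet> b)" "continuous_on UNIV (\<lambda>x. \<eta> x *\<^sub>R b)"
    by (intro continuous_on_inner continuous_on_scaleR continuous_on_const c)+
  show "l2 M \<eta>" by (rule compact_support_lebesgue_on(3)[OF c(1) K(2,3) _ open_\<Omega>]) (simp add: K)
  show "l2 M (grad \<eta>)" by (rule compact_support_lebesgue_on(3)[OF c(2) K(2,3) _ open_\<Omega>]) (simp add: g0)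
  show "l2 M (\<lambda>x. grad \<eta> x \<bullet> b)"
    by (rule compact_support_lebesgue_on(3)[OF c'(1) K(2,3) _ open_\<Omega>]) (simp add: g0)
  show "l2 M (\<lambda>x. \<eta> x *\<^sub>R b)"
    by (rule compact_support_lebesgue_on(3)[OF c'(2) K(2,3) _ open_\<Omega>]) (simp add: K)
  show "pdiff b \<eta> x = grad \<eta> x \<bullet> b" by (rule pdiff_eq_grad[OF smooth_differentiable[OF K(1)]])
qed

text \<open>The function \<open>wgrad\<close> selects some weak gradient of a representative. Uniqueness is what makes it linear
and equal to the limit of the gradients of approximating test functions.\<close>

lemma weak_grad_unique:
  assumes g: "has_weak_grad \<Omega> f g" and g': "has_weak_grad \<Omega> f' g'" and eq: "AE x in M. f x = f' x"
  shows "AE x in M. g x = g' x"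
proof -
  interpret finite_measure M by (rule finite_measure_M)
  note G = has_weak_gradD[OF g] and G' = has_weak_gradD[OF g']
  have "AE x in M. (g x - g' x) \<bullet> b = 0" if b: "b \<in> Basis" for b
  proof (rule fundamental_lemma[OF open_\<Omega>])
    show "integrable M (\<lambda>x. (g x - g' x) \<bullet> b)"
      by (rule l2_inner_integrable[OF l2_diff[OF G(2) G'(2)] l2_const])
    fix \<eta> assume \<eta>: "\<eta> \<in> test_functions \<Omega>"
    note L = l2_test[OF \<eta>]
    have i: "integrable M (\<lambda>x. (g x \<bullet> b) * \<eta> x)" "integrable M (\<lambda>x. (g' x \<bullet> b) * \<eta> x)"
      using l2_inner_integrable[OF G(2) L(5)[of b]] l2_inner_integrable[OF G'(2) L(5)[of b]]
      by (simp_all add: mult.commute)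
    have "(LINT x|M. f x * pdiff b \<eta> x) = (LINT x|M. f' x * pdiff b \<eta> x)"
    proof (rule integral_cong_AE)
      show "(\<lambda>x. f x * pdiff b \<eta> x) \<in> borel_measurable M"
        unfolding L(3) using G(1) L(4) by (intro borel_measurable_times l2_measurable)
      show "(\<lambda>x. f' x * pdiff b \<eta> x) \<in> borel_measurable M"
        unfolding L(3) using G'(1) L(4) by (intro borel_measurable_times l2_measurable)
      show "AE x in M. f x * pdiff b \<eta> x = f' x * pdiff b \<eta> x" using eq by eventually_elim simp
    qed
    then have "(LINT x|M. (g x \<bullet> b) * \<eta> x) = (LINT x|M. (g' x \<bullet> b) * \<eta> x)"
      using G(3)[OF \<eta> b] G'(3)[OF \<eta> b] by simp
    then show "(LINT x|M. ((g x - g' x) \<bullet> b) * \<eta> x) = 0"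
      using i by (simp add: inner_diff_left left_diff_distrib)
  qed
  then have "AE x in M. \<forall>b\<in>Basis. (g x - g' x) \<bullet> b = 0"
    by (intro AE_finite_allI) auto
  then show ?thesis
  proof eventually_elim
    case (elim x)
    show ?case by (rule euclidean_eqI) (use elim in \<open>simp add: inner_diff_left\<close>)
  qed
qed

lemma weak_grad_lincomb:
  assumes g: "has_weak_grad \<Omega> f g" and g': "has_weak_grad \<Omega> f' g'"
  shows "has_weak_grad \<Omega> (\<lambda>x. f x + c * f' x) (\<lambda>x. g x + c *\<^sub>R g' x)"
proof -
  note G = has_weak_gradD[OF g] and G' = has_weak_gradD[OF g']
  have "(LINT x|M. (f x + c * f' x) * pdiff b \<eta> x) = - (LINT x|M. ((g x + c *\<^sub>R g' x) \<bullet> b) * \<eta> x)"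
    if \<eta>: "\<eta> \<in> test_functions \<Omega>" and b: "b \<in> Basis" for \<eta> b
  proof -
    note L = l2_test[OF \<eta>]
    have i: "integrable M (\<lambda>x. (g x \<bullet> b) * \<eta> x)" "integrable M (\<lambda>x. (g' x \<bullet> b) * \<eta> x)"
      using l2_inner_integrable[OF G(2) L(5)[of b]] l2_inner_integrable[OF G'(2) L(5)[of b]]
      by (simp_all add: mult.commute)
    have j: "integrable M (\<lambda>x. f x * pdiff b \<eta> x)" "integrable M (\<lambda>x. f' x * pdiff b \<eta> x)"
      unfolding L(3) by (intro l2_mult_integrable G(1) G'(1) L(4))+
    have "(LINT x|M. (f x + c * f' x) * pdiff b \<eta> x) = (LINT x|M. f x * pdiff b \<eta> x) + c * (LINT x|M. f' x * pdiff b \<eta> x)"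
      using j by (simp add: distrib_right mult.assoc)
    also have "\<dots> = - ((LINT x|M. (g x \<bullet> b) * \<eta> x) + c * (LINT x|M. (g' x \<bullet> b) * \<eta> x))"
      using G(3)[OF \<eta> b] G'(3)[OF \<eta> b] by simp
    also have "(LINT x|M. (g x \<bullet> b) * \<eta> x) + c * (LINT x|M. (g' x \<bullet> b) * \<eta> x)
        = (LINT x|M. ((g x + c *\<^sub>R g' x) \<bullet> b) * \<eta> x)"
      using i by (simp add: inner_add_left distrib_right mult.assoc)
    finally show ?thesis .
  qed
  then show ?thesis unfolding has_weak_grad_def square_integrable_l2
    using l2_add[OF G(1) l2_scale[OF G'(1), of c]] l2_add[OF G(2) l2_scale[OF G'(2), of c]] by simp
qed

lemma l2_cong_AE:
  fixes f g :: "'a \<Rightarrow> real"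
  assumes "l2 M f" "AE x in lebesgue. f x = g x"
  shows "l2 M g"
proof -
  have m: "g \<in> borel_measurable M" using measurable_M_cong_AE[OF l2_measurable[OF assms(1)] assms(2)] .
  have "integrable M (\<lambda>x. (norm (g x))\<^sup>2)"
  proof (rule integrable_cong_AE_imp[OF l2_norm_integrable[OF assms(1)]])
    show "(\<lambda>x. (norm (g x))\<^sup>2) \<in> borel_measurable M" using m by simp
    show "AE x in M. (norm (f x))\<^sup>2 = (norm (g x))\<^sup>2" using AE_M[OF assms(2)] by eventually_elim simp
  qed
  then show ?thesis using m unfolding l2_def by simp
qed

lemma weak_grad_cong_AE:
  assumes g: "has_weak_grad \<Omega> f g" and eq: "AE x in lebesgue. f x = f' x"
  shows "has_weak_grad \<Omega> f' g"
proof -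
  note G = has_weak_gradD[OF g]
  have f': "l2 M f'" by (rule l2_cong_AE[OF G(1) eq])
  have "(LINT x|M. f' x * pdiff b \<eta> x) = (LINT x|M. f x * pdiff b \<eta> x)"
    if \<eta>: "\<eta> \<in> test_functions \<Omega>" for \<eta> b
  proof (rule integral_cong_AE)
    note L = l2_test[OF \<eta>]
    show "(\<lambda>x. f' x * pdiff b \<eta> x) \<in> borel_measurable M"
      unfolding L(3) using f' L(4) by (intro borel_measurable_times l2_measurable)
    show "(\<lambda>x. f x * pdiff b \<eta> x) \<in> borel_measurable M"
      unfolding L(3) using G(1) L(4) by (intro borel_measurable_times l2_measurable)
    show "AE x in M. f' x * pdiff b \<eta> x = f x * pdiff b \<eta> x"
      using AE_M[OF eq] by eventually_elim simp
  qed
  then show ?thesis using f' G unfolding has_weak_grad_def square_integrable_l2 by simp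
qed

text \<open>The squared distance of \<open>H\<^sup>1(\<Omega>)\<close>, for functions given together with their gradients.\<close>

definition sq_dist :: "('a \<Rightarrow> real) \<Rightarrow> ('a \<Rightarrow> 'a) \<Rightarrow> ('a \<Rightarrow> real) \<Rightarrow> ('a \<Rightarrow> 'a) \<Rightarrow> real" where
  "sq_dist f g f' g' = (LINT x|M. (f x - f' x)\<^sup>2) + (LINT x|M. (norm (g x - g' x))\<^sup>2)"

lemma sq_dist_triangle:
  assumes "l2 M f" "l2 M g" "l2 M f'" "l2 M g'" "l2 M f''" "l2 M g''"
  shows "sq_dist f g f'' g'' \<le> 2 * sq_dist f g f' g' + 2 * sq_dist f' g' f'' g''"
  using l2_parallelogram(1)[OF l2_diff[OF assms(1,3)] l2_diff[OF assms(3,5)]]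
    l2_parallelogram(1)[OF l2_diff[OF assms(2,4)] l2_diff[OF assms(4,6)]]
  unfolding sq_dist_def by simp

lemma sq_dist_cong:
  assumes l: "l2 M f" "l2 M g" "l2 M f'" "l2 M g'" "l2 M f''" "l2 M g''"
    and "AE x in M. f' x = f'' x" "AE x in M. g' x = g'' x"
  shows "sq_dist f g f' g' = sq_dist f g f'' g''"
proof -
  have "(LINT x|M. (f x - f' x)\<^sup>2) = (LINT x|M. (f x - f'' x)\<^sup>2)"
    using assms(7) l by (intro integral_cong_AE borel_measurable_power borel_measurable_diff l2_measurable)
      (auto elim!: eventually_mono)
  moreover have "(LINT x|M. (norm (g x - g' x))\<^sup>2) = (LINT x|M. (norm (g x - g'' x))\<^sup>2)"
  proof (rule integral_cong_AE)
    have "(\<lambda>x. g x - g' x) \<in> borel_measurable M" "(\<lambda>x. g x - g'' x) \<in> borel_measurable M"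
      using l by (simp_all add: borel_measurable_diff l2_measurable)
    then show "(\<lambda>x. (norm (g x - g' x))\<^sup>2) \<in> borel_measurable M" "(\<lambda>x. (norm (g x - g'' x))\<^sup>2) \<in> borel_measurable M"
      by simp_all
    show "AE x in M. (norm (g x - g' x))\<^sup>2 = (norm (g x - g'' x))\<^sup>2" using assms(8) by eventually_elim simp
  qed
  ultimately show ?thesis unfolding sq_dist_def by simp
qed

lemma H10_grad:
  assumes u: "u \<in> H10 \<Omega>"
  shows "has_weak_grad \<Omega> (rep_aefun u) (wgrad \<Omega> u)"
proof -
  have "\<exists>g. has_weak_grad \<Omega> (rep_aefun u) g" using u unfolding H10_def by blast
  then show ?thesis unfolding wgrad_def by (rule someI_ex)
qed

lemma H10_l2: "u \<in> H10 \<Omega> \<Longrightarrow> l2 M (rep_aefun u)" "u \<in> H10 \<Omega> \<Longrightarrow> l2 M (wgrad \<Omega> u)"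
  using has_weak_gradD[OF H10_grad] by auto

lemma H10_sequence:
  assumes u: "u \<in> H10 \<Omega>"
  shows "\<exists>\<eta>. (\<forall>k::nat. \<eta> k \<in> test_functions \<Omega>) \<and> (\<lambda>k. sq_dist (\<eta> k) (grad (\<eta> k)) (rep_aefun u) (wgrad \<Omega> u)) \<longlonglongrightarrow> 0"
proof -
  obtain g \<eta> where g: "has_weak_grad \<Omega> (rep_aefun u) g" and \<eta>: "\<And>k::nat. \<eta> k \<in> test_functions \<Omega>"
    and lim: "(\<lambda>k. sq_dist (\<eta> k) (grad (\<eta> k)) (rep_aefun u) g) \<longlonglongrightarrow> 0"
    using u unfolding H10_def sq_dist_def by blast
  have ae: "AE x in M. g x = wgrad \<Omega> u x" by (rule weak_grad_unique[OF g H10_grad[OF u]]) simp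
  have "sq_dist (\<eta> k) (grad (\<eta> k)) (rep_aefun u) g = sq_dist (\<eta> k) (grad (\<eta> k)) (rep_aefun u) (wgrad \<Omega> u)" for k
    by (rule sq_dist_cong[OF l2_test(1,2)[OF \<eta>] H10_l2(1)[OF u] has_weak_gradD(2)[OF g] H10_l2[OF u] _ ae]) simp
  then have "(\<lambda>k. sq_dist (\<eta> k) (grad (\<eta> k)) (rep_aefun u) (wgrad \<Omega> u)) \<longlonglongrightarrow> 0"
    using lim by simp
  then show ?thesis using \<eta> by (intro exI[of _ \<eta>] conjI allI)
qed

text \<open>The criterion by which test functions, linear combinations and limits are recognized as members of
\<open>H\<^sup>1\<^sub>0(\<Omega>)\<close>, together with their gradients.\<close>

lemma H10_abs:
  assumes zero: "AE x in lebesgue. x \<notin> \<Omega> \<longrightarrow> f x = 0" and g: "has_weak_grad \<Omega> f g"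
    and approx: "\<And>e. e > 0 \<Longrightarrow> \<exists>\<eta>\<in>test_functions \<Omega>. sq_dist \<eta> (grad \<eta>) f g < e"
  shows "abs_aefun f \<in> H10 \<Omega>" "AE x in M. wgrad \<Omega> (abs_aefun f) x = g x"
proof -
  define u where "u = abs_aefun f"
  have ae: "AE x in lebesgue. f x = rep_aefun u x" using rep_abs_aefun[of f] unfolding u_def by eventually_elim simp
  have wg: "has_weak_grad \<Omega> (rep_aefun u) g" by (rule weak_grad_cong_AE[OF g ae])
  have "\<exists>\<eta>\<in>test_functions \<Omega>. sq_dist \<eta> (grad \<eta>) f g < inverse (real (Suc k))" for k
    by (rule approx) simp
  then obtain \<eta> where \<eta>: "\<And>k. \<eta> k \<in> test_functions \<Omega>" "\<And>k. sq_dist (\<eta> k) (grad (\<eta> k)) f g < inverse (real (Suc k))"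
    by metis
  have eq: "sq_dist (\<eta> k) (grad (\<eta> k)) f g = sq_dist (\<eta> k) (grad (\<eta> k)) (rep_aefun u) g" for k
    by (rule sq_dist_cong[OF l2_test(1,2)[OF \<eta>(1)] has_weak_gradD(1,2)[OF g] has_weak_gradD(1,2)[OF wg] AE_M[OF ae]]) simp
  have "(\<lambda>k. sq_dist (\<eta> k) (grad (\<eta> k)) (rep_aefun u) g) \<longlonglongrightarrow> 0"
  proof (rule tendsto_sandwich[OF _ _ tendsto_const LIMSEQ_inverse_real_of_nat])
    show "\<forall>\<^sub>F k in sequentially. 0 \<le> sq_dist (\<eta> k) (grad (\<eta> k)) (rep_aefun u) g"
      by (simp add: sq_dist_def)
    show "\<forall>\<^sub>F k in sequentially. sq_dist (\<eta> k) (grad (\<eta> k)) (rep_aefun u) g \<le> inverse (real (Suc k))"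
      using less_imp_le[OF \<eta>(2)] unfolding eq by simp
  qed
  moreover have "AE x in lebesgue. x \<notin> \<Omega> \<longrightarrow> rep_aefun u x = 0" using zero ae by eventually_elim simp
  ultimately have "u \<in> H10 \<Omega>" unfolding H10_def sq_dist_def using wg \<eta>(1) by blast
  then show "abs_aefun f \<in> H10 \<Omega>" unfolding u_def .
  have "AE x in M. wgrad \<Omega> u x = g x"
    by (rule weak_grad_unique[OF H10_grad[OF \<open>u \<in> H10 \<Omega>\<close>] wg]) simp
  then show "AE x in M. wgrad \<Omega> (abs_aefun f) x = g x" unfolding u_def .
qed

lemma H10_approx:
  assumes u: "u \<in> H10 \<Omega>" and e: "e > 0"
  shows "\<exists>\<eta>\<in>test_functions \<Omega>. sq_dist \<eta> (grad \<eta>) (rep_aefun u) (wgrad \<Omega> u) < e"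
proof -
  obtain \<eta> where \<eta>: "\<forall>k::nat. \<eta> k \<in> test_functions \<Omega>"
    and lim: "(\<lambda>k. sq_dist (\<eta> k) (grad (\<eta> k)) (rep_aefun u) (wgrad \<Omega> u)) \<longlonglongrightarrow> 0"
    using H10_sequence[OF u] by blast
  have "\<forall>\<^sub>F k in sequentially. sq_dist (\<eta> k) (grad (\<eta> k)) (rep_aefun u) (wgrad \<Omega> u) < e"
    using order_tendstoD(2)[OF lim e] .
  then obtain k where "sq_dist (\<eta> k) (grad (\<eta> k)) (rep_aefun u) (wgrad \<Omega> u) < e"
    unfolding eventually_sequentially by blast
  then show ?thesis using \<eta> by blast
qed

lemma H10_test_sequence:
  assumes u: "u \<in> H10 \<Omega>"
  obtains \<eta> where "\<And>k::nat. \<eta> k \<in> test_functions \<Omega>"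
    "(\<lambda>k. LINT x|M. (norm (\<eta> k x - rep_aefun u x))\<^sup>2) \<longlonglongrightarrow> 0"
    "(\<lambda>k. LINT x|M. (norm (grad (\<eta> k) x - wgrad \<Omega> u x))\<^sup>2) \<longlonglongrightarrow> 0"
proof -
  obtain \<eta> where \<eta>: "\<forall>k::nat. \<eta> k \<in> test_functions \<Omega>"
    and lim: "(\<lambda>k. sq_dist (\<eta> k) (grad (\<eta> k)) (rep_aefun u) (wgrad \<Omega> u)) \<longlonglongrightarrow> 0"
    using H10_sequence[OF u] by blast
  show ?thesis
  proof (rule that)
    show "\<eta> k \<in> test_functions \<Omega>" for k using \<eta> by blast
    show "(\<lambda>k. LINT x|M. (norm (\<eta> k x - rep_aefun u x))\<^sup>2) \<longlonglongrightarrow> 0"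
      by (rule tendsto_sandwich[OF _ _ tendsto_const lim]) (simp_all add: sq_dist_def)
    show "(\<lambda>k. LINT x|M. (norm (grad (\<eta> k) x - wgrad \<Omega> u x))\<^sup>2) \<longlonglongrightarrow> 0"
      by (rule tendsto_sandwich[OF _ _ tendsto_const lim]) (simp_all add: sq_dist_def)
  qed
qed

lemma H10_zero: "u \<in> H10 \<Omega> \<Longrightarrow> AE x in lebesgue. x \<notin> \<Omega> \<longrightarrow> rep_aefun u x = 0"
  unfolding H10_def by blast

lemma H10_test:
  assumes \<eta>: "\<eta> \<in> test_functions \<Omega>"
  shows "abs_aefun \<eta> \<in> H10 \<Omega>" "AE x in M. wgrad \<Omega> (abs_aefun \<eta>) x = grad \<eta> x"
proof -
  have z: "AE x in lebesgue. x \<notin> \<Omega> \<longrightarrow> \<eta> x = 0"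
    using \<eta> unfolding test_functions_def by (intro AE_I2) blast
  have "\<exists>\<zeta>\<in>test_functions \<Omega>. sq_dist \<zeta> (grad \<zeta>) \<eta> (grad \<eta>) < e" if "e > 0" for e
    using that \<eta> by (intro bexI[of _ \<eta>]) (auto simp: sq_dist_def)
  note * = H10_abs[OF z test_weak_grad[OF open_\<Omega> \<eta>] this]
  show "abs_aefun \<eta> \<in> H10 \<Omega>" by (rule *(1))
  show "AE x in M. wgrad \<Omega> (abs_aefun \<eta>) x = grad \<eta> x" by (rule *(2))
qed

lemma H10_lincomb:
  assumes u: "u \<in> H10 \<Omega>" and v: "v \<in> H10 \<Omega>"
  shows "u + c *\<^sub>R v \<in> H10 \<Omega>" "AE x in M. wgrad \<Omega> (u + c *\<^sub>R v) x = wgrad \<Omega> u x + c *\<^sub>R wgrad \<Omega> v x"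
proof -
  define f where "f x = rep_aefun u x + c * rep_aefun v x" for x
  define g where "g x = wgrad \<Omega> u x + c *\<^sub>R wgrad \<Omega> v x" for x
  have eq: "u + c *\<^sub>R v = abs_aefun f"
  proof (rule aefun_eqI)
    show "AE x in lebesgue. rep_aefun (u + c *\<^sub>R v) x = rep_aefun (abs_aefun f) x"
      using rep_add[of u "c *\<^sub>R v"] rep_scaleR[of c v] rep_abs_aefun[of f]
      by eventually_elim (simp add: f_def)
  qed
  have z: "AE x in lebesgue. x \<notin> \<Omega> \<longrightarrow> f x = 0"
    using H10_zero[OF u] H10_zero[OF v] by eventually_elim (simp add: f_def)
  have wg: "has_weak_grad \<Omega> f g"
    unfolding f_def g_def by (rule weak_grad_lincomb[OF H10_grad[OF u] H10_grad[OF v]])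
  have "\<exists>\<eta>\<in>test_functions \<Omega>. sq_dist \<eta> (grad \<eta>) f g < e" if e: "e > 0" for e
  proof -
    (* the parallelogram inequality costs a factor 2 (1 + c^2); another factor 2 makes the final bound strict *)
    define q where "q = 1 + c\<^sup>2"
    define d where "d = e / (4 * q)"
    have q: "q > 0" unfolding q_def by (simp add: add_pos_nonneg)
    have d: "d > 0" using e q by (simp add: d_def)
    obtain \<eta> where \<eta>: "\<eta> \<in> test_functions \<Omega>" "sq_dist \<eta> (grad \<eta>) (rep_aefun u) (wgrad \<Omega> u) < d"
      using H10_approx[OF u d] by blast
    obtain \<zeta> where \<zeta>: "\<zeta> \<in> test_functions \<Omega>" "sq_dist \<zeta> (grad \<zeta>) (rep_aefun v) (wgrad \<Omega> v) < d"
      using H10_approx[OF v d] by blast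
    define \<theta> where "\<theta> x = \<eta> x + c * \<zeta> x" for x
    have \<theta>: "\<theta> \<in> test_functions \<Omega>"
      unfolding \<theta>_def by (intro test_functions_add test_functions_scale \<eta> \<zeta>)
    have sm: "smooth \<eta>" "smooth \<zeta>" using \<eta>(1) \<zeta>(1) unfolding test_functions_def by auto
    have gr: "grad \<theta> x = grad \<eta> x + c *\<^sub>R grad \<zeta> x" for x
      unfolding \<theta>_def using sm by (simp add: grad_add grad_scale smooth_mult smooth_const)
    note l = l2_test[OF \<eta>(1)] l2_test[OF \<zeta>(1)] H10_l2[OF u] H10_l2[OF v]
    have 1: "(LINT x|M. (\<theta> x - f x)\<^sup>2) \<le> 2 * (LINT x|M. (\<eta> x - rep_aefun u x)\<^sup>2) + 2 * c\<^sup>2 * (LINT x|M. (\<zeta> x - rep_aefun v x)\<^sup>2)"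
    proof -
      have "l2 M (\<lambda>x. \<eta> x - rep_aefun u x)" "l2 M (\<lambda>x. c *\<^sub>R (\<zeta> x - rep_aefun v x))"
        by (intro l2_diff l2_scale l)+
      note p = l2_parallelogram(1)[OF this]
      have "\<theta> x - f x = (\<eta> x - rep_aefun u x) + c *\<^sub>R (\<zeta> x - rep_aefun v x)" for x
        by (simp add: \<theta>_def f_def algebra_simps)
      then show ?thesis using p by (simp add: power_mult_distrib)
    qed
    have 2: "(LINT x|M. (norm (grad \<theta> x - g x))\<^sup>2)
       \<le> 2 * (LINT x|M. (norm (grad \<eta> x - wgrad \<Omega> u x))\<^sup>2) + 2 * c\<^sup>2 * (LINT x|M. (norm (grad \<zeta> x - wgrad \<Omega> v x))\<^sup>2)"
    proof -
      have "l2 M (\<lambda>x. grad \<eta> x - wgrad \<Omega> u x)" "l2 M (\<lambda>x. c *\<^sub>R (grad \<zeta> x - wgrad \<Omega> v x))"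
        by (intro l2_diff l2_scale l)+
      note p = l2_parallelogram(1)[OF this]
      have "grad \<theta> x - g x = (grad \<eta> x - wgrad \<Omega> u x) + c *\<^sub>R (grad \<zeta> x - wgrad \<Omega> v x)" for x
        by (simp add: gr g_def scaleR_diff_right)
      then show ?thesis using p by (simp add: power_mult_distrib)
    qed
    have "sq_dist \<theta> (grad \<theta>) f g
       \<le> 2 * sq_dist \<eta> (grad \<eta>) (rep_aefun u) (wgrad \<Omega> u) + 2 * c\<^sup>2 * sq_dist \<zeta> (grad \<zeta>) (rep_aefun v) (wgrad \<Omega> v)"
      using 1 2 unfolding sq_dist_def by (simp add: algebra_simps)
    also have "\<dots> \<le> 2 * d + 2 * c\<^sup>2 * d"
      using \<eta>(2) \<zeta>(2) by (intro add_mono mult_left_mono) auto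
    also have "\<dots> = 2 * q * d" by (simp add: q_def algebra_simps)
    also have "\<dots> = e / 2" using q by (simp add: d_def)
    also have "\<dots> < e" using e by simp
    finally show ?thesis using \<theta> by blast
  qed
  note * = H10_abs[OF z wg this]
  show "u + c *\<^sub>R v \<in> H10 \<Omega>" unfolding eq by (rule *(1))
  show "AE x in M. wgrad \<Omega> (u + c *\<^sub>R v) x = wgrad \<Omega> u x + c *\<^sub>R wgrad \<Omega> v x"
    unfolding eq g_def[symmetric] by (rule *(2))
qed

lemma H10_0: "0 \<in> H10 \<Omega>"
proof -
  have "abs_aefun (\<lambda>x. 0) \<in> H10 \<Omega>" by (rule H10_test(1)[OF test_functions_0])
  then show ?thesis by (simp add: zero_aefun_def map_fun_def)
qed

lemma subspace_H10: "subspace (H10 \<Omega>)"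
proof (rule subspaceI)
  show "u + v \<in> H10 \<Omega>" if "u \<in> H10 \<Omega>" "v \<in> H10 \<Omega>" for u v
    using H10_lincomb(1)[OF that, of 1] by simp
  show "c *\<^sub>R u \<in> H10 \<Omega>" if "u \<in> H10 \<Omega>" for c u
    using H10_lincomb(1)[OF H10_0 that, of c] by simp
qed (rule H10_0)

lemma wgrad_add: "u \<in> H10 \<Omega> \<Longrightarrow> v \<in> H10 \<Omega> \<Longrightarrow> AE x in M. wgrad \<Omega> (u + v) x = wgrad \<Omega> u x + wgrad \<Omega> v x"
  using H10_lincomb(2)[of u v 1] by simp

lemma wgrad_scaleR: 
  assumes u: "u \<in> H10 \<Omega>"
  shows "AE x in M. wgrad \<Omega> (c *\<^sub>R u) x = c *\<^sub>R wgrad \<Omega> u x"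
proof -
  have "AE x in M. wgrad \<Omega> (u + (c - 1) *\<^sub>R u) x = wgrad \<Omega> u x + (c - 1) *\<^sub>R wgrad \<Omega> u x"
    by (rule H10_lincomb(2)[OF u u])
  moreover have "u + (c - 1) *\<^sub>R u = c *\<^sub>R u" by (simp add: algebra_simps)
  ultimately show ?thesis by (simp add: algebra_simps)
qed

lemma rep_diff_M: "AE x in M. rep_aefun (u - v) x = rep_aefun u x - rep_aefun v x"
  using AE_M[OF rep_add[of u "(-1) *\<^sub>R v"]] AE_M[OF rep_scaleR[of "-1" v]] by eventually_elim simp

lemma wgrad_diff:
  assumes "u \<in> H10 \<Omega>" "v \<in> H10 \<Omega>"
  shows "AE x in M. wgrad \<Omega> (u - v) x = wgrad \<Omega> u x - wgrad \<Omega> v x"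
  using H10_lincomb(2)[OF assms, of "-1"] by simp

end

section \<open>The quadratic forms of the problem on the Sobolev space\<close>

context bounded_open_set
begin

definition L2_form :: "'a aefun \<Rightarrow> 'a aefun \<Rightarrow> real" where
  "L2_form u v = (LINT x|M. rep_aefun u x * rep_aefun v x)"

definition grad_form :: "'a aefun \<Rightarrow> 'a aefun \<Rightarrow> real" where
  "grad_form u v = (LINT x|M. wgrad \<Omega> u x \<bullet> wgrad \<Omega> v x)"

definition potential_form :: "('a \<Rightarrow> real) \<Rightarrow> 'a aefun \<Rightarrow> 'a aefun \<Rightarrow> real" where
  "potential_form c u v = (LINT x|M. c x * (rep_aefun u x * rep_aefun v x))"

lemma bounded_mult_integrable:
  fixes c f :: "'a \<Rightarrow> real"
  assumes f: "integrable M f" and c: "c \<in> borel_measurable M" "AE x in M. \<bar>c x\<bar> \<le> K"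
  shows "integrable M (\<lambda>x. c x * f x)"
proof (rule Bochner_Integration.integrable_bound)
  show "integrable M (\<lambda>x. K * \<bar>f x\<bar>)" using f by simp
  show "(\<lambda>x. c x * f x) \<in> borel_measurable M" using c(1) f by simp
  show "AE x in M. norm (c x * f x) \<le> norm (K * \<bar>f x\<bar>)" using c(2)
  proof eventually_elim
    case (elim x)
    then have "\<bar>c x\<bar> * \<bar>f x\<bar> \<le> \<bar>K\<bar> * \<bar>f x\<bar>" by (intro mult_right_mono) auto
    then show ?case by (simp add: abs_mult)
  qed
qed

lemma linear_on_integral:
  fixes T :: "'a aefun \<Rightarrow> 'a \<Rightarrow> 'b::euclidean_space"
  assumes T: "\<And>u. u \<in> H10 \<Omega> \<Longrightarrow> l2 M (T u)"
    and add: "\<And>u v. u \<in> H10 \<Omega> \<Longrightarrow> v \<in> H10 \<Omega> \<Longrightarrow> AE x in M. T (u + v) x = T u x + T v x"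
    and scale: "\<And>u r. u \<in> H10 \<Omega> \<Longrightarrow> AE x in M. T (r *\<^sub>R u) x = r *\<^sub>R T u x"
    and h: "l2 M h"
  shows "linear_on (H10 \<Omega>) (\<lambda>u. LINT x|M. T u x \<bullet> h x)"
  unfolding linear_on_def
proof (intro conjI ballI allI)
  have int: "integrable M (\<lambda>x. T u x \<bullet> h x)" if "u \<in> H10 \<Omega>" for u
    by (rule l2_inner_integrable[OF T[OF that] h])
  note meas = borel_measurable_integrable[OF int]
  fix u assume u: "u \<in> H10 \<Omega>"
  show "(LINT x|M. T (u + v) x \<bullet> h x) = (LINT x|M. T u x \<bullet> h x) + (LINT x|M. T v x \<bullet> h x)"
    if v: "v \<in> H10 \<Omega>" for v
  proof -
    have "(LINT x|M. T (u + v) x \<bullet> h x) = (LINT x|M. T u x \<bullet> h x + T v x \<bullet> h x)"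
    proof (rule integral_cong_AE[OF meas])
      show "u + v \<in> H10 \<Omega>" by (rule subspace_add[OF subspace_H10 u v])
      show "(\<lambda>x. T u x \<bullet> h x + T v x \<bullet> h x) \<in> borel_measurable M" by (intro borel_measurable_add meas u v)
      show "AE x in M. T (u + v) x \<bullet> h x = T u x \<bullet> h x + T v x \<bullet> h x"
        using add[OF u v] by eventually_elim (simp add: inner_add_left)
    qed
    then show ?thesis using Bochner_Integration.integral_add[OF int[OF u] int[OF v]] by simp
  qed
  show "(LINT x|M. T (r *\<^sub>R u) x \<bullet> h x) = r * (LINT x|M. T u x \<bullet> h x)" for r
  proof -
    have "(LINT x|M. T (r *\<^sub>R u) x \<bullet> h x) = (LINT x|M. r * (T u x \<bullet> h x))"
    proof (rule integral_cong_AE[OF meas])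
      show "r *\<^sub>R u \<in> H10 \<Omega>" by (rule subspace_scale[OF subspace_H10 u])
      show "(\<lambda>x. r * (T u x \<bullet> h x)) \<in> borel_measurable M"
        by (intro borel_measurable_times borel_measurable_const meas u)
      show "AE x in M. T (r *\<^sub>R u) x \<bullet> h x = r * (T u x \<bullet> h x)"
        using scale[OF u, of r] by eventually_elim simp
    qed
    then show ?thesis by simp
  qed
qed

lemma weighted_form:
  fixes T :: "'a aefun \<Rightarrow> 'a \<Rightarrow> 'b::euclidean_space" and c :: "'a \<Rightarrow> real"
  assumes T: "\<And>u. u \<in> H10 \<Omega> \<Longrightarrow> l2 M (T u)"
    and add: "\<And>u v. u \<in> H10 \<Omega> \<Longrightarrow> v \<in> H10 \<Omega> \<Longrightarrow> AE x in M. T (u + v) x = T u x + T v x"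
    and scale: "\<And>u r. u \<in> H10 \<Omega> \<Longrightarrow> AE x in M. T (r *\<^sub>R u) x = r *\<^sub>R T u x"
    and c: "c \<in> borel_measurable M" "AE x in M. \<bar>c x\<bar> \<le> K"
  shows "sym_bilinear_on (H10 \<Omega>) (\<lambda>u v. LINT x|M. c x * (T u x \<bullet> T v x))"
proof -
  have "linear_on (H10 \<Omega>) (\<lambda>v. LINT x|M. c x * (T u x \<bullet> T v x))" if u: "u \<in> H10 \<Omega>" for u
    using linear_on_integral[of T, OF T add scale l2_bounded_scaleR[OF T[OF u] c]]
    by (simp add: inner_commute)
  then show ?thesis unfolding sym_bilinear_on_def by (simp add: inner_commute)
qed

lemma rep_add_M: "AE x in M. rep_aefun (u + v) x = rep_aefun u x + rep_aefun v x"
  by (rule AE_M[OF rep_add])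

lemma rep_scaleR_M: "AE x in M. rep_aefun (r *\<^sub>R u) x = r *\<^sub>R rep_aefun u x"
  using AE_M[OF rep_scaleR] by simp

lemma potential_form_bilinear:
  assumes c: "c \<in> borel_measurable M" "AE x in M. \<bar>c x\<bar> \<le> K"
  shows "sym_bilinear_on (H10 \<Omega>) (potential_form c)"
  using weighted_form[of rep_aefun, OF H10_l2(1) rep_add_M rep_scaleR_M c]
  unfolding potential_form_def[abs_def] by simp

lemma L2_form_bilinear: "sym_bilinear_on (H10 \<Omega>) L2_form"
  using weighted_form[of rep_aefun "\<lambda>x. 1" 1, OF H10_l2(1) rep_add_M rep_scaleR_M]
  unfolding L2_form_def[abs_def] by simp

lemma grad_form_bilinear: "sym_bilinear_on (H10 \<Omega>) grad_form"
  using weighted_form[of "wgrad \<Omega>" "\<lambda>x. 1" 1, OF H10_l2(2) wgrad_add wgrad_scaleR]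
  unfolding grad_form_def[abs_def] by simp

lemma grad_form_nonneg: "grad_form u u \<ge> 0"
  unfolding grad_form_def by simp

lemma L2_form_pos:
  assumes u: "u \<in> H10 \<Omega>" and "u \<noteq> 0"
  shows "L2_form u u > 0"
proof (rule ccontr)
  assume "\<not> L2_form u u > 0"
  moreover have "L2_form u u \<ge> 0" unfolding L2_form_def by simp
  ultimately have "(LINT x|M. rep_aefun u x * rep_aefun u x) = 0" unfolding L2_form_def by simp
  moreover have "integrable M (\<lambda>x. rep_aefun u x * rep_aefun u x)"
    by (intro l2_mult_integrable H10_l2 u)
  ultimately have "AE x in M. rep_aefun u x * rep_aefun u x = 0"
    by (subst (asm) integral_nonneg_eq_0_iff_AE) auto
  then have "AE x in lebesgue. x \<in> \<Omega> \<longrightarrow> rep_aefun u x * rep_aefun u x = 0"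
    unfolding AE_restrict_space_iff[OF \<Omega>_sets] .
  then have "AE x in lebesgue. rep_aefun u x = rep_aefun 0 x"
    using H10_zero[OF u] rep_0 by eventually_elim auto
  then have "u = 0" by (rule aefun_eqI)
  with assms show False by simp
qed

lemma potential_form_bound:
  assumes c: "c \<in> borel_measurable M" "AE x in M. \<bar>c x\<bar> \<le> K" and u: "u \<in> H10 \<Omega>"
  shows "\<bar>potential_form c u u\<bar> \<le> K * L2_form u u"
proof -
  have i: "integrable M (\<lambda>x. rep_aefun u x * rep_aefun u x)" by (intro l2_mult_integrable H10_l2 u)
  have ic: "integrable M (\<lambda>x. c x * (rep_aefun u x * rep_aefun u x))" by (rule bounded_mult_integrable[OF i c])
  have "\<bar>potential_form c u u\<bar> \<le> (LINT x|M. \<bar>c x * (rep_aefun u x * rep_aefun u x)\<bar>)"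
    unfolding potential_form_def by (rule integral_abs_bound)
  also have "\<dots> \<le> (LINT x|M. K * (rep_aefun u x * rep_aefun u x))"
  proof (rule integral_mono_AE)
    show "integrable M (\<lambda>x. \<bar>c x * (rep_aefun u x * rep_aefun u x)\<bar>)" using ic by simp
    show "integrable M (\<lambda>x. K * (rep_aefun u x * rep_aefun u x))" using i by simp
    show "AE x in M. \<bar>c x * (rep_aefun u x * rep_aefun u x)\<bar> \<le> K * (rep_aefun u x * rep_aefun u x)"
      using c(2) by eventually_elim (simp add: abs_mult mult_right_mono)
  qed
  finally show ?thesis using i by (simp add: L2_form_def)
qed

lemma form_diff_eq_sq_dist:
  assumes u: "u \<in> H10 \<Omega>" and v: "v \<in> H10 \<Omega>"
  shows "grad_form (u - v) (u - v) + L2_form (u - v) (u - v)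
    = sq_dist (rep_aefun u) (wgrad \<Omega> u) (rep_aefun v) (wgrad \<Omega> v)"
proof -
  have uv: "u - v \<in> H10 \<Omega>" by (rule subspace_diff[OF subspace_H10 u v])
  have m: "(\<lambda>x. rep_aefun u x - rep_aefun v x) \<in> borel_measurable M" "(\<lambda>x. wgrad \<Omega> u x - wgrad \<Omega> v x) \<in> borel_measurable M"
    "rep_aefun (u - v) \<in> borel_measurable M" "wgrad \<Omega> (u - v) \<in> borel_measurable M"
    using l2_measurable[OF l2_diff[OF H10_l2(1)[OF u] H10_l2(1)[OF v]]]
      l2_measurable[OF l2_diff[OF H10_l2(2)[OF u] H10_l2(2)[OF v]]] l2_measurable[OF H10_l2(1)[OF uv]]
      l2_measurable[OF H10_l2(2)[OF uv]] by simp_all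
  have "grad_form (u - v) (u - v) = (LINT x|M. (norm (wgrad \<Omega> u x - wgrad \<Omega> v x))\<^sup>2)"
    unfolding grad_form_def
  proof (rule integral_cong_AE)
    show "AE x in M. wgrad \<Omega> (u - v) x \<bullet> wgrad \<Omega> (u - v) x = (norm (wgrad \<Omega> u x - wgrad \<Omega> v x))\<^sup>2"
      using wgrad_diff[OF u v] by eventually_elim (simp add: power2_norm_eq_inner)
  qed (use m in simp_all)
  moreover have "L2_form (u - v) (u - v) = (LINT x|M. (rep_aefun u x - rep_aefun v x)\<^sup>2)"
    unfolding L2_form_def
  proof (rule integral_cong_AE)
    show "AE x in M. rep_aefun (u - v) x * rep_aefun (u - v) x = (rep_aefun u x - rep_aefun v x)\<^sup>2"
      using rep_diff_M[of u v] by eventually_elim (simp add: power2_eq_square)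
  qed (use m in simp_all)
  ultimately show ?thesis unfolding sq_dist_def by simp
qed

text \<open>The functions and their gradients have limits in \<open>L\<^sup>2(\<Omega>)\<close>. The relation defining weak gradients passes to
the limit, and test functions close to a late member of the sequence are close to the limit.\<close>

lemma H10_complete:
  assumes w: "\<And>n. w n \<in> H10 \<Omega>"
    and Cauchy: "\<And>e. e > 0 \<Longrightarrow> \<exists>N. \<forall>m\<ge>N. \<forall>n\<ge>N. grad_form (w m - w n) (w m - w n) + L2_form (w m - w n) (w m - w n) < e"
  shows "\<exists>u\<in>H10 \<Omega>. (\<lambda>n. grad_form (w n - u) (w n - u) + L2_form (w n - u) (w n - u)) \<longlonglongrightarrow> 0"
proof -
  define f where "f n = rep_aefun (w n)" for n
  define g where "g n = wgrad \<Omega> (w n)" for n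
  have fl: "l2 M (f n)" "l2 M (g n)" for n unfolding f_def g_def using H10_l2[OF w] by auto
  have C: "\<exists>N. \<forall>m\<ge>N. \<forall>n\<ge>N. sq_dist (f m) (g m) (f n) (g n) < e" if "e > 0" for e
    using Cauchy[OF that] unfolding form_diff_eq_sq_dist[OF w w] f_def g_def .
  have RF: "\<exists>F. l2 M F \<and> (\<lambda>n. LINT x|M. (norm (k n x - F x))\<^sup>2) \<longlonglongrightarrow> 0"
    if k: "\<And>n. l2 M (k n)"
      and le: "\<And>m n. (LINT x|M. (norm (k m x - k n x))\<^sup>2) \<le> sq_dist (f m) (g m) (f n) (g n)"
    for k :: "nat \<Rightarrow> 'a \<Rightarrow> 'c::euclidean_space"
  proof (rule Riesz_Fischer_l2[OF k])
    fix e :: real assume "e > 0"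
    then obtain N where "\<forall>m\<ge>N. \<forall>n\<ge>N. sq_dist (f m) (g m) (f n) (g n) < e" using C by blast
    then have "\<forall>m\<ge>N. \<forall>n\<ge>N. (LINT x|M. (norm (k m x - k n x))\<^sup>2) < e" using le by (meson le_less_trans)
    then show "\<exists>N. \<forall>m\<ge>N. \<forall>n\<ge>N. (LINT x|M. (norm (k m x - k n x))\<^sup>2) < e" by blast
  qed
  have "\<exists>F. l2 M F \<and> (\<lambda>n. LINT x|M. (norm (f n x - F x))\<^sup>2) \<longlonglongrightarrow> 0"
    by (rule RF[of f, OF fl(1)]) (simp add: sq_dist_def)
  then obtain F0 where F0: "l2 M F0" "(\<lambda>n. LINT x|M. (norm (f n x - F0 x))\<^sup>2) \<longlonglongrightarrow> 0" by blast
  have "\<exists>F. l2 M F \<and> (\<lambda>n. LINT x|M. (norm (g n x - F x))\<^sup>2) \<longlonglongrightarrow> 0"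
    by (rule RF[of g, OF fl(2)]) (simp add: sq_dist_def)
  then obtain G where G: "l2 M G" "(\<lambda>n. LINT x|M. (norm (g n x - G x))\<^sup>2) \<longlonglongrightarrow> 0" by blast
  (* members of H10 vanish outside the domain *)
  define F where "F x = (if x \<in> \<Omega> then F0 x else 0)" for x
  have FM: "F x = F0 x" if "x \<in> space M" for x using that by (simp add: F_def space_restrict_space)
  have Fl: "l2 M F"
  proof -
    have "F \<in> borel_measurable M \<longleftrightarrow> F0 \<in> borel_measurable M" by (rule measurable_cong[OF FM])
    moreover have "integrable M (\<lambda>x. (norm (F x))\<^sup>2) \<longleftrightarrow> integrable M (\<lambda>x. (norm (F0 x))\<^sup>2)"
      by (rule Bochner_Integration.integrable_cong[OF refl]) (simp add: FM)
    ultimately show ?thesis using F0(1) unfolding l2_def by blast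
  qed
  have "(LINT x|M. (norm (f n x - F x))\<^sup>2) = (LINT x|M. (norm (f n x - F0 x))\<^sup>2)" for n
    by (intro Bochner_Integration.integral_cong) (simp_all add: FM)
  then have F: "(\<lambda>n. LINT x|M. (norm (f n x - F x))\<^sup>2) \<longlonglongrightarrow> 0" using F0(2) by simp
  have sq: "(\<lambda>n. sq_dist (f n) (g n) F G) \<longlonglongrightarrow> 0"
    using tendsto_add[OF F G(2)] unfolding sq_dist_def by simp
  have wg: "has_weak_grad \<Omega> F G"
  proof -
    have "(LINT x|M. F x * pdiff b \<eta> x) = - (LINT x|M. (G x \<bullet> b) * \<eta> x)"
      if \<eta>: "\<eta> \<in> test_functions \<Omega>" and b: "b \<in> Basis" for \<eta> b
    proof -
      note L = l2_test[OF \<eta>]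
      have "(\<lambda>n. LINT x|M. f n x \<bullet> (grad \<eta> x \<bullet> b)) \<longlonglongrightarrow> (LINT x|M. F x \<bullet> (grad \<eta> x \<bullet> b))"
        by (rule l2_tendsto_inner[OF fl(1) Fl L(4) F])
      moreover have "(\<lambda>n. - (LINT x|M. g n x \<bullet> (\<eta> x *\<^sub>R b))) \<longlonglongrightarrow> - (LINT x|M. G x \<bullet> (\<eta> x *\<^sub>R b))"
        by (intro tendsto_minus l2_tendsto_inner[OF fl(2) G(1) L(5) G(2)])
      moreover have "(LINT x|M. f n x \<bullet> (grad \<eta> x \<bullet> b)) = - (LINT x|M. g n x \<bullet> (\<eta> x *\<^sub>R b))" for n
        using has_weak_gradD(3)[OF H10_grad[OF w] \<eta> b, of n] unfolding f_def g_def L(3)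
        by (simp add: mult.commute)
      ultimately have "(LINT x|M. F x \<bullet> (grad \<eta> x \<bullet> b)) = - (LINT x|M. G x \<bullet> (\<eta> x *\<^sub>R b))"
        using LIMSEQ_unique by simp
      then show ?thesis unfolding L(3) by (simp add: mult.commute)
    qed
    then show ?thesis unfolding has_weak_grad_def square_integrable_l2 using Fl G(1) by simp
  qed
  have approx: "\<exists>\<eta>\<in>test_functions \<Omega>. sq_dist \<eta> (grad \<eta>) F G < e" if e: "e > 0" for e
  proof -
    have "e / 4 > 0" using e by simp
    have "\<forall>\<^sub>F n in sequentially. sq_dist (f n) (g n) F G < e / 4"
      by (rule order_tendstoD(2)[OF sq \<open>e / 4 > 0\<close>])
    then obtain n where n: "sq_dist (f n) (g n) F G < e / 4" unfolding eventually_sequentially by blast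
    obtain \<eta> where \<eta>: "\<eta> \<in> test_functions \<Omega>" "sq_dist \<eta> (grad \<eta>) (f n) (g n) < e / 4"
      using H10_approx[OF w[of n] \<open>e / 4 > 0\<close>] unfolding f_def g_def by blast
    have "sq_dist \<eta> (grad \<eta>) F G \<le> 2 * sq_dist \<eta> (grad \<eta>) (f n) (g n) + 2 * sq_dist (f n) (g n) F G"
      by (rule sq_dist_triangle[OF l2_test(1,2)[OF \<eta>(1)] fl Fl G(1)])
    also have "\<dots> < e" using n \<eta>(2) by simp
    finally show ?thesis using \<eta>(1) by blast
  qed
  have z: "AE x in lebesgue. x \<notin> \<Omega> \<longrightarrow> F x = 0" by (simp add: F_def)
  define u where "u = abs_aefun F"
  have u: "u \<in> H10 \<Omega>" and uw: "AE x in M. wgrad \<Omega> u x = G x"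
    unfolding u_def by (rule H10_abs[OF z wg approx], assumption)+
  have "sq_dist (f n) (g n) (rep_aefun u) (wgrad \<Omega> u) = sq_dist (f n) (g n) F G" for n
    by (rule sq_dist_cong[OF fl H10_l2[OF u] Fl G(1) _ uw]) (unfold u_def, rule AE_M[OF rep_abs_aefun])
  then have "(\<lambda>n. grad_form (w n - u) (w n - u) + L2_form (w n - u) (w n - u)) \<longlonglongrightarrow> 0"
    using sq unfolding form_diff_eq_sq_dist[OF w u] f_def g_def by simp
  then show ?thesis using u by blast
qed

text \<open>All terms of the inequality for test functions are continuous with respect to convergence in
\<open>H\<^sup>1(\<Omega>)\<close>, so it extends to the closure.\<close>

lemma H10_compact:
  assumes e: "\<epsilon> > 0"
  shows "\<exists>(K::nat) l c. (\<forall>i<K. linear_on (H10 \<Omega>) (l i) \<and> (\<forall>u\<in>H10 \<Omega>. (l i u)\<^sup>2 \<le> c * L2_form u u)) \<and>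
        (\<forall>u\<in>H10 \<Omega>. L2_form u u \<le> \<epsilon> * grad_form u u + (\<Sum>i<K. (l i u)\<^sup>2))"
proof -
  interpret finite_measure M by (rule finite_measure_M)
  obtain K :: nat and Q and c :: real where Q: "\<And>i. i < K \<Longrightarrow> Q i \<in> sets borel" and
    est: "\<And>\<eta>. \<eta> \<in> test_functions \<Omega> \<Longrightarrow> (LINT x|M. (\<eta> x)\<^sup>2) \<le> \<epsilon> * (LINT x|M. (norm (grad \<eta> x))\<^sup>2)
      + (\<Sum>i<K. (c * (LINT x|M. indicator (Q i) x * \<eta> x))\<^sup>2)"
    using Rellich_inequality[OF open_\<Omega> bounded_\<Omega> e] by blast
  define l where "l i u = c * (LINT x|M. rep_aefun u x \<bullet> indicator (Q i) x)" for i u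
  define b where "b = c\<^sup>2 * (\<Sum>i<K. LINT x|M. (norm (indicator (Q i) x :: real))\<^sup>2)"
  have lin: "linear_on (H10 \<Omega>) (l i)" if i: "i < K" for i
    using linear_on_integral[of rep_aefun, OF H10_l2(1) rep_add_M rep_scaleR_M l2_indicator[OF Q[OF i]]]
    unfolding linear_on_def l_def by (simp add: distrib_left)
  have bd: "(l i u)\<^sup>2 \<le> b * L2_form u u" if i: "i < K" and u: "u \<in> H10 \<Omega>" for i u
  proof -
    have "(l i u)\<^sup>2 = c\<^sup>2 * (LINT x|M. rep_aefun u x \<bullet> indicator (Q i) x)\<^sup>2" unfolding l_def by (rule power_mult_distrib)
    also have "\<dots> \<le> c\<^sup>2 * ((LINT x|M. (norm (rep_aefun u x))\<^sup>2) * (LINT x|M. (norm (indicator (Q i) x :: real))\<^sup>2))"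
      by (intro mult_left_mono l2_inner_Cauchy_Schwarz H10_l2(1)[OF u] l2_indicator[OF Q[OF i]]) simp
    also have "\<dots> \<le> c\<^sup>2 * ((LINT x|M. (norm (rep_aefun u x))\<^sup>2) * (\<Sum>i<K. LINT x|M. (norm (indicator (Q i) x :: real))\<^sup>2))"
      using i by (intro mult_left_mono member_le_sum) auto
    also have "\<dots> = b * L2_form u u" unfolding b_def L2_form_def by (simp add: power2_eq_square)
    finally show ?thesis .
  qed
  have est': "L2_form u u \<le> \<epsilon> * grad_form u u + (\<Sum>i<K. (l i u)\<^sup>2)" if u: "u \<in> H10 \<Omega>" for u
  proof -
    obtain \<eta> where \<eta>: "\<And>k::nat. \<eta> k \<in> test_functions \<Omega>"
      and lim1: "(\<lambda>k. LINT x|M. (norm (\<eta> k x - rep_aefun u x))\<^sup>2) \<longlonglongrightarrow> 0"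
      and lim2: "(\<lambda>k. LINT x|M. (norm (grad (\<eta> k) x - wgrad \<Omega> u x))\<^sup>2) \<longlonglongrightarrow> 0"
      using H10_test_sequence[OF u] by blast
    have T: "l2 M (\<eta> k)" "l2 M (grad (\<eta> k))" for k by (rule l2_test[OF \<eta>])+
    have a1: "(\<lambda>k. LINT x|M. (norm (\<eta> k x))\<^sup>2) \<longlonglongrightarrow> (LINT x|M. (norm (rep_aefun u x))\<^sup>2)"
      by (rule l2_tendsto_norm[OF T(1) H10_l2(1)[OF u] lim1])
    have a2: "(\<lambda>k. LINT x|M. (norm (grad (\<eta> k) x))\<^sup>2) \<longlonglongrightarrow> (LINT x|M. (norm (wgrad \<Omega> u x))\<^sup>2)"
      by (rule l2_tendsto_norm[OF T(2) H10_l2(2)[OF u] lim2])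
    have a3: "(\<lambda>k. \<Sum>i<K. (c * (LINT x|M. \<eta> k x \<bullet> indicator (Q i) x))\<^sup>2) \<longlonglongrightarrow> (\<Sum>i<K. (l i u)\<^sup>2)"
      unfolding l_def
    proof (intro tendsto_sum tendsto_power tendsto_mult tendsto_const)
      fix i assume "i \<in> {..<K}"
      then show "(\<lambda>k. LINT x|M. \<eta> k x \<bullet> indicator (Q i) x) \<longlonglongrightarrow> (LINT x|M. rep_aefun u x \<bullet> indicator (Q i) x)"
        using l2_tendsto_inner[OF T(1) H10_l2(1)[OF u] l2_indicator[OF Q] lim1] by simp
    qed
    have a4: "(\<lambda>k. \<epsilon> * (LINT x|M. (norm (grad (\<eta> k) x))\<^sup>2) + (\<Sum>i<K. (c * (LINT x|M. \<eta> k x \<bullet> indicator (Q i) x))\<^sup>2))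
        \<longlonglongrightarrow> \<epsilon> * (LINT x|M. (norm (wgrad \<Omega> u x))\<^sup>2) + (\<Sum>i<K. (l i u)\<^sup>2)"
      by (intro tendsto_add tendsto_mult tendsto_const a2 a3)
    have "(LINT x|M. (norm (rep_aefun u x))\<^sup>2) \<le> \<epsilon> * (LINT x|M. (norm (wgrad \<Omega> u x))\<^sup>2) + (\<Sum>i<K. (l i u)\<^sup>2)"
    proof (rule LIMSEQ_le[OF a1 a4])
      have "(LINT x|M. (norm (\<eta> k x))\<^sup>2) \<le> \<epsilon> * (LINT x|M. (norm (grad (\<eta> k) x))\<^sup>2) + (\<Sum>i<K. (c * (LINT x|M. \<eta> k x \<bullet> indicator (Q i) x))\<^sup>2)" for k
        using est[OF \<eta>[of k]] by (simp add: mult.commute)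
      then show "\<exists>N. \<forall>k\<ge>N. (LINT x|M. (norm (\<eta> k x))\<^sup>2) \<le> \<epsilon> * (LINT x|M. (norm (grad (\<eta> k) x))\<^sup>2) + (\<Sum>i<K. (c * (LINT x|M. \<eta> k x \<bullet> indicator (Q i) x))\<^sup>2)"
        by blast
    qed
    then show ?thesis unfolding L2_form_def grad_form_def by (simp add: power2_eq_square power2_norm_eq_inner[symmetric, unfolded power2_eq_square])
  qed
  show ?thesis
    by (intro exI[of _ K] exI[of _ l] exI[of _ b] conjI allI impI ballI lin bd est')
qed

lemma compact_form_H10:
  assumes c: "c \<in> borel_measurable M" "AE x in M. \<bar>c x\<bar> \<le> K"
  shows "compact_form (H10 \<Omega>) grad_form L2_form (potential_form c) (\<bar>K\<bar> + 1)"
proof (unfold_locales)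
  show "\<bar>potential_form c u u\<bar> \<le> (\<bar>K\<bar> + 1) * L2_form u u" if "u \<in> H10 \<Omega>" for u
  proof -
    have "\<bar>potential_form c u u\<bar> \<le> K * L2_form u u" by (rule potential_form_bound[OF c that])
    also have "\<dots> \<le> (\<bar>K\<bar> + 1) * L2_form u u"
      by (intro mult_right_mono) (auto simp: L2_form_def)
    finally show ?thesis .
  qed
qed (use subspace_H10 grad_form_bilinear L2_form_bilinear potential_form_bilinear[OF c] grad_form_nonneg
    L2_form_pos H10_complete H10_compact in auto)

text \<open>By density of the test functions, weak solutions may be tested with arbitrary elements of \<open>H\<^sup>1\<^sub>0(\<Omega>)\<close>, in
particular with themselves and with other eigenfunctions.\<close>

lemma weak_dirichlet_iff:
  assumes h: "l2 M h" and f: "l2 M f"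
  shows "weak_dirichlet \<Omega> u h f \<longleftrightarrow> u \<in> H10 \<Omega> \<and>
    (\<forall>z\<in>H10 \<Omega>. grad_form u z + (LINT x|M. h x * rep_aefun z x) = (LINT x|M. f x * rep_aefun z x))"
proof
  assume w: "weak_dirichlet \<Omega> u h f"
  then have u: "u \<in> H10 \<Omega>" unfolding weak_dirichlet_def by simp
  have "grad_form u z + (LINT x|M. h x * rep_aefun z x) = (LINT x|M. f x * rep_aefun z x)"
    if z: "z \<in> H10 \<Omega>" for z
  proof -
    obtain \<eta> where \<eta>: "\<And>k::nat. \<eta> k \<in> test_functions \<Omega>"
      and lim1: "(\<lambda>k. LINT x|M. (norm (\<eta> k x - rep_aefun z x))\<^sup>2) \<longlonglongrightarrow> 0"
      and lim2: "(\<lambda>k. LINT x|M. (norm (grad (\<eta> k) x - wgrad \<Omega> z x))\<^sup>2) \<longlonglongrightarrow> 0"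
      using H10_test_sequence[OF z] by blast
    have T: "l2 M (\<eta> k)" "l2 M (grad (\<eta> k))" for k by (rule l2_test[OF \<eta>])+
    have eq: "(LINT x|M. grad (\<eta> k) x \<bullet> wgrad \<Omega> u x) + (LINT x|M. \<eta> k x \<bullet> h x) = (LINT x|M. \<eta> k x \<bullet> f x)" for k
    proof -
      have "(LINT x|M. wgrad \<Omega> u x \<bullet> grad (\<eta> k) x) + (LINT x|M. h x * \<eta> k x) = (LINT x|M. f x * \<eta> k x)"
        using w \<eta> unfolding weak_dirichlet_def by blast
      then show ?thesis by (simp add: inner_commute mult.commute)
    qed
    have "(\<lambda>k. (LINT x|M. grad (\<eta> k) x \<bullet> wgrad \<Omega> u x) + (LINT x|M. \<eta> k x \<bullet> h x))
        \<longlonglongrightarrow> (LINT x|M. wgrad \<Omega> z x \<bullet> wgrad \<Omega> u x) + (LINT x|M. rep_aefun z x \<bullet> h x)"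
      by (intro tendsto_add l2_tendsto_inner T H10_l2 u z h lim1 lim2)
    moreover have "(\<lambda>k. LINT x|M. \<eta> k x \<bullet> f x) \<longlonglongrightarrow> (LINT x|M. rep_aefun z x \<bullet> f x)"
      by (intro l2_tendsto_inner T H10_l2 z f lim1)
    ultimately have "(LINT x|M. wgrad \<Omega> z x \<bullet> wgrad \<Omega> u x) + (LINT x|M. rep_aefun z x \<bullet> h x) = (LINT x|M. rep_aefun z x \<bullet> f x)"
      unfolding eq by (rule LIMSEQ_unique)
    then show ?thesis unfolding grad_form_def by (simp add: inner_commute mult.commute)
  qed
  then show "u \<in> H10 \<Omega> \<and> (\<forall>z\<in>H10 \<Omega>. grad_form u z + (LINT x|M. h x * rep_aefun z x) = (LINT x|M. f x * rep_aefun z x))"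
    using u by simp
next
  assume r: "u \<in> H10 \<Omega> \<and> (\<forall>z\<in>H10 \<Omega>. grad_form u z + (LINT x|M. h x * rep_aefun z x) = (LINT x|M. f x * rep_aefun z x))"
  then have u: "u \<in> H10 \<Omega>" by simp
  show "weak_dirichlet \<Omega> u h f"
    unfolding weak_dirichlet_def
  proof (intro conjI ballI u)
    fix \<eta> assume \<eta>: "\<eta> \<in> test_functions \<Omega>"
    note T = l2_test(1,2)[OF \<eta>]
    show "integrable M (\<lambda>x. h x * \<eta> x)" "integrable M (\<lambda>x. f x * \<eta> x)" by (intro l2_mult_integrable h f T)+
    define z where "z = abs_aefun \<eta>"
    have z: "z \<in> H10 \<Omega>" "AE x in M. wgrad \<Omega> z x = grad \<eta> x" unfolding z_def by (rule H10_test[OF \<eta>])+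
    have rz: "AE x in M. rep_aefun z x = \<eta> x" unfolding z_def by (rule AE_M[OF rep_abs_aefun])
    have "grad_form u z = (LINT x|M. wgrad \<Omega> u x \<bullet> grad \<eta> x)"
      unfolding grad_form_def
    proof (rule integral_cong_AE)
      show "AE x in M. wgrad \<Omega> u x \<bullet> wgrad \<Omega> z x = wgrad \<Omega> u x \<bullet> grad \<eta> x" using z(2) by eventually_elim simp
    qed (use l2_measurable[OF H10_l2(2)[OF u]] l2_measurable[OF H10_l2(2)[OF z(1)]] l2_measurable[OF T(2)] in simp_all)
    moreover have "(LINT x|M. k x * rep_aefun z x) = (LINT x|M. k x * \<eta> x)" if k: "l2 M k" for k
    proof (rule integral_cong_AE)
      show "AE x in M. k x * rep_aefun z x = k x * \<eta> x" using rz by eventually_elim simp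
    qed (use l2_measurable[OF k] l2_measurable[OF H10_l2(1)[OF z(1)]] l2_measurable[OF T(1)] in simp_all)
    ultimately show "(LINT x|M. wgrad \<Omega> u x \<bullet> grad \<eta> x) + (LINT x|M. h x * \<eta> x) = (LINT x|M. f x * \<eta> x)"
      using r z(1) h f by metis
  qed
qed

end

section \<open>Measurability of the coefficients\<close>

text \<open>Rounded to multiples of \<open>1/n\<close>, the inner functions take countably many values, and the composition is
patched together from countably many measurable functions; continuity in \<open>(s, t)\<close> allows \<open>n \<rightarrow> \<infinity>\<close>.\<close>

lemma Caratheodory_composition_measurable:
  fixes F :: "'x \<Rightarrow> real \<Rightarrow> real \<Rightarrow> real"
  assumes meas: "\<And>s t. (\<lambda>x. F x s t) \<in> borel_measurable N"
    and cont: "\<And>x. x \<in> space N \<Longrightarrow> continuous_on UNIV (\<lambda>(s, t). F x s t)"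
    and u[measurable]: "u \<in> borel_measurable N" and v[measurable]: "v \<in> borel_measurable N"
  shows "(\<lambda>x. F x (u x) (v x)) \<in> borel_measurable N"
proof (rule borel_measurable_LIMSEQ_real)
  define r where "r n y = real_of_int \<lfloor>real (Suc n) * y\<rfloor> / real (Suc n)" for n and y :: real
  show "(\<lambda>x. F x (r n (u x)) (r n (v x))) \<in> borel_measurable N" for n
  proof -
    have "(\<lambda>x. F x (real_of_int i / real (Suc n)) (r n (v x))) \<in> borel_measurable N" for i
      unfolding r_def
      by (rule measurable_compose_countable[where f = "\<lambda>j x. F x (real_of_int i / real (Suc n)) (real_of_int j / real (Suc n))"
            and g = "\<lambda>x. \<lfloor>real (Suc n) * v x\<rfloor>"])
        (use meas in \<open>simp_all\<close>)
    from measurable_compose_countable[where f = "\<lambda>i x. F x (real_of_int i / real (Suc n)) (r n (v x))"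
            and g = "\<lambda>x. \<lfloor>real (Suc n) * u x\<rfloor>", OF this]
    show ?thesis unfolding r_def by simp
  qed
  fix x assume x: "x \<in> space N"
  have r: "(\<lambda>n. r n y) \<longlonglongrightarrow> y" for y
  proof (rule tendsto_sandwich)
    show "\<forall>\<^sub>F n in sequentially. y - inverse (real (Suc n)) \<le> r n y"
    proof (rule always_eventually, rule allI)
      fix n
      have "real (Suc n) * y - 1 \<le> real_of_int \<lfloor>real (Suc n) * y\<rfloor>" by linarith
      then have "(real (Suc n) * y - 1) / real (Suc n) \<le> r n y" unfolding r_def by (intro divide_right_mono) auto
      then show "y - inverse (real (Suc n)) \<le> r n y" by (simp add: diff_divide_distrib inverse_eq_divide)
    qed
    show "\<forall>\<^sub>F n in sequentially. r n y \<le> y"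
    proof (rule always_eventually, rule allI)
      fix n
      have "r n y \<le> (real (Suc n) * y) / real (Suc n)" unfolding r_def by (intro divide_right_mono) auto
      then show "r n y \<le> y" by simp
    qed
    show "(\<lambda>n. y - inverse (real (Suc n))) \<longlonglongrightarrow> y"
      using tendsto_diff[OF tendsto_const[of y] LIMSEQ_inverse_real_of_nat] by simp
  qed simp
  have "isCont (\<lambda>(s, t). F x s t) (u x, v x)"
    using cont[OF x] by (simp add: continuous_on_eq_continuous_at)
  moreover have "(\<lambda>n. (r n (u x), r n (v x))) \<longlonglongrightarrow> (u x, v x)" by (intro tendsto_Pair r)
  ultimately have "(\<lambda>n. (\<lambda>(s, t). F x s t) (r n (u x), r n (v x))) \<longlonglongrightarrow> (\<lambda>(s, t). F x s t) (u x, v x)"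
    by (rule isCont_tendsto_compose)
  then show "(\<lambda>n. F x (r n (u x)) (r n (v x))) \<longlonglongrightarrow> F x (u x) (v x)" by simp
qed

lemma Ck_on_partial_derivatives:
  fixes F :: "real \<Rightarrow> real \<Rightarrow> real"
  assumes F: "Ck_on (Suc k) UNIV (\<lambda>(s, t). F s t)"
  shows "((\<lambda>s. F s t) has_real_derivative deriv (\<lambda>s. F s t) s) (at s)"
    "((\<lambda>t. F s t) has_real_derivative deriv (\<lambda>t. F s t) t) (at t)"
    "Ck_on k UNIV (\<lambda>(s, t). deriv (\<lambda>s. F s t) s)" "Ck_on k UNIV (\<lambda>(s, t). deriv (\<lambda>t. F s t) t)"
proof -
  define f where "f = (\<lambda>(s, t). F s t)"
  have diff: "f differentiable (at p)" for p by (cases p) (use F in \<open>simp add: f_def\<close>)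
  have 1: "((\<lambda>s. F s t) has_real_derivative pdiff (1, 0) f (s, t)) (at s)" for s t
  proof -
    have "((\<lambda>s. (s, t)) has_derivative (\<lambda>h. (h, 0))) (at s)" by (intro derivative_intros)
    from has_derivative_compose[OF this has_derivative_grad[OF diff]]
    have "((\<lambda>s. F s t) has_derivative (\<lambda>h. grad f (s, t) \<bullet> (h, 0))) (at s)" by (simp add: f_def)
    moreover have "(\<lambda>h. grad f (s, t) \<bullet> (h, 0)) = (*) (grad f (s, t) \<bullet> (1, 0))"
      by (rule ext) (cases "grad f (s, t)"; simp)
    ultimately show ?thesis unfolding has_field_derivative_def pdiff_eq_grad[OF diff] by metis
  qed
  have 2: "((\<lambda>t. F s t) has_real_derivative pdiff (0, 1) f (s, t)) (at t)" for s t
  proof -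
    have "((\<lambda>t. (s, t)) has_derivative (\<lambda>h. (0, h))) (at t)" by (intro derivative_intros)
    from has_derivative_compose[OF this has_derivative_grad[OF diff]]
    have "((\<lambda>t. F s t) has_derivative (\<lambda>h. grad f (s, t) \<bullet> (0, h))) (at t)" by (simp add: f_def)
    moreover have "(\<lambda>h. grad f (s, t) \<bullet> (0, h)) = (*) (grad f (s, t) \<bullet> (0, 1))"
      by (rule ext) (cases "grad f (s, t)"; simp)
    ultimately show ?thesis unfolding has_field_derivative_def pdiff_eq_grad[OF diff] by metis
  qed
  have e1: "(\<lambda>(s, t). deriv (\<lambda>s. F s t) s) = pdiff (1, 0) f" using DERIV_imp_deriv[OF 1] by auto
  have e2: "(\<lambda>(s, t). deriv (\<lambda>t. F s t) t) = pdiff (0, 1) f" using DERIV_imp_deriv[OF 2] by auto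
  have b: "(1, 0) \<in> (Basis :: (real \<times> real) set)" "(0, 1) \<in> (Basis :: (real \<times> real) set)"
    by (simp_all add: Basis_prod_def)
  show "((\<lambda>s. F s t) has_real_derivative deriv (\<lambda>s. F s t) s) (at s)" using 1 DERIV_imp_deriv[OF 1] by simp
  show "((\<lambda>t. F s t) has_real_derivative deriv (\<lambda>t. F s t) t) (at t)" using 2 DERIV_imp_deriv[OF 2] by simp
  show "Ck_on k UNIV (\<lambda>(s, t). deriv (\<lambda>s. F s t) s)" unfolding e1 using F b(1) unfolding f_def by simp
  show "Ck_on k UNIV (\<lambda>(s, t). deriv (\<lambda>t. F s t) t)" unfolding e2 using F b(2) unfolding f_def by simp
qed

text \<open>A derivative is a pointwise limit of measurable difference quotients.\<close>

lemma measurable_derivative: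
  fixes F :: "'x \<Rightarrow> real \<Rightarrow> real"
  assumes [measurable]: "\<And>s. (\<lambda>x. F x s) \<in> borel_measurable N"
    and D: "\<And>x. x \<in> space N \<Longrightarrow> (F x has_real_derivative F' x) (at s)"
  shows "F' \<in> borel_measurable N"
proof (rule borel_measurable_LIMSEQ_real)
  define h where "h n = inverse (real (Suc n))" for n
  show "(\<lambda>x. (F x (s + h n) - F x s) / h n) \<in> borel_measurable N" for n by measurable
  fix x assume "x \<in> space N"
  have "filterlim h (at 0) sequentially"
    using LIMSEQ_inverse_real_of_nat unfolding filterlim_at h_def[abs_def] by auto
  then show "(\<lambda>n. (F x (s + h n) - F x s) / h n) \<longlonglongrightarrow> F' x"
    using D[OF \<open>x \<in> space N\<close>] unfolding DERIV_def by (rule filterlim_compose[rotated])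
qed

lemma second_derivatives_measurable:
  assumes H: "\<And>s t. (\<lambda>x. H x s t) \<in> borel_measurable N"
    and C2: "\<And>x. x \<in> space N \<Longrightarrow> Ck_on 2 UNIV (\<lambda>(s, t). H x s t)"
    and u: "rep_aefun u \<in> borel_measurable N" and v: "rep_aefun v \<in> borel_measurable N"
  shows "along (Huu H) u v \<in> borel_measurable N" "along (Hvv H) u v \<in> borel_measurable N"
    "along (Huv H) u v \<in> borel_measurable N"
proof -
  have C2': "Ck_on (Suc (Suc 0)) UNIV (\<lambda>(s, t). H x s t)" if "x \<in> space N" for x
    using C2[OF that] by (simp add: numeral_2_eq_2)
  have C1: "Ck_on (Suc 0) UNIV (\<lambda>(s, t). Du H x s t)" "Ck_on (Suc 0) UNIV (\<lambda>(s, t). Dv H x s t)"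
    if "x \<in> space N" for x
    using Ck_on_partial_derivatives(3,4)[OF C2'[OF that]] unfolding Du_def Dv_def by simp_all
  have C0: "continuous_on UNIV (\<lambda>(s, t). Huu H x s t)" "continuous_on UNIV (\<lambda>(s, t). Hvv H x s t)"
    "continuous_on UNIV (\<lambda>(s, t). Huv H x s t)" if "x \<in> space N" for x
    using Ck_on_partial_derivatives(3,4)[OF C1(1)[OF that]] Ck_on_partial_derivatives(4)[OF C1(2)[OF that]]
    by (simp_all add: Du_def[of "Du H"] Dv_def[of "Dv H"] Dv_def[of "Du H"])
  have mu: "(\<lambda>x. Du H x s t) \<in> borel_measurable N" for s t
    by (rule measurable_derivative[where F = "\<lambda>x s. H x s t" and s = s, OF H])
      (use Ck_on_partial_derivatives(1)[OF C2'] in \<open>simp add: Du_def\<close>)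
  have mv: "(\<lambda>x. Dv H x s t) \<in> borel_measurable N" for s t
    by (rule measurable_derivative[where F = "\<lambda>x t. H x s t" and s = t, OF H])
      (use Ck_on_partial_derivatives(2)[OF C2'] in \<open>simp add: Dv_def\<close>)
  have muu: "(\<lambda>x. Huu H x s t) \<in> borel_measurable N" for s t
    by (rule measurable_derivative[where F = "\<lambda>x s. Du H x s t" and s = s, OF mu])
      (use Ck_on_partial_derivatives(1)[OF C1(1)] in \<open>simp add: Du_def[of "Du H"]\<close>)
  have mvv: "(\<lambda>x. Hvv H x s t) \<in> borel_measurable N" for s t
    by (rule measurable_derivative[where F = "\<lambda>x t. Dv H x s t" and s = t, OF mv])
      (use Ck_on_partial_derivatives(2)[OF C1(2)] in \<open>simp add: Dv_def[of "Dv H"]\<close>)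
  have muv: "(\<lambda>x. Huv H x s t) \<in> borel_measurable N" for s t
    by (rule measurable_derivative[where F = "\<lambda>x t. Du H x s t" and s = t, OF mu])
      (use Ck_on_partial_derivatives(2)[OF C1(1)] in \<open>simp add: Dv_def[of "Du H"]\<close>)
  show "along (Huu H) u v \<in> borel_measurable N"
    unfolding along_def[abs_def] by (rule Caratheodory_composition_measurable[OF muu C0(1) u v])
  show "along (Hvv H) u v \<in> borel_measurable N"
    unfolding along_def[abs_def] by (rule Caratheodory_composition_measurable[OF mvv C0(2) u v])
  show "along (Huv H) u v \<in> borel_measurable N"
    unfolding along_def[abs_def] by (rule Caratheodory_composition_measurable[OF muv C0(3) u v])
qed

section \<open>Scalar eigenvalue problems\<close>

context bounded_open_set
begin

lemma potential_form_integrable: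
  assumes c: "c \<in> borel_measurable M" "AE x in M. \<bar>c x\<bar> \<le> K" and "u \<in> H10 \<Omega>" "v \<in> H10 \<Omega>"
  shows "integrable M (\<lambda>x. c x * (rep_aefun u x * rep_aefun v x))"
  by (intro bounded_mult_integrable[OF _ c] l2_mult_integrable H10_l2 assms)

lemma eigenspace_eq:
  assumes c: "c \<in> borel_measurable M" "AE x in M. \<bar>c x\<bar> \<le> K"
  shows "eigenspace \<Omega> c \<mu> = {\<phi> \<in> H10 \<Omega>. \<forall>z\<in>H10 \<Omega>. grad_form \<phi> z + potential_form c \<phi> z = \<mu> * L2_form \<phi> z}"
proof -
  have "weak_dirichlet \<Omega> \<phi> (\<lambda>x. c x * rep_aefun \<phi> x) (\<lambda>x. \<mu> * rep_aefun \<phi> x) \<longleftrightarrow>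
      \<phi> \<in> H10 \<Omega> \<and> (\<forall>z\<in>H10 \<Omega>. grad_form \<phi> z + potential_form c \<phi> z = \<mu> * L2_form \<phi> z)" for \<phi>
  proof (cases "\<phi> \<in> H10 \<Omega>")
    case True
    have 1: "l2 M (\<lambda>x. c x * rep_aefun \<phi> x)" using l2_bounded_scaleR[OF H10_l2(1)[OF True] c] by simp
    have 2: "l2 M (\<lambda>x. \<mu> * rep_aefun \<phi> x)" using l2_scale[OF H10_l2(1)[OF True], of \<mu>] by simp
    show ?thesis unfolding weak_dirichlet_iff[OF 1 2] potential_form_def L2_form_def
      by (simp add: mult.assoc)
  qed (simp add: weak_dirichlet_def)
  then show ?thesis unfolding eigenspace_def by simp
qed

lemma compact_form_eigenspaces:
  assumes c: "c \<in> borel_measurable M" "AE x in M. \<bar>c x\<bar> \<le> K"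
  shows "compact_form.eig (H10 \<Omega>) grad_form L2_form (potential_form c) \<mu> = eigenspace \<Omega> c \<mu>"
    "compact_form.neg (H10 \<Omega>) grad_form L2_form (potential_form c) = neg_eigenvalues \<Omega> c"
    "num_neg_eigenvalues \<Omega> c = enat (dim (compact_form.E (H10 \<Omega>) grad_form L2_form (potential_form c)))"
proof -
  interpret compact_form "H10 \<Omega>" grad_form L2_form "potential_form c" "\<bar>K\<bar> + 1"
    by (rule compact_form_H10[OF c])
  have e: "eig \<mu> = eigenspace \<Omega> c \<mu>" for \<mu> unfolding eig_def B_def eigenspace_eq[OF c] ..
  have n: "neg = neg_eigenvalues \<Omega> c" unfolding neg_def neg_eigenvalues_def e ..
  show "eig \<mu> = eigenspace \<Omega> c \<mu>" "neg = neg_eigenvalues \<Omega> c" by (rule e n)+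
  show "num_neg_eigenvalues \<Omega> c = enat (dim E)"
    using SUP_sum_edim_eig unfolding num_neg_eigenvalues_def e n .
qed

lemma subspace_eigenspace:
  assumes c: "c \<in> borel_measurable M" "AE x in M. \<bar>c x\<bar> \<le> K"
  shows "subspace (eigenspace \<Omega> c \<mu>)" "eigenspace \<Omega> c \<mu> \<subseteq> H10 \<Omega>"
proof -
  interpret compact_form "H10 \<Omega>" grad_form L2_form "potential_form c" "\<bar>K\<bar> + 1"
    by (rule compact_form_H10[OF c])
  show "subspace (eigenspace \<Omega> c \<mu>)" "eigenspace \<Omega> c \<mu> \<subseteq> H10 \<Omega>"
    using subspace_eig[of \<mu>] eig_subset[of \<mu>] unfolding compact_form_eigenspaces(1)[OF c] by simp_all
qed

end

section \<open>Decoupling the linearized system\<close>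

text \<open>In the application \<open>S\<close> is \<open>H\<^sub>u\<^sub>u + H\<^sub>v\<^sub>v\<close> and \<open>T\<close> is \<open>H\<^sub>u\<^sub>v\<close> along the solution.\<close>

locale coupled_system = bounded_open_set \<Omega> for \<Omega> :: "'a::euclidean_space set" +
  fixes S T :: "'a \<Rightarrow> real" and KS KT :: real
  assumes S_meas: "S \<in> borel_measurable M" and S_bound: "AE x in M. \<bar>S x\<bar> \<le> KS"
    and T_meas: "T \<in> borel_measurable M" and T_bound: "AE x in M. \<bar>T x\<bar> \<le> KT"
begin

abbreviation pot_plus :: "'a \<Rightarrow> real" where "pot_plus \<equiv> \<lambda>x. - 1/2 * S x - T x"
abbreviation pot_minus :: "'a \<Rightarrow> real" where "pot_minus \<equiv> \<lambda>x. 1/2 * S x - T x"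

lemma pot_plus: "pot_plus \<in> borel_measurable M" "AE x in M. \<bar>pot_plus x\<bar> \<le> KS + KT"
proof -
  show "pot_plus \<in> borel_measurable M" using S_meas T_meas by simp
  show "AE x in M. \<bar>pot_plus x\<bar> \<le> KS + KT" using S_bound T_bound by eventually_elim linarith
qed

lemma pot_minus: "pot_minus \<in> borel_measurable M" "AE x in M. \<bar>pot_minus x\<bar> \<le> KS + KT"
proof -
  show "pot_minus \<in> borel_measurable M" using S_meas T_meas by simp
  show "AE x in M. \<bar>pot_minus x\<bar> \<le> KS + KT" using S_bound T_bound by eventually_elim linarith
qed

lemma potential_form_split:
  assumes u: "u \<in> H10 \<Omega>" and v: "v \<in> H10 \<Omega>"
  shows "potential_form pot_plus u v = - 1/2 * potential_form S u v - potential_form T u v"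
    "potential_form pot_minus u v = 1/2 * potential_form S u v - potential_form T u v"
proof -
  note i = potential_form_integrable[OF S_meas S_bound u v] potential_form_integrable[OF T_meas T_bound u v]
  have *: "(LINT x|M. (r * S x - T x) * (rep_aefun u x * rep_aefun v x)) = r * potential_form S u v - potential_form T u v" for r
  proof -
    have "(LINT x|M. (r * S x - T x) * (rep_aefun u x * rep_aefun v x))
        = (LINT x|M. r * (S x * (rep_aefun u x * rep_aefun v x)) - T x * (rep_aefun u x * rep_aefun v x))"
      by (rule Bochner_Integration.integral_cong) (simp_all add: left_diff_distrib mult.assoc)
    also have "\<dots> = r * potential_form S u v - potential_form T u v"
      unfolding potential_form_def using i by simp
    finally show ?thesis .
  qed
  show "potential_form pot_plus u v = - 1/2 * potential_form S u v - potential_form T u v"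
    unfolding potential_form_def[of pot_plus] by (rule *)
  show "potential_form pot_minus u v = 1/2 * potential_form S u v - potential_form T u v"
    unfolding potential_form_def[of pot_minus] by (rule *)
qed

text \<open>The cross terms of the two scalar forms are \<open>- S/2 - T\<close> and, with opposite sign, \<open>S/2 - T\<close>; together they
give the coupling \<open>- S \<phi> \<psi>\<close>, while in the diagonal terms \<open>S\<close> cancels.\<close>

lemma coupled_form_decouples:
  assumes p: "\<phi> \<in> H10 \<Omega>" and q: "\<psi> \<in> H10 \<Omega>"
  shows "(LINT x|M. (norm (wgrad \<Omega> \<phi> x))\<^sup>2 + (norm (wgrad \<Omega> \<psi> x))\<^sup>2)
     - (LINT x|M. S x * (rep_aefun \<phi> x * rep_aefun \<psi> x) + T x * ((rep_aefun \<phi> x)\<^sup>2 + (rep_aefun \<psi> x)\<^sup>2))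
   = (compact_form.B grad_form (potential_form pot_plus) (\<phi> + \<psi>) (\<phi> + \<psi>)
      + compact_form.B grad_form (potential_form pot_minus) (\<phi> - \<psi>) (\<phi> - \<psi>)) / 2"
proof -
  interpret a: compact_form "H10 \<Omega>" grad_form L2_form "potential_form pot_plus" "\<bar>KS + KT\<bar> + 1"
    by (rule compact_form_H10[OF pot_plus])
  interpret b: compact_form "H10 \<Omega>" grad_form L2_form "potential_form pot_minus" "\<bar>KS + KT\<bar> + 1"
    by (rule compact_form_H10[OF pot_minus])
  have Qa: "a.B (\<phi> + \<psi>) (\<phi> + \<psi>) = a.B \<phi> \<phi> + 2 * a.B \<phi> \<psi> + a.B \<psi> \<psi>"
    using sym_bilinear_quadratic[OF a.B_form subspace_H10 p q, of 1] by simp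
  have Qb: "b.B (\<phi> - \<psi>) (\<phi> - \<psi>) = b.B \<phi> \<phi> - 2 * b.B \<phi> \<psi> + b.B \<psi> \<psi>"
    using sym_bilinear_quadratic[OF b.B_form subspace_H10 p q, of "-1"] by simp
  have 1: "(LINT x|M. (norm (wgrad \<Omega> \<phi> x))\<^sup>2 + (norm (wgrad \<Omega> \<psi> x))\<^sup>2) = grad_form \<phi> \<phi> + grad_form \<psi> \<psi>"
    unfolding grad_form_def power2_norm_eq_inner
    by (intro Bochner_Integration.integral_add l2_inner_integrable H10_l2 p q)
  have 2: "(LINT x|M. S x * (rep_aefun \<phi> x * rep_aefun \<psi> x) + T x * ((rep_aefun \<phi> x)\<^sup>2 + (rep_aefun \<psi> x)\<^sup>2))
      = potential_form S \<phi> \<psi> + potential_form T \<phi> \<phi> + potential_form T \<psi> \<psi>"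
  proof -
    note i = potential_form_integrable[OF S_meas S_bound p q] potential_form_integrable[OF T_meas T_bound p p]
      potential_form_integrable[OF T_meas T_bound q q]
    have "(LINT x|M. S x * (rep_aefun \<phi> x * rep_aefun \<psi> x) + T x * ((rep_aefun \<phi> x)\<^sup>2 + (rep_aefun \<psi> x)\<^sup>2))
      = (LINT x|M. S x * (rep_aefun \<phi> x * rep_aefun \<psi> x) + T x * (rep_aefun \<phi> x * rep_aefun \<phi> x)
          + T x * (rep_aefun \<psi> x * rep_aefun \<psi> x))"
      by (rule Bochner_Integration.integral_cong) (simp_all add: power2_eq_square distrib_left)
    also have "\<dots> = potential_form S \<phi> \<psi> + potential_form T \<phi> \<phi> + potential_form T \<psi> \<psi>"
      unfolding potential_form_def using i by simp
    finally show ?thesis .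
  qed
  show ?thesis unfolding 1 2 Qa Qb
    unfolding a.B_def b.B_def
    unfolding potential_form_split[OF p p] potential_form_split[OF p q] potential_form_split[OF q q] by simp
qed

text \<open>The scalar problems are the sum and the difference of the two equations, tested with the same
function.\<close>

lemma coupled_eigenfunction_iff:
  "weak_dirichlet \<Omega> \<phi> (\<lambda>x. - T x * rep_aefun \<phi> x - 1/2 * S x * rep_aefun \<psi> x) (\<lambda>x. \<Lambda> * rep_aefun \<phi> x)
   \<and> weak_dirichlet \<Omega> \<psi> (\<lambda>x. - 1/2 * S x * rep_aefun \<phi> x - T x * rep_aefun \<psi> x) (\<lambda>x. \<Lambda> * rep_aefun \<psi> x)
   \<longleftrightarrow> \<phi> + \<psi> \<in> eigenspace \<Omega> pot_plus \<Lambda> \<and> \<phi> - \<psi> \<in> eigenspace \<Omega> pot_minus \<Lambda>"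
  (is "?L \<longleftrightarrow> ?R")
proof (cases "\<phi> \<in> H10 \<Omega> \<and> \<psi> \<in> H10 \<Omega>")
  case False
  have "\<not> ?L" using False unfolding weak_dirichlet_def by blast
  moreover have "\<not> ?R"
  proof
    assume R: ?R
    have H: "\<phi> + \<psi> \<in> H10 \<Omega>" "\<phi> - \<psi> \<in> H10 \<Omega>"
      using R subspace_eigenspace(2)[OF pot_plus, of \<Lambda>] subspace_eigenspace(2)[OF pot_minus, of \<Lambda>] by blast+
    have "(1/2) *\<^sub>R ((\<phi> + \<psi>) + (\<phi> - \<psi>)) \<in> H10 \<Omega>" "(1/2) *\<^sub>R ((\<phi> + \<psi>) - (\<phi> - \<psi>)) \<in> H10 \<Omega>"
      using subspace_scale[OF subspace_H10 subspace_add[OF subspace_H10 H], of "1/2"]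
        subspace_scale[OF subspace_H10 subspace_diff[OF subspace_H10 H], of "1/2"] by blast+
    moreover have "(1/2) *\<^sub>R ((\<phi> + \<psi>) + (\<phi> - \<psi>)) = \<phi>" "(1/2) *\<^sub>R ((\<phi> + \<psi>) - (\<phi> - \<psi>)) = \<psi>"
      by (simp_all add: scaleR_2[symmetric] del: scaleR_2)
    ultimately show False using False by metis
  qed
  ultimately show ?thesis by blast
next
  case True
  then have p: "\<phi> \<in> H10 \<Omega>" and q: "\<psi> \<in> H10 \<Omega>" by auto
  have pq: "\<phi> + \<psi> \<in> H10 \<Omega>" "\<phi> - \<psi> \<in> H10 \<Omega>"
    by (rule subspace_add[OF subspace_H10 p q] subspace_diff[OF subspace_H10 p q])+
  note Sl = l2_bounded_scaleR[OF H10_l2(1) S_meas S_bound] and Tl = l2_bounded_scaleR[OF H10_l2(1) T_meas T_bound]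
  have l1: "l2 M (\<lambda>x. - T x * rep_aefun \<phi> x - 1/2 * S x * rep_aefun \<psi> x)"
    using l2_diff[OF l2_scale[OF Tl[OF p], of "-1"] l2_scale[OF Sl[OF q], of "1/2"]] by (simp add: mult.assoc)
  have l2': "l2 M (\<lambda>x. - 1/2 * S x * rep_aefun \<phi> x - T x * rep_aefun \<psi> x)"
    using l2_diff[OF l2_scale[OF Sl[OF p], of "-1/2"] Tl[OF q]] by (simp add: mult.assoc)
  have l3: "l2 M (\<lambda>x. \<Lambda> * rep_aefun \<phi> x)" "l2 M (\<lambda>x. \<Lambda> * rep_aefun \<psi> x)"
    using l2_scale[OF H10_l2(1)[OF p], of \<Lambda>] l2_scale[OF H10_l2(1)[OF q], of \<Lambda>] by simp_all
  have L3: "(LINT x|M. \<Lambda> * rep_aefun \<phi> x * rep_aefun z x) = \<Lambda> * L2_form \<phi> z"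
    "(LINT x|M. \<Lambda> * rep_aefun \<psi> x * rep_aefun z x) = \<Lambda> * L2_form \<psi> z" for z
    unfolding L2_form_def by (simp_all add: mult.assoc)
  have L1: "(LINT x|M. (- T x * rep_aefun \<phi> x - 1/2 * S x * rep_aefun \<psi> x) * rep_aefun z x)
      = - potential_form T \<phi> z - 1/2 * potential_form S \<psi> z" if z: "z \<in> H10 \<Omega>" for z
  proof -
    have "(LINT x|M. (- T x * rep_aefun \<phi> x - 1/2 * S x * rep_aefun \<psi> x) * rep_aefun z x)
      = (LINT x|M. (-1) * (T x * (rep_aefun \<phi> x * rep_aefun z x)) - 1/2 * (S x * (rep_aefun \<psi> x * rep_aefun z x)))"
      by (rule Bochner_Integration.integral_cong) (simp_all add: left_diff_distrib mult.assoc)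
    also have "\<dots> = (-1) * potential_form T \<phi> z - 1/2 * potential_form S \<psi> z"
      unfolding potential_form_def
      by (simp only: Bochner_Integration.integral_diff integrable_mult_right integral_mult_right_zero
          potential_form_integrable[OF T_meas T_bound p z] potential_form_integrable[OF S_meas S_bound q z])
    finally show ?thesis by simp
  qed
  have L2: "(LINT x|M. (- 1/2 * S x * rep_aefun \<phi> x - T x * rep_aefun \<psi> x) * rep_aefun z x)
      = - 1/2 * potential_form S \<phi> z - potential_form T \<psi> z" if z: "z \<in> H10 \<Omega>" for z
  proof -
    have "(LINT x|M. (- 1/2 * S x * rep_aefun \<phi> x - T x * rep_aefun \<psi> x) * rep_aefun z x)
      = (LINT x|M. (-1/2) * (S x * (rep_aefun \<phi> x * rep_aefun z x)) - T x * (rep_aefun \<psi> x * rep_aefun z x))"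
      by (rule Bochner_Integration.integral_cong) (simp_all add: left_diff_distrib mult.assoc)
    also have "\<dots> = (-1/2) * potential_form S \<phi> z - potential_form T \<psi> z"
      unfolding potential_form_def
      by (simp only: Bochner_Integration.integral_diff integrable_mult_right integral_mult_right_zero
          potential_form_integrable[OF S_meas S_bound p z] potential_form_integrable[OF T_meas T_bound q z])
    finally show ?thesis by simp
  qed
  have L: "?L \<longleftrightarrow> (\<forall>z\<in>H10 \<Omega>.
      grad_form \<phi> z - potential_form T \<phi> z - 1/2 * potential_form S \<psi> z = \<Lambda> * L2_form \<phi> z
    \<and> grad_form \<psi> z - 1/2 * potential_form S \<phi> z - potential_form T \<psi> z = \<Lambda> * L2_form \<psi> z)"
    unfolding weak_dirichlet_iff[OF l1 l3(1)] weak_dirichlet_iff[OF l2' l3(2)] L3 using p q L1 L2 by auto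
  have R: "?R \<longleftrightarrow> (\<forall>z\<in>H10 \<Omega>.
      grad_form (\<phi> + \<psi>) z + potential_form pot_plus (\<phi> + \<psi>) z = \<Lambda> * L2_form (\<phi> + \<psi>) z
    \<and> grad_form (\<phi> - \<psi>) z + potential_form pot_minus (\<phi> - \<psi>) z = \<Lambda> * L2_form (\<phi> - \<psi>) z)"
    unfolding eigenspace_eq[OF pot_plus] eigenspace_eq[OF pot_minus] using pq by auto
  have "(grad_form \<phi> z - potential_form T \<phi> z - 1/2 * potential_form S \<psi> z = \<Lambda> * L2_form \<phi> z
    \<and> grad_form \<psi> z - 1/2 * potential_form S \<phi> z - potential_form T \<psi> z = \<Lambda> * L2_form \<psi> z)
    \<longleftrightarrow> (grad_form (\<phi> + \<psi>) z + potential_form pot_plus (\<phi> + \<psi>) z = \<Lambda> * L2_form (\<phi> + \<psi>) z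
    \<and> grad_form (\<phi> - \<psi>) z + potential_form pot_minus (\<phi> - \<psi>) z = \<Lambda> * L2_form (\<phi> - \<psi>) z)"
    if z: "z \<in> H10 \<Omega>" for z
  proof -
    note bl = sym_bilinear_onD(3,7)[OF _ subspace_H10 z p q]
    have e: "grad_form (\<phi> + \<psi>) z = grad_form \<phi> z + grad_form \<psi> z" "grad_form (\<phi> - \<psi>) z = grad_form \<phi> z - grad_form \<psi> z"
      "\<Lambda> * L2_form (\<phi> + \<psi>) z = \<Lambda> * L2_form \<phi> z + \<Lambda> * L2_form \<psi> z"
      "\<Lambda> * L2_form (\<phi> - \<psi>) z = \<Lambda> * L2_form \<phi> z - \<Lambda> * L2_form \<psi> z"
      "potential_form S (\<phi> + \<psi>) z = potential_form S \<phi> z + potential_form S \<psi> z"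
      "potential_form S (\<phi> - \<psi>) z = potential_form S \<phi> z - potential_form S \<psi> z"
      "potential_form T (\<phi> + \<psi>) z = potential_form T \<phi> z + potential_form T \<psi> z"
      "potential_form T (\<phi> - \<psi>) z = potential_form T \<phi> z - potential_form T \<psi> z"
      using bl[OF grad_form_bilinear] bl[OF L2_form_bilinear] bl[OF potential_form_bilinear[OF S_meas S_bound]]
        bl[OF potential_form_bilinear[OF T_meas T_bound]] by (simp_all add: distrib_left right_diff_distrib)
    show ?thesis
      unfolding potential_form_split[OF pq(1) z] potential_form_split[OF pq(2) z] e by argo
  qed
  then show ?thesis unfolding L R by simp
qed

lemma coupled_morse_index:
  assumes Q: "\<And>\<phi> \<psi>. Q (\<phi>, \<psi>) = (LINT x|M. (norm (wgrad \<Omega> \<phi> x))\<^sup>2 + (norm (wgrad \<Omega> \<psi> x))\<^sup>2)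
     - (LINT x|M. S x * (rep_aefun \<phi> x * rep_aefun \<psi> x) + T x * ((rep_aefun \<phi> x)\<^sup>2 + (rep_aefun \<psi> x)\<^sup>2))"
  shows "(SUP V\<in>{V. subspace V \<and> V \<subseteq> H10 \<Omega> \<times> H10 \<Omega> \<and> (\<forall>w\<in>V. w \<noteq> 0 \<longrightarrow> Q w < 0)}. edim V)
    = num_neg_eigenvalues \<Omega> pot_plus + num_neg_eigenvalues \<Omega> pot_minus"
  unfolding compact_form_eigenspaces(3)[OF pot_plus] compact_form_eigenspaces(3)[OF pot_minus]
  by (rule morse_index_decoupled[OF compact_form_H10[OF pot_plus] compact_form_H10[OF pot_minus]])
    (unfold Q, rule coupled_form_decouples)

text \<open>An eigenfunction \<open>(\<phi>, \<psi>)\<close> is \<open>(p, p) + (q, - q)\<close> with \<open>p = (\<phi> + \<psi>)/2\<close> and \<open>q = (\<phi> - \<psi>)/2\<close>, each of which is zero or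
a scalar eigenfunction for the same eigenvalue. Conversely \<open>(\<phi>, \<phi>)\<close> has difference zero and \<open>(\<psi>, - \<psi>)\<close> has
sum zero, and zero belongs to every eigenspace.\<close>

lemma coupled_negative_eigenspace:
  "span {(\<phi>, \<psi>) |\<phi> \<psi> \<Lambda>. \<Lambda> < 0 \<and> (\<phi>, \<psi>) \<noteq> 0 \<and>
      \<phi> + \<psi> \<in> eigenspace \<Omega> pot_plus \<Lambda> \<and> \<phi> - \<psi> \<in> eigenspace \<Omega> pot_minus \<Lambda>}
   = span ({(\<phi>, \<phi>) |\<phi> \<mu>. \<mu> \<in> neg_eigenvalues \<Omega> pot_plus \<and> \<phi> \<in> eigenspace \<Omega> pot_plus \<mu>}
         \<union> {(\<psi>, - \<psi>) |\<psi> \<nu>. \<nu> \<in> neg_eigenvalues \<Omega> pot_minus \<and> \<psi> \<in> eigenspace \<Omega> pot_minus \<nu>})"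
  (is "span ?W = span (?A \<union> ?B)")
proof (rule antisym; rule span_minimal[OF _ subspace_span]; rule subsetI)
  fix w assume "w \<in> ?W"
  then obtain \<phi> \<psi> \<Lambda> where w: "w = (\<phi>, \<psi>)" "\<Lambda> < 0" "\<phi> + \<psi> \<in> eigenspace \<Omega> pot_plus \<Lambda>"
    "\<phi> - \<psi> \<in> eigenspace \<Omega> pot_minus \<Lambda>" by blast
  define p q where "p = (1/2) *\<^sub>R (\<phi> + \<psi>)" and "q = (1/2) *\<^sub>R (\<phi> - \<psi>)"
  have p: "p \<in> eigenspace \<Omega> pot_plus \<Lambda>" and q: "q \<in> eigenspace \<Omega> pot_minus \<Lambda>"
    unfolding p_def q_def using subspace_scale[OF subspace_eigenspace(1)[OF pot_plus] w(3)]
      subspace_scale[OF subspace_eigenspace(1)[OF pot_minus] w(4)] by blast+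
  have "(p, p) \<in> span (?A \<union> ?B)"
  proof (cases "p = 0")
    case True
    show ?thesis unfolding True minus_zero zero_prod_def[symmetric] by (rule span_zero)
  next
    case False
    then have "\<Lambda> \<in> neg_eigenvalues \<Omega> pot_plus" unfolding neg_eigenvalues_def using w(2) p by blast
    then have "(p, p) \<in> ?A" using p by blast
    then show ?thesis by (intro span_base) blast
  qed
  moreover have "(q, - q) \<in> span (?A \<union> ?B)"
  proof (cases "q = 0")
    case True
    show ?thesis unfolding True minus_zero zero_prod_def[symmetric] by (rule span_zero)
  next
    case False
    then have "\<Lambda> \<in> neg_eigenvalues \<Omega> pot_minus" unfolding neg_eigenvalues_def using w(2) q by blast
    then have "(q, - q) \<in> ?B" using q by blast
    then show ?thesis by (intro span_base) blast
  qed
  ultimately have "(p, p) + (q, - q) \<in> span (?A \<union> ?B)" by (rule span_add)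
  moreover have "p + q = \<phi>" "p - q = \<psi>"
    unfolding p_def q_def scaleR_add_right[symmetric] scaleR_diff_right[symmetric]
    by (simp_all add: scaleR_2[symmetric] del: scaleR_2)
  ultimately show "w \<in> span (?A \<union> ?B)" using w(1) by simp
next
  fix w assume "w \<in> ?A \<union> ?B"
  then show "w \<in> span ?W"
  proof
    assume "w \<in> ?A"
    then obtain \<phi> \<mu> where w: "w = (\<phi>, \<phi>)" "\<mu> \<in> neg_eigenvalues \<Omega> pot_plus" "\<phi> \<in> eigenspace \<Omega> pot_plus \<mu>" by blast
    show ?thesis
    proof (cases "\<phi> = 0")
      case True
      show ?thesis unfolding w(1) True minus_zero zero_prod_def[symmetric] by (rule span_zero)
    next
      case False
      have "\<phi> + \<phi> \<in> eigenspace \<Omega> pot_plus \<mu>" by (rule subspace_add[OF subspace_eigenspace(1)[OF pot_plus] w(3) w(3)])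
      moreover have "\<phi> - \<phi> \<in> eigenspace \<Omega> pot_minus \<mu>" using subspace_0[OF subspace_eigenspace(1)[OF pot_minus]] by simp
      moreover have "(\<phi>, \<phi>) \<noteq> 0" using False by (simp add: zero_prod_def)
      moreover have "\<mu> < 0" using w(2) unfolding neg_eigenvalues_def by blast
      ultimately have "w \<in> ?W" unfolding w(1) by blast
      then show ?thesis by (rule span_base)
    qed
  next
    assume "w \<in> ?B"
    then obtain \<psi> \<nu> where w: "w = (\<psi>, - \<psi>)" "\<nu> \<in> neg_eigenvalues \<Omega> pot_minus" "\<psi> \<in> eigenspace \<Omega> pot_minus \<nu>" by blast
    show ?thesis
    proof (cases "\<psi> = 0")
      case True
      show ?thesis unfolding w(1) True minus_zero zero_prod_def[symmetric] by (rule span_zero)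
    next
      case False
      have "\<psi> - (- \<psi>) \<in> eigenspace \<Omega> pot_minus \<nu>"
        using subspace_add[OF subspace_eigenspace(1)[OF pot_minus] w(3) w(3)] by simp
      moreover have "\<psi> + (- \<psi>) \<in> eigenspace \<Omega> pot_plus \<nu>" using subspace_0[OF subspace_eigenspace(1)[OF pot_plus]] by simp
      moreover have "(\<psi>, - \<psi>) \<noteq> 0" using False by (simp add: zero_prod_def)
      moreover have "\<nu> < 0" using w(2) unfolding neg_eigenvalues_def by blast
      ultimately have "w \<in> ?W" unfolding w(1) by blast
      then show ?thesis by (rule span_base)
    qed
  qed
qed

lemma no_negative_eigenvalues:
  assumes nn: "AE x in M. 0 \<le> pot_minus x"
  shows "neg_eigenvalues \<Omega> pot_minus = {}"
proof (rule ccontr)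
  assume "neg_eigenvalues \<Omega> pot_minus \<noteq> {}"
  then obtain \<nu> \<psi> where n: "\<nu> < 0" "\<psi> \<in> eigenspace \<Omega> pot_minus \<nu>" "\<psi> \<noteq> 0"
    unfolding neg_eigenvalues_def by blast
  have psi: "\<psi> \<in> H10 \<Omega>" "grad_form \<psi> \<psi> + potential_form pot_minus \<psi> \<psi> = \<nu> * L2_form \<psi> \<psi>"
    using n(2) unfolding eigenspace_eq[OF pot_minus] by blast+
  have "\<nu> * L2_form \<psi> \<psi> < 0" using n(1) L2_form_pos[OF psi(1) n(3)] by (rule mult_neg_pos)
  moreover have "potential_form pot_minus \<psi> \<psi> \<ge> 0"
    unfolding potential_form_def using nn by (intro integral_nonneg_AE) (auto elim!: eventually_mono)
  ultimately show False using psi(2) grad_form_nonneg[of \<psi>] by linarith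
qed

end

section \<open>Hamiltonian systems\<close>

theorem proposition1p1:
  fixes \<Omega> :: "'a::euclidean_space set"
    and H :: "'a \<Rightarrow> real \<Rightarrow> real \<Rightarrow> real"
    and u v :: "'a aefun"
    and a b :: "'a \<Rightarrow> real"
  assumes dimension: "DIM('a) \<ge> 2"
    and domain: "bounded_smooth_domain \<Omega>"
    and H_continuous: "\<And>s t. continuous_on \<Omega> (\<lambda>x. H x s t)"
    and H_C2: "\<And>x. x \<in> \<Omega> \<Longrightarrow> Ck_on 2 (UNIV :: (real \<times> real) set) (\<lambda>(s, t). H x s t)"
    and solution: "hamiltonian_solution \<Omega> H u v"
    and bounded_uu: "ess_bounded_on \<Omega> (along (Huu H) u v)"
    and bounded_vv: "ess_bounded_on \<Omega> (along (Hvv H) u v)"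
    and bounded_uv: "ess_bounded_on \<Omega> (along (Huv H) u v)"
    and a: "a = (\<lambda>x. - 1/2 * (along (Huu H) u v x + along (Hvv H) u v x) - along (Huv H) u v x)"
    and b: "b = (\<lambda>x. 1/2 * (along (Huu H) u v x + along (Hvv H) u v x) - along (Huv H) u v x)"
  shows "lin_morse_index \<Omega> H u v = num_neg_eigenvalues \<Omega> a + num_neg_eigenvalues \<Omega> b
    \<and> neg_eigenspace \<Omega> H u v =
        span ({(\<phi>, \<phi>) |\<phi> \<mu>. \<mu> \<in> neg_eigenvalues \<Omega> a \<and> \<phi> \<in> eigenspace \<Omega> a \<mu>}
            \<union> {(\<psi>, - \<psi>) |\<psi> \<nu>. \<nu> \<in> neg_eigenvalues \<Omega> b \<and> \<psi> \<in> eigenspace \<Omega> b \<nu>})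
    \<and> ((\<forall>x\<in>\<Omega>. \<forall>s t. Huu H x s t \<ge> 0 \<and> Hvv H x s t \<ge> 0 \<and>
                       Huu H x s t * Hvv H x s t \<ge> (Huv H x s t)\<^sup>2)
        \<longrightarrow> lin_morse_index \<Omega> H u v = num_neg_eigenvalues \<Omega> a
          \<and> neg_eigenspace \<Omega> H u v \<subseteq> {(\<phi>, \<phi>) |\<phi>. \<phi> \<in> H10 \<Omega>})"
proof -
  have dom: "open \<Omega>" "bounded \<Omega>" using domain unfolding bounded_smooth_domain_def by auto
  interpret bounded_open_set \<Omega> by unfold_locales (fact dom)+
  have uv: "u \<in> H10 \<Omega>" "v \<in> H10 \<Omega>"
    using solution unfolding hamiltonian_solution_def weak_dirichlet_def by auto
  have spM: "space M = \<Omega>" by (simp add: space_restrict_space)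
  have H_meas: "(\<lambda>x. H x s t) \<in> borel_measurable M" for s t
    by (rule continuous_imp_measurable_on_sets_lebesgue[OF H_continuous]) (use dom in simp)
  have C2: "Ck_on 2 UNIV (\<lambda>(s, t). H x s t)" if "x \<in> space M" for x
    using H_C2 that spM by simp
  note meas = second_derivatives_measurable[OF H_meas C2 l2_measurable[OF H10_l2(1)[OF uv(1)]] l2_measurable[OF H10_l2(1)[OF uv(2)]]]
  define S where "S = (\<lambda>x. along (Huu H) u v x + along (Hvv H) u v x)"
  define T where "T = along (Huv H) u v"
  obtain k1 k2 k3 where k: "AE x in M. \<bar>along (Huu H) u v x\<bar> \<le> k1" "AE x in M. \<bar>along (Hvv H) u v x\<bar> \<le> k2"
    "AE x in M. \<bar>T x\<bar> \<le> k3"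
    using bounded_uu bounded_vv bounded_uv unfolding ess_bounded_on_def T_def by blast
  interpret coupled_system \<Omega> S T "k1 + k2" k3
  proof unfold_locales
    show "S \<in> borel_measurable M" unfolding S_def by (intro borel_measurable_add meas)
    show "T \<in> borel_measurable M" unfolding T_def by (rule meas)
    show "AE x in M. \<bar>S x\<bar> \<le> k1 + k2" using k(1,2) unfolding S_def by eventually_elim linarith
    show "AE x in M. \<bar>T x\<bar> \<le> k3" by (rule k(3))
  qed
  have ab: "a = pot_plus" "b = pot_minus" unfolding a b S_def T_def by simp_all
  have morse: "lin_morse_index \<Omega> H u v = num_neg_eigenvalues \<Omega> a + num_neg_eigenvalues \<Omega> b"
    unfolding lin_morse_index_def ab
    by (rule coupled_morse_index) (simp add: Qlin_def S_def T_def)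
  have neg: "neg_eigenspace \<Omega> H u v =
        span ({(\<phi>, \<phi>) |\<phi> \<mu>. \<mu> \<in> neg_eigenvalues \<Omega> a \<and> \<phi> \<in> eigenspace \<Omega> a \<mu>}
            \<union> {(\<psi>, - \<psi>) |\<psi> \<nu>. \<nu> \<in> neg_eigenvalues \<Omega> b \<and> \<psi> \<in> eigenspace \<Omega> b \<nu>})"
  proof -
    have "sym_eigenfunction \<Omega> H u v \<Lambda> (\<phi>, \<psi>) \<longleftrightarrow> (\<phi>, \<psi>) \<noteq> 0 \<and>
        \<phi> + \<psi> \<in> eigenspace \<Omega> pot_plus \<Lambda> \<and> \<phi> - \<psi> \<in> eigenspace \<Omega> pot_minus \<Lambda>" for \<Lambda> \<phi> \<psi>
      unfolding coupled_eigenfunction_iff[symmetric] unfolding sym_eigenfunction_def S_def T_def by simp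
    then have "{w. \<exists>\<Lambda><0. sym_eigenfunction \<Omega> H u v \<Lambda> w} = {(\<phi>, \<psi>) |\<phi> \<psi> \<Lambda>. \<Lambda> < 0 \<and> (\<phi>, \<psi>) \<noteq> 0 \<and>
        \<phi> + \<psi> \<in> eigenspace \<Omega> pot_plus \<Lambda> \<and> \<phi> - \<psi> \<in> eigenspace \<Omega> pot_minus \<Lambda>}"
      by (auto simp del: split_paired_Ex)
    then show ?thesis unfolding neg_eigenspace_def ab using coupled_negative_eigenspace by simp
  qed
  have conv: "lin_morse_index \<Omega> H u v = num_neg_eigenvalues \<Omega> a \<and> neg_eigenspace \<Omega> H u v \<subseteq> {(\<phi>, \<phi>) |\<phi>. \<phi> \<in> H10 \<Omega>}"
    if convex: "\<forall>x\<in>\<Omega>. \<forall>s t. Huu H x s t \<ge> 0 \<and> Hvv H x s t \<ge> 0 \<and> Huu H x s t * Hvv H x s t \<ge> (Huv H x s t)\<^sup>2"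
  proof -
    have "0 \<le> pot_minus x" if x: "x \<in> \<Omega>" for x
    proof -
      define \<alpha> \<beta> \<gamma> where "\<alpha> = along (Huu H) u v x" and "\<beta> = along (Hvv H) u v x" and "\<gamma> = along (Huv H) u v x"
      have c: "\<alpha> \<ge> 0" "\<beta> \<ge> 0" "\<gamma>\<^sup>2 \<le> \<alpha> * \<beta>" using convex x unfolding \<alpha>_def \<beta>_def \<gamma>_def along_def by auto
      (* the geometric mean of H_uu and H_vv bounds H_uv and is bounded by the arithmetic mean *)
      have "0 \<le> (\<alpha> - \<beta>)\<^sup>2" by simp
      then have "\<gamma>\<^sup>2 \<le> ((\<alpha> + \<beta>) / 2)\<^sup>2" using c(3) by (simp add: power2_eq_square field_simps)
      then have "\<bar>\<gamma>\<bar> \<le> (\<alpha> + \<beta>) / 2" using c by (intro power2_le_imp_le[of "\<bar>\<gamma>\<bar>"]) simp_all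
      then show ?thesis unfolding S_def T_def \<alpha>_def[symmetric] \<beta>_def[symmetric] \<gamma>_def[symmetric] by linarith
    qed
    then have "AE x in M. 0 \<le> pot_minus x" using spM by (intro AE_I2) simp
    then have empty: "neg_eigenvalues \<Omega> b = {}" unfolding ab by (rule no_negative_eigenvalues)
    have "num_neg_eigenvalues \<Omega> b = 0" unfolding num_neg_eigenvalues_def empty by simp
    then have 1: "lin_morse_index \<Omega> H u v = num_neg_eigenvalues \<Omega> a" using morse by simp
    have diag: "subspace {(\<phi>, \<phi>) |\<phi>. \<phi> \<in> H10 \<Omega>}"
    proof -
      have "{(\<phi>, \<phi>) |\<phi>. \<phi> \<in> H10 \<Omega>} = (\<lambda>\<phi>. (\<phi>, \<phi>)) ` H10 \<Omega>" by blast
      moreover have "linear (\<lambda>\<phi> :: 'a aefun. (\<phi>, \<phi>))" by (intro linearI) simp_all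
      ultimately show ?thesis using linear_subspace_image subspace_H10 by metis
    qed
    have "neg_eigenspace \<Omega> H u v \<subseteq> {(\<phi>, \<phi>) |\<phi>. \<phi> \<in> H10 \<Omega>}"
      unfolding neg
    proof (rule span_minimal[OF _ diag])
      show "{(\<phi>, \<phi>) |\<phi> \<mu>. \<mu> \<in> neg_eigenvalues \<Omega> a \<and> \<phi> \<in> eigenspace \<Omega> a \<mu>}
            \<union> {(\<psi>, - \<psi>) |\<psi> \<nu>. \<nu> \<in> neg_eigenvalues \<Omega> b \<and> \<psi> \<in> eigenspace \<Omega> b \<nu>} \<subseteq> {(\<phi>, \<phi>) |\<phi>. \<phi> \<in> H10 \<Omega>}"
        unfolding empty unfolding ab using subspace_eigenspace(2)[OF pot_plus] by blast
    qed
    then show ?thesis using 1 by simp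
  qed
  show ?thesis using morse neg conv by blast
qed

end
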